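(* Let $\mathbb{D}=\{z\in\mathbb{C}\colon |z|<1\}$ and, for $0<r<1$, let $\mathbb{D}_r=\{z\in\mathbb{C}\colon |z|<r\}$. Let $f\colon \mathbb{D}\to\mathbb{D}$ be a bijective harmonic map. Then \[ |f(\mathbb{D}_r)| \leqslant |\mathbb{D}_r| \quad\text{for all } 0<r<1, \] where $|E|$ denotes the area (planar Lebesgue measure) of a set $E$. Moreover, if equality $|f(\mathbb{D}_r)| = |\mathbb{D}_r|$ holds for some $r\in(0,1)$, then $f$ is an isometry (of the Euclidean metric).
   Context: A map $f\colon\mathbb{D}\to\mathbb{C}$ is harmonic if its real and imaginary parts are harmonic functions, i.e. $\partial\bar\partial f=0$; $f$ need not be holomorphic. *)

theory Defs
  imports "HOL-Analysis.Analysis"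
begin

definition harmonic_real_on :: "(complex \<Rightarrow> real) \<Rightarrow> complex set \<Rightarrow> bool" where
  "harmonic_real_on u S \<longleftrightarrow>
     (\<exists>(Du :: complex \<Rightarrow> complex \<Rightarrow>\<^sub>L real) (D2u :: complex \<Rightarrow> complex \<Rightarrow>\<^sub>L (complex \<Rightarrow>\<^sub>L real)).
        (\<forall>z\<in>S. (u has_derivative blinfun_apply (Du z)) (at z)) \<and>
        (\<forall>z\<in>S. (Du has_derivative blinfun_apply (D2u z)) (at z)) \<and>
        continuous_on S D2u \<and>
        (\<forall>z\<in>S. blinfun_apply (blinfun_apply (D2u z) 1) 1
                + blinfun_apply (blinfun_apply (D2u z) \<i>) \<i> = 0))"

definition harmonic_on :: "(complex \<Rightarrow> complex) \<Rightarrow> complex set \<Rightarrow> bool" where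
  "harmonic_on f S \<longleftrightarrow> harmonic_real_on (\<lambda>z. Re (f z)) S \<and> harmonic_real_on (\<lambda>z. Im (f z)) S"

end

theory Submission
  imports Defs "HOL-Complex_Analysis.Complex_Analysis"
begin

text \<open>
  Write \<open>f = h + cnj g\<close> with \<open>h\<close>, \<open>g\<close> holomorphic and Taylor coefficients \<open>a n\<close>, \<open>b n\<close>. As the Jacobian
  of an injective harmonic map does not change sign, the area of \<open>f (D_r)\<close> is
  \<open>\<bar>pi * (\<Sum>n. n * (\<bar>a n\<bar>\<^sup>2 - \<bar>b n\<bar>\<^sup>2) * r ^ (2 * n))\<bar>\<close>. Since \<open>\<bar>f\<bar>\<close> tends to \<open>1\<close> at the circle, \<open>f\<close> is the
  Poisson integral of a unimodular function \<open>F\<close>. The preimage of a half disc is connected, so by the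
  maximum principle and planar topology the set where \<open>F\<close> lies in a half plane through \<open>0\<close> is an arc.

  Since \<open>F\<close> is the average of \<open>e^(i x) * sgn (Re (e^(-i x) * F)) / 4\<close> over \<open>x\<close>, the area becomes an integral
  over pairs \<open>(x, x + u)\<close> of \<open>sin u\<close> times \<open>\<Phi> m1 + \<Phi> m2 + \<Phi> m3 + \<Phi> m4\<close>, up to sign, where the \<open>m_i\<close> are the
  harmonic measures of the four sectors cut out by two lines, of mean \<open>u\<close>, \<open>pi - u\<close>, \<open>u\<close>, \<open>pi - u\<close>, and
  \<open>\<Phi> v = (\<Sum>n. r ^ (2 * n) * sin (n * v) / n)\<close> is concave on \<open>[0, pi]\<close>. A version of Jensen's inequality
  for the sum over the four gaps gives the bound. A multiple of \<open>sin v\<close> can be subtracted from \<open>\<Phi>\<close>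
  without losing concavity; this forces \<open>\<bar>\<bar>a 1\<bar>\<^sup>2 - \<bar>b 1\<bar>\<^sup>2\<bar> = 1\<close> in the case of equality.
\<close>


section \<open>Concave kernels\<close>

text \<open>Concavity on \<open>[0, pi]\<close> alone is not enough: one of the four gaps may exceed
  \<open>pi\<close>, where an odd periodic kernel turns convex. Hence the tangent form
  \<open>four_gaps\<close>, taken at the mean gap lengths \<open>pi - u\<close> and
  \<open>u\<close>. For a fixed pair of lines the gaps differ from these means, but the error is
  linear in the total length of one opposite pair, that is in \<open>side_corr x (x + u)\<close>.
  For every unimodular value of \<open>F\<close> the average over \<open>x\<close> of the sign
  product is the same number, so the error integrates to zero whatever \<open>F\<close> is. For a
  rotation the gaps equal their means and the gap estimates are equalities, so the bound is sharp.
  The orientation of \<open>f\<close> is unknown. As the kernel sum over the four gaps is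
  nonnegative, one upper bound serves both signs. Boundary values are taken along a sequence of
  radii: since \<open>cmod (hp z)\<close> tends to 1, the restrictions to circles are L2 Cauchy, and
  a subsequence converges almost everywhere. This suffices for the Poisson formula and for the
  crossing argument.\<close>

locale concave_kernel =
  fixes \<Phi> \<phi> :: "real \<Rightarrow> real"
  assumes deriv: "\<And>v. (\<Phi> has_real_derivative \<phi> v) (at v)"
    and anti: "\<And>v w. 0 \<le> v \<Longrightarrow> v \<le> w \<Longrightarrow> w \<le> pi \<Longrightarrow> \<phi> w \<le> \<phi> v"
    and odd: "\<And>v. \<Phi> (- v) = - \<Phi> v"
    and periodic: "\<And>v. \<Phi> (v + 2 * pi) = \<Phi> v"
begin

lemma zero: "\<Phi> 0 = 0"
  using odd[of 0] by simp

lemma reflect: "\<Phi> (2 * pi - v) = - \<Phi> v"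
  using periodic[of "- v"] odd[of v] by (simp add: algebra_simps)

lemma at_pi: "\<Phi> pi = 0"
  using reflect[of pi] by simp

lemma tangent:
  assumes "0 \<le> v" "v \<le> pi" "0 \<le> a" "a \<le> pi"
  shows "\<Phi> v \<le> \<Phi> a + \<phi> a * (v - a)"
proof (cases v a rule: linorder_cases)
  case less
  obtain z where "v < z" "z < a" and eq: "\<Phi> a - \<Phi> v = (a - v) * \<phi> z"
    using MVT2[OF less, of \<Phi> \<phi>] deriv by blast
  then have "\<phi> a \<le> \<phi> z" using assms anti by simp
  then have "(a - v) * \<phi> a \<le> (a - v) * \<phi> z" using less by (intro mult_left_mono) auto
  then show ?thesis using eq by (simp add: algebra_simps)
next
  case greater
  obtain z where "a < z" "z < v" and eq: "\<Phi> v - \<Phi> a = (v - a) * \<phi> z"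
    using MVT2[OF greater, of \<Phi> \<phi>] deriv by blast
  then have "\<phi> z \<le> \<phi> a" using assms anti by simp
  then have "(v - a) * \<phi> z \<le> (v - a) * \<phi> a" using greater by (intro mult_left_mono) auto
  then show ?thesis using eq by (simp add: algebra_simps)
qed auto

text \<open>Over a window of fixed width \<open>d\<close> the increment of a concave function
  decreases as the window moves right, since its derivative is
  \<open>\<phi> (x + d) - \<phi> x\<close>. This is what allows mass to be moved between
  gaps.\<close>

lemma increments:
  assumes "0 \<le> c" "c \<le> s" "0 \<le> d" "s + d \<le> pi"
  shows "\<Phi> (s + d) - \<Phi> s \<le> \<Phi> (c + d) - \<Phi> c"
proof -
  have "(\<lambda>x. \<Phi> (x + d) - \<Phi> x) c \<ge> (\<lambda>x. \<Phi> (x + d) - \<Phi> x) s"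
  proof (rule DERIV_nonpos_imp_nonincreasing[OF assms(2)])
    fix x assume x: "c \<le> x" "x \<le> s"
    have "((\<lambda>x. \<Phi> (x + d) - \<Phi> x) has_real_derivative \<phi> (x + d) - \<phi> x) (at x)"
      by (intro DERIV_diff deriv) (use deriv[of "x + d"] DERIV_shift in blast)
    moreover have "\<phi> (x + d) - \<phi> x \<le> 0" using x assms anti[of x "x + d"] by simp
    ultimately show "\<exists>y. ((\<lambda>x. \<Phi> (x + d) - \<Phi> x) has_real_derivative y) (at x) \<and> y \<le> 0" by blast
  qed
  then show ?thesis by simp
qed

text \<open>The tangent at \<open>v\<close> is compared with the kernel at its two zeros
  \<open>0\<close> and \<open>pi\<close>; the sign of \<open>\<phi> v\<close> decides which of the
  two comparisons gives the bound.\<close>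

lemma nonneg: "0 \<le> v \<Longrightarrow> v \<le> pi \<Longrightarrow> 0 \<le> \<Phi> v"
proof -
  assume v: "0 \<le> v" "v \<le> pi"
  have "0 \<le> \<phi> v * v \<or> 0 \<le> - \<phi> v * (pi - v)"
    using v by (cases "0 \<le> \<phi> v") (auto intro: mult_nonneg_nonneg simp: mult_nonpos_nonneg)
  then show ?thesis using tangent[of 0 v] tangent[of pi v] v by (auto simp: zero at_pi)
qed

lemma subadditive: "0 \<le> a \<Longrightarrow> 0 \<le> b \<Longrightarrow> a + b \<le> pi \<Longrightarrow> \<Phi> (a + b) \<le> \<Phi> a + \<Phi> b"
  using increments[of 0 a b] by (simp add: zero)

text \<open>By reflection, a gap beyond \<open>pi\<close> contributes minus the kernel at the sum of
  the other three gaps, and subadditivity compensates for it.\<close>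

lemma four_gaps_nonneg_aux:
  assumes "0 \<le> b" "0 \<le> c" "0 \<le> d" "b + c + d \<le> pi"
  shows "0 \<le> \<Phi> (2 * pi - (b + c + d)) + \<Phi> b + \<Phi> c + \<Phi> d"
  using reflect[of "b + c + d"] subadditive[of "b + c" d] subadditive[of b c] assms by simp

text \<open>Turns the upper bound of \<open>four_gaps\<close> into a bound for the absolute value,
  as required when the orientation is unknown.\<close>

lemma four_gaps_nonneg:
  assumes "0 \<le> a" "0 \<le> b" "0 \<le> c" "0 \<le> d" "a + b + c + d = 2 * pi"
  shows "0 \<le> \<Phi> a + \<Phi> b + \<Phi> c + \<Phi> d"
proof -
  have e: "a = 2 * pi - (b + c + d)" "b = 2 * pi - (a + c + d)"
    "c = 2 * pi - (a + b + d)" "d = 2 * pi - (a + b + c)" using assms by auto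
  consider "a \<ge> pi" | "b \<ge> pi" | "c \<ge> pi" | "d \<ge> pi" | "a \<le> pi \<and> b \<le> pi \<and> c \<le> pi \<and> d \<le> pi"
    by linarith
  then show ?thesis
  proof cases
    case 1 then show ?thesis using four_gaps_nonneg_aux[of b c d] assms e(1) by simp
  next
    case 2 then show ?thesis using four_gaps_nonneg_aux[of a c d] assms e(2) by simp
  next
    case 3 then show ?thesis using four_gaps_nonneg_aux[of a b d] assms e(3) by simp
  next
    case 4 then show ?thesis using four_gaps_nonneg_aux[of a b c] assms e(4) by simp
  next
    case 5 then show ?thesis using nonneg assms by simp
  qed
qed

text \<open>If the gap \<open>a\<close> exceeds \<open>pi\<close>, shifting mass from it to the opposite gap \<open>c\<close> until \<open>a = pi\<close>
  increases the left-hand side and leaves the right-hand side unchanged.\<close>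
lemma four_gaps_aux:
  assumes nn: "0 \<le> a" "0 \<le> b" "0 \<le> c" "0 \<le> d" and s: "a + b + c + d = 2 * pi"
    and bd: "b \<le> pi" "c \<le> pi" "d \<le> pi" and p: "0 \<le> p" "p \<le> pi" and q: "0 \<le> q" "q \<le> pi"
  shows "\<Phi> a + \<Phi> b + \<Phi> c + \<Phi> d \<le> 2 * \<Phi> p + 2 * \<Phi> q + \<phi> p * (a + c - 2 * p) + \<phi> q * (b + d - 2 * q)"
proof -
  have main: "\<Phi> a' + \<Phi> b + \<Phi> c' + \<Phi> d \<le> 2 * \<Phi> p + 2 * \<Phi> q + \<phi> p * (a' + c' - 2 * p) + \<phi> q * (b + d - 2 * q)"
    if "0 \<le> a'" "a' \<le> pi" "0 \<le> c'" "c' \<le> pi" for a' c'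
    using tangent[OF that(1,2) p] tangent[OF that(3,4) p] tangent[of b, OF _ _ q] tangent[of d, OF _ _ q] nn bd
    by (simp add: algebra_simps)
  show ?thesis
  proof (cases "a \<le> pi")
    case True then show ?thesis using main[of a c] nn bd by simp
  next
    case False
    have "\<Phi> a = - \<Phi> (b + c + d)"
    proof -
      have "a = 2 * pi - (b + c + d)" using s by simp
      then show ?thesis by (simp only: reflect)
    qed
    \<comment> \<open>Since \<open>b + c + d = pi - (a - pi)\<close>, the window of width
      \<open>a - pi\<close> starting there ends at \<open>pi\<close>, a zero of the kernel; moving
      its start down to \<open>c\<close> can only increase the increment.\<close>
    moreover have "\<Phi> (b + c + d + (a - pi)) - \<Phi> (b + c + d) \<le> \<Phi> (c + (a - pi)) - \<Phi> c"
      by (rule increments) (use False nn s in auto)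
    moreover have "b + c + d + (a - pi) = pi" using s by simp
    ultimately have "\<Phi> a + \<Phi> c \<le> \<Phi> (c + (a - pi))" using at_pi by simp
    moreover have "a + c = pi + (c + (a - pi))" by simp
    ultimately show ?thesis using main[of pi "c + (a - pi)"] False nn s at_pi by (simp add: add.commute)
  qed
qed

text \<open>The claim is symmetric under a swap inside an opposite pair and under an exchange of the
  pairs together with \<open>p\<close> and \<open>q\<close>. At most one gap can lie strictly above
  \<open>pi\<close>, so it may be taken as the first one of \<open>four_gaps_aux\<close>.\<close>

lemma four_gaps:
  assumes nn: "0 \<le> a" "0 \<le> b" "0 \<le> c" "0 \<le> d" and s: "a + b + c + d = 2 * pi"
    and p: "0 \<le> p" "p \<le> pi" and q: "0 \<le> q" "q \<le> pi"
  shows "\<Phi> a + \<Phi> b + \<Phi> c + \<Phi> d \<le> 2 * \<Phi> p + 2 * \<Phi> q + \<phi> p * (a + c - 2 * p) + \<phi> q * (b + d - 2 * q)"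
proof -
  consider "b \<le> pi \<and> c \<le> pi \<and> d \<le> pi" | "a \<le> pi \<and> b \<le> pi \<and> d \<le> pi"
    | "a \<le> pi \<and> c \<le> pi \<and> d \<le> pi" | "a \<le> pi \<and> b \<le> pi \<and> c \<le> pi"
    using nn s by linarith
  then show ?thesis
  proof cases
    case 1 then show ?thesis using four_gaps_aux[of a b c d p q] assms by simp
  next
    case 2 then show ?thesis using four_gaps_aux[of c b a d p q] assms by (simp add: algebra_simps)
  next
    case 3 then show ?thesis using four_gaps_aux[of b a d c q p] assms by (simp add: algebra_simps)
  next
    case 4 then show ?thesis using four_gaps_aux[of d a b c q p] assms by (simp add: algebra_simps)
  qed
qed

end

text \<open>\<open>- Ln (1 - z)\<close> is the sum of \<open>z ^ n / n\<close>; its imaginary part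
  at \<open>of_real \<rho> * cis v\<close> is the kernel whose weights \<open>\<rho> ^ n\<close> are
  those of the area series when \<open>\<rho>\<close> is the squared radius. The term at
  \<open>n = 0\<close> is a division by zero, hence 0.\<close>

lemma log_kernel_sums:
  fixes \<rho> v :: real
  assumes "0 \<le> \<rho>" "\<rho> < 1"
  shows "(\<lambda>n. \<rho> ^ n * sin (real n * v) / real n) sums (- Im (Ln (1 - of_real \<rho> * cis v)))"
proof -
  have "norm (- (of_real \<rho> * cis v)) < 1" using assms by (simp add: norm_mult)
  then have "(\<lambda>n. - ((of_real \<rho> * cis v) ^ n) / of_nat n) sums Ln (1 - of_real \<rho> * cis v)"
    using Ln_series'[of "- (of_real \<rho> * cis v)"] by simp
  then have "(\<lambda>n. - Im (- ((of_real \<rho> * cis v) ^ n) / of_nat n)) sums - Im (Ln (1 - of_real \<rho> * cis v))"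
    by (intro sums_minus sums_Im)
  moreover have "- Im (- ((of_real \<rho> * cis v) ^ n) / of_nat n) = \<rho> ^ n * sin (real n * v) / real n" for n
  proof -
    have "(of_real \<rho> * cis v) ^ n = of_real (\<rho> ^ n) * cis (real n * v)"
      by (simp only: power_mult_distrib Complex.DeMoivre of_real_power)
    then show ?thesis by (simp add: Im_divide_of_nat del: of_real_power)
  qed
  ultimately show ?thesis by (simp only:)
qed

text \<open>The derivative of the logarithmic kernel is \<open>(P - 1) / 2\<close> with \<open>P\<close> the Poisson kernel, and
  \<open>\<kappa>\<close> is a lower bound for the derivative of \<open>P / 2\<close> with respect to \<open>cos v\<close>. The subtracted
  multiple of \<open>sin v\<close> is what detects the extremal maps.\<close>
lemma concave_kernel_log:
  fixes \<rho> \<kappa> :: real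
  assumes \<rho>: "0 < \<rho>" "\<rho> < 1" and \<kappa>: "\<kappa> = \<rho> * (1 - \<rho>) / (1 + \<rho>) ^ 3"
  shows "concave_kernel (\<lambda>v. - Im (Ln (1 - of_real \<rho> * cis v)) - \<kappa> * sin v)
     (\<lambda>v. ((1 - \<rho>\<^sup>2) / (1 + \<rho>\<^sup>2 - 2 * \<rho> * cos v) - 1) / 2 - \<kappa> * cos v)"
proof
  have D: "(1 - \<rho>)\<^sup>2 \<le> 1 + \<rho>\<^sup>2 - 2 * \<rho> * cos v" "1 + \<rho>\<^sup>2 - 2 * \<rho> * cos v \<le> (1 + \<rho>)\<^sup>2" for v
    using \<rho> mult_left_mono[OF cos_le_one[of v], of \<rho>] mult_left_mono[OF cos_ge_minus_one[of v], of \<rho>]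
    by (auto simp: power2_eq_square algebra_simps)
  have Dpos: "0 < 1 + \<rho>\<^sup>2 - 2 * \<rho> * cos v" for v
    using D(1)[of v] zero_less_power[of "1 - \<rho>" 2] \<rho> by linarith
  \<comment> \<open>A positive real part keeps the argument of \<open>Ln\<close> off the branch
    cut.\<close>
  have re: "0 < Re (1 - of_real \<rho> * cis v)" for v
  proof -
    have "\<rho> * cos v \<le> \<rho> * 1" using \<rho> by (intro mult_left_mono) auto
    moreover have "Re (1 - of_real \<rho> * cis v) = 1 - \<rho> * cos v" by simp
    ultimately show ?thesis using \<rho> by linarith
  qed
  fix v :: real
  have dcis: "((\<lambda>v. 1 - of_real \<rho> * cis v) has_vector_derivative - (of_real \<rho> * (\<i> * cis v))) (at v)"
    unfolding cis_conv_exp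
    by (rule has_vector_derivative_real_field) (auto intro!: derivative_eq_intros)
  have nn: "1 - of_real \<rho> * cis v \<notin> \<real>\<^sub>\<le>\<^sub>0" using re[of v] by (auto simp: complex_nonpos_Reals_iff)
  have "((\<lambda>v. Ln (1 - of_real \<rho> * cis v)) has_vector_derivative
      (- (of_real \<rho> * (\<i> * cis v))) * inverse (1 - of_real \<rho> * cis v)) (at v)"
    using field_vector_diff_chain_at[OF dcis has_field_derivative_Ln[OF nn]] by (simp add: o_def)
  then have "((\<lambda>v. Im (Ln (1 - of_real \<rho> * cis v))) has_vector_derivative
      Im ((- (of_real \<rho> * (\<i> * cis v))) * inverse (1 - of_real \<rho> * cis v))) (at v)"
    by (rule bounded_linear.has_vector_derivative[OF bounded_linear_Im])
  moreover have "Im ((- (of_real \<rho> * (\<i> * cis v))) * inverse (1 - of_real \<rho> * cis v))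
      = - ((1 - \<rho>\<^sup>2) / (1 + \<rho>\<^sup>2 - 2 * \<rho> * cos v) - 1) / 2"
  proof -
    have e: "(1 - \<rho> * cos v)\<^sup>2 + (\<rho> * sin v)\<^sup>2 = 1 + \<rho>\<^sup>2 - 2 * \<rho> * cos v"
      using sin_cos_squared_add[of v] by algebra
    have "(cmod (1 - of_real \<rho> * cis v))\<^sup>2 = 1 + \<rho>\<^sup>2 - 2 * \<rho> * cos v"
      unfolding cmod_power2 using e by simp
    then have "(- (of_real \<rho> * (\<i> * cis v))) * inverse (1 - of_real \<rho> * cis v)
      = (- (of_real \<rho> * (\<i> * cis v))) * cnj (1 - of_real \<rho> * cis v) / of_real (1 + \<rho>\<^sup>2 - 2 * \<rho> * cos v)"
      by (metis complex_div_cnj divide_inverse of_real_power)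
    also have "Im \<dots> = (- \<rho> * cos v * (1 - \<rho> * cos v) + \<rho> * sin v * (\<rho> * sin v)) / (1 + \<rho>\<^sup>2 - 2 * \<rho> * cos v)"
      unfolding Im_divide_of_real by simp
    also have "- \<rho> * cos v * (1 - \<rho> * cos v) + \<rho> * sin v * (\<rho> * sin v) = \<rho>\<^sup>2 - \<rho> * cos v"
      using sin_cos_squared_add[of v] by algebra
    finally show ?thesis using Dpos[of v] by (simp add: field_simps)
  qed
  ultimately have "((\<lambda>v. Im (Ln (1 - of_real \<rho> * cis v))) has_real_derivative
      - ((1 - \<rho>\<^sup>2) / (1 + \<rho>\<^sup>2 - 2 * \<rho> * cos v) - 1) / 2) (at v)"
    by (simp only: has_real_derivative_iff_has_vector_derivative)
  from DERIV_diff[OF DERIV_minus[OF this] DERIV_cmult[OF DERIV_sin[of v], of \<kappa>]]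
  show "((\<lambda>v. - Im (Ln (1 - of_real \<rho> * cis v)) - \<kappa> * sin v) has_real_derivative
      ((1 - \<rho>\<^sup>2) / (1 + \<rho>\<^sup>2 - 2 * \<rho> * cos v) - 1) / 2 - \<kappa> * cos v) (at v)"
    by (simp only: minus_divide_left minus_minus)
  show "- Im (Ln (1 - of_real \<rho> * cis (- v))) - \<kappa> * sin (- v) = - (- Im (Ln (1 - of_real \<rho> * cis v)) - \<kappa> * sin v)"
  proof -
    have "Ln (1 - of_real \<rho> * cis (- v)) = Ln (cnj (1 - of_real \<rho> * cis v))" by (simp add: cis_cnj)
    also have "\<dots> = cnj (Ln (1 - of_real \<rho> * cis v))" using nn by (intro cnj_Ln[symmetric])
    finally show ?thesis by simp
  qed
  show "- Im (Ln (1 - of_real \<rho> * cis (v + 2 * pi))) - \<kappa> * sin (v + 2 * pi) = - Im (Ln (1 - of_real \<rho> * cis v)) - \<kappa> * sin v"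
    by (simp flip: cis_mult)
  fix w :: real
  assume vw: "0 \<le> v" "v \<le> w" "w \<le> pi"
  have ar: "(Y - 1) / 2 - d \<le> (X - 1) / 2 - c" if "c - d \<le> (X - Y) / 2" for c d X Y :: real
    using that by (simp add: diff_divide_distrib)
  define A B where "A = 1 + \<rho>\<^sup>2 - 2 * \<rho> * cos v" and "B = 1 + \<rho>\<^sup>2 - 2 * \<rho> * cos w"
  have c: "cos w \<le> cos v" using vw by (intro cos_monotone_0_pi_le) auto
  have pos: "0 < A" "0 < B" using Dpos by (auto simp: A_def B_def)
  \<comment> \<open>The denominators of the Poisson kernel are largest at \<open>pi\<close>, where
    they equal \<open>(1 + \<rho>)\<^sup>2\<close>; this worst case fixes
    \<open>\<kappa>\<close>.\<close>
  have "A * B \<le> (1 + \<rho>)\<^sup>2 * (1 + \<rho>)\<^sup>2"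
    using D(2) pos by (intro mult_mono) (auto simp: A_def B_def)
  then have AB: "1 / ((1 + \<rho>)\<^sup>2 * (1 + \<rho>)\<^sup>2) \<le> 1 / (A * B)"
    using pos \<rho> by (intro divide_left_mono mult_pos_pos) auto
  have "\<kappa> = \<rho> * (1 - \<rho>\<^sup>2) * (1 / ((1 + \<rho>)\<^sup>2 * (1 + \<rho>)\<^sup>2))"
  proof -
    have "(1 + \<rho>)\<^sup>2 * (1 + \<rho>)\<^sup>2 = (1 + \<rho>) ^ 3 * (1 + \<rho>)" "1 - \<rho>\<^sup>2 = (1 - \<rho>) * (1 + \<rho>)" by algebra+
    then show ?thesis using \<rho> \<kappa> by simp
  qed
  also have "\<dots> \<le> \<rho> * (1 - \<rho>\<^sup>2) * (1 / (A * B))"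
    using \<rho> by (intro mult_left_mono AB) (auto simp: power_le_one)
  finally have "\<kappa> * (cos v - cos w) \<le> \<rho> * (1 - \<rho>\<^sup>2) * (1 / (A * B)) * (cos v - cos w)"
    using c by (intro mult_right_mono) auto
  also have "\<dots> = ((1 - \<rho>\<^sup>2) / A - (1 - \<rho>\<^sup>2) / B) / 2"
  proof -
    have "(1 - \<rho>\<^sup>2) / A - (1 - \<rho>\<^sup>2) / B = (1 - \<rho>\<^sup>2) * (B - A) / (A * B)" using pos by (simp add: field_simps)
    also have "B - A = 2 * \<rho> * (cos v - cos w)" by (simp add: A_def B_def algebra_simps)
    finally show ?thesis by simp
  qed
  finally show "((1 - \<rho>\<^sup>2) / (1 + \<rho>\<^sup>2 - 2 * \<rho> * cos w) - 1) / 2 - \<kappa> * cos w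
      \<le> ((1 - \<rho>\<^sup>2) / (1 + \<rho>\<^sup>2 - 2 * \<rho> * cos v) - 1) / 2 - \<kappa> * cos v"
    unfolding A_def[symmetric] B_def[symmetric] right_diff_distrib by (rule ar)
qed


section \<open>Integration over the circle\<close>

text \<open>The circle is encoded as a density on the whole line, so that measurability is plain
  Borel measurability and shifted arguments need no domain condition. The doubled endpoint is a null
  set.\<close>

definition circ :: "real measure" where
  "circ = density lborel (\<lambda>x. ennreal (indicator {0..2 * pi} x))"

lemma space_circ [simp]: "space circ = UNIV"
  by (simp add: circ_def)

lemma sets_circ [simp, measurable_cong]: "sets circ = sets borel"
  by (simp add: circ_def)

lemma emeasure_circ: "emeasure circ UNIV = ennreal (2 * pi)"
  unfolding circ_def ennreal_indicator
  by (subst emeasure_density) (simp_all add: nn_integral_indicator)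

interpretation circ: finite_measure circ
  by standard (simp add: emeasure_circ)

interpretation circ2: pair_sigma_finite circ circ ..

lemma measure_circ: "measure circ UNIV = 2 * pi"
  by (simp add: measure_def emeasure_circ)

lemma AE_circ: "(AE x in circ. P x) \<longleftrightarrow> (AE x in lborel. x \<in> {0..2 * pi} \<longrightarrow> P x)"
  unfolding circ_def by (subst AE_density) (auto simp: indicator_def)

lemma integrable_circ:
  fixes f :: "real \<Rightarrow> 'a::{banach, second_countable_topology}"
  assumes "f \<in> borel_measurable borel" "\<And>x. norm (f x) \<le> B"
  shows "integrable circ f"
  by (rule circ.integrable_const_bound[where B = B]) (use assms in \<open>auto cong: measurable_cong_sets\<close>)

lemma integral_circ:
  fixes f :: "real \<Rightarrow> 'a::{banach, second_countable_topology}"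
  assumes "f \<in> borel_measurable borel"
  shows "(LINT x|circ. f x) = (LINT x|lborel. indicator {0..2 * pi} x *\<^sub>R f x)"
  unfolding circ_def by (rule integral_density) (use assms in auto)

text \<open>A bridge from gauge integrals, where primitives are evaluated and intervals glued, to
  the Bochner integral of a bounded Borel function.\<close>

lemma has_integral_circ:
  fixes f :: "real \<Rightarrow> 'a::euclidean_space"
  assumes f: "f \<in> borel_measurable borel" "\<And>x. norm (f x) \<le> B" and "(f has_integral I) {0..2 * pi}"
  shows "(LINT x|circ. f x) = I"
proof -
  have "finite_measure (restrict_space lborel {0..2 * pi})"
    by standard (simp add: emeasure_restrict_space)
  then have "integrable (restrict_space lborel {0..2 * pi}) f"
    using f by (intro finite_measure.integrable_const_bound[where B = B]) (auto intro: measurable_restrict_space1)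
  then have "set_integrable lborel {0..2 * pi} f"
    unfolding set_integrable_def by (simp add: integrable_restrict_space)
  then show ?thesis
    using set_borel_integral_eq_integral(2)[of "{0..2 * pi}" f] assms(3)
    by (simp add: integral_circ[OF f(1)] set_lebesgue_integral_def integral_unique)
qed

text \<open>The shifted window is cut at \<open>2 * pi\<close> and its second piece moved back by
  one period. Pieces overlap only in single points, so the indicator identities hold almost
  everywhere.\<close>

lemma circ_shift:
  fixes f :: "real \<Rightarrow> 'a::euclidean_space"
  assumes [measurable]: "f \<in> borel_measurable borel" and B: "\<And>x. norm (f x) \<le> B"
    and per: "\<And>x. f (x + 2 * pi) = f x" and u: "0 \<le> u" "u \<le> 2 * pi"
  shows "(LINT x|circ. f (x + u)) = (LINT x|circ. f x)"
proof -
  have int: "integrable lborel (\<lambda>x. indicator {a..b} x *\<^sub>R f x)" for a b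
  proof -
    have "finite_measure (restrict_space lborel {a..b})"
      by standard (simp add: emeasure_restrict_space emeasure_lborel_Icc_eq)
    then have "integrable (restrict_space lborel {a..b}) f"
      using B by (intro finite_measure.integrable_const_bound[where B = B]) (auto intro: measurable_restrict_space1)
    then show ?thesis by (simp add: integrable_restrict_space)
  qed
  have sh: "(LINT x|lborel. indicator {a..b} (x - c) *\<^sub>R f x) = (LINT x|lborel. indicator {a..b} x *\<^sub>R f (x + c))"
    for a b c
    using lborel_integral_real_affine[of 1 "\<lambda>x. indicator {a..b} (x - c) *\<^sub>R f x" c]
    by (simp add: add.commute)
  have "(LINT x|circ. f (x + u)) = (LINT x|lborel. indicator {0..2 * pi} (x - u) *\<^sub>R f x)"
    using sh[of 0 "2 * pi" u] by (simp add: integral_circ)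
  also have "\<dots> = (LINT x|lborel. indicator {u..2 * pi} x *\<^sub>R f x + indicator {2 * pi..2 * pi + u} x *\<^sub>R f x)"
    using AE_lborel_singleton[of "2 * pi"] u
    by (intro integral_cong_AE) (auto elim!: eventually_mono simp: indicator_def)
  also have "\<dots> = (LINT x|lborel. indicator {u..2 * pi} x *\<^sub>R f x) + (LINT x|lborel. indicator {2 * pi..2 * pi + u} x *\<^sub>R f x)"
    by (intro Bochner_Integration.integral_add int)
  also have "(LINT x|lborel. indicator {2 * pi..2 * pi + u} x *\<^sub>R f x) = (LINT x|lborel. indicator {0..u} (x - 2 * pi) *\<^sub>R f x)"
    by (intro Bochner_Integration.integral_cong) (auto simp: indicator_def)
  also have "\<dots> = (LINT x|lborel. indicator {0..u} x *\<^sub>R f x)"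
    using sh[of 0 u "2 * pi"] per by simp
  also have "(LINT x|lborel. indicator {u..2 * pi} x *\<^sub>R f x) + \<dots>
      = (LINT x|lborel. indicator {u..2 * pi} x *\<^sub>R f x + indicator {0..u} x *\<^sub>R f x)"
    by (intro Bochner_Integration.integral_add[symmetric] int)
  also have "\<dots> = (LINT x|circ. f x)"
    unfolding integral_circ[OF assms(1)] using AE_lborel_singleton[of u] u
    by (intro integral_cong_AE) (auto elim!: eventually_mono simp: indicator_def)
  finally show ?thesis .
qed

lemma borel_measurable_shift:
  assumes [measurable]: "f \<in> borel_measurable borel"
  shows "(\<lambda>x::real. f (x - u)) \<in> borel_measurable borel"
  by measurable

lemma circ_shift_neg:
  fixes f :: "real \<Rightarrow> 'a::euclidean_space"
  assumes [measurable]: "f \<in> borel_measurable borel" and B: "\<And>x. norm (f x) \<le> B"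
    and per: "\<And>x. f (x + 2 * pi) = f x" and u: "0 \<le> u" "u \<le> 2 * pi"
  shows "(LINT x|circ. f (x - u)) = (LINT x|circ. f x)"
proof -
  have per': "f (x + 2 * pi - u) = f (x - u)" for x
  proof -
    have "x + 2 * pi - u = (x - u) + 2 * pi" by simp
    then show ?thesis by (simp only: per)
  qed
  have m: "(\<lambda>x. f (x - u)) \<in> borel_measurable borel"
    by (rule borel_measurable_shift[OF assms(1)])
  have "(LINT x|circ. f ((x + u) - u)) = (LINT x|circ. f (x - u))"
  proof (rule circ_shift[of "\<lambda>x. f (x - u)" B u, OF m])
    show "norm (f (x - u)) \<le> B" for x by (rule B)
    show "f (x + 2 * pi - u) = f (x - u)" for x by (rule per')
  qed (fact u)+
  then show ?thesis by (simp only: add_diff_cancel_right')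
qed

section \<open>Orthogonality, and explicit integrals of sign functions on the circle\<close>

lemma integral_circ_cis: "(LINT x|circ. cis (real_of_int n * x)) = (if n = 0 then 2 * pi else 0)"
proof (cases "n = 0")
  case True
  then show ?thesis by (simp add: measure_circ scaleR_conv_of_real)
next
  case False
  have m: "(\<lambda>x. cis (real_of_int n * x)) \<in> borel_measurable borel"
    by (intro borel_measurable_continuous_onI continuous_intros)
  have "((\<lambda>x. cis (real_of_int n * x)) has_integral
      (cis (real_of_int n * (2 * pi)) / (\<i> * of_int n) - cis (real_of_int n * 0) / (\<i> * of_int n))) {0..2 * pi}"
  proof (rule fundamental_theorem_of_calculus)
    fix x :: real
    have "((\<lambda>z. exp (\<i> * (of_int n * z)) / (\<i> * of_int n)) has_field_derivative exp (\<i> * (of_int n * of_real x)))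
        (at (of_real x))"
      using False by (auto intro!: derivative_eq_intros simp: field_simps)
    from has_vector_derivative_real_field[OF this]
    show "((\<lambda>x. cis (real_of_int n * x) / (\<i> * of_int n)) has_vector_derivative cis (real_of_int n * x)) (at x within {0..2 * pi})"
      by (simp add: cis_conv_exp)
  qed auto
  moreover have "cis (real_of_int n * (2 * pi)) = 1"
    using cis_multiple_2pi[of "of_int n"] by (simp add: mult_ac)
  ultimately have "(LINT x|circ. cis (real_of_int n * x)) = 0"
    by (intro has_integral_circ[OF m, where B = 1]) auto
  then show ?thesis using False by simp
qed

lemma has_integral_const_on_interior:
  fixes f g :: "real \<Rightarrow> 'a::euclidean_space"
  assumes "a \<le> b" "\<And>x. a < x \<Longrightarrow> x < b \<Longrightarrow> f x = c *\<^sub>R g x" "(g has_integral I) {a..b}"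
  shows "(f has_integral c *\<^sub>R I) {a..b}"
proof -
  have "((\<lambda>x. c *\<^sub>R g x) has_integral c *\<^sub>R I) (cbox a b)" using assms(3) by (auto intro: has_integral_cmul)
  then show ?thesis using has_integral_spike_interior[of "\<lambda>x. c *\<^sub>R g x" "c *\<^sub>R I" a b f] assms(2)
    by (auto simp: box_real)
qed

lemma unimodular_cis:
  assumes "cmod w = 1" obtains \<xi> where "0 \<le> \<xi>" "\<xi> \<le> 2 * pi" "w = cis \<xi>"
proof -
  have "w = cis (Arg2pi w)" using Arg2pi_eq[of w] assms by (simp add: cis_conv_exp)
  then show thesis using that[of "Arg2pi w"] Arg2pi_ge_0[of w] Arg2pi_lt_2pi[of w] by auto
qed

lemma sgn_Re_cis: "sgn (Re (cis (- x) * cis \<xi>)) = sgn (cos (x - \<xi>))"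
  by (metis Re_complex_of_real cis.sel(1) cis_mult cos_minus minus_diff_eq uminus_add_conv_diff)

lemma sgn_cos_pieces:
  "0 < x \<Longrightarrow> x < pi / 2 \<Longrightarrow> sgn (cos x) = 1"
  "pi / 2 < x \<Longrightarrow> x < 3 * pi / 2 \<Longrightarrow> sgn (cos x) = - 1"
  "3 * pi / 2 < x \<Longrightarrow> x < 2 * pi \<Longrightarrow> sgn (cos x) = 1"
proof -
  show "0 < x \<Longrightarrow> x < pi / 2 \<Longrightarrow> sgn (cos x) = 1" using cos_gt_zero by simp
  show "pi / 2 < x \<Longrightarrow> x < 3 * pi / 2 \<Longrightarrow> sgn (cos x) = - 1"
    using cos_gt_zero_pi[of "x - pi"] by (simp add: sgn_if cos_diff)
  show "3 * pi / 2 < x \<Longrightarrow> x < 2 * pi \<Longrightarrow> sgn (cos x) = 1"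
    using cos_gt_zero_pi[of "x - 2 * pi"] by (simp add: cos_diff)
qed

lemma sin_3pi_half: "sin (3 * pi / 2) = - 1"
  by (metis sin_3over2_pi times_divide_eq_left)

lemma cos_3pi_half: "cos (3 * pi / 2) = 0"
  by (metis cos_3over2_pi times_divide_eq_left)

lemma integral_sgn_cos_aux:
  fixes g G :: "real \<Rightarrow> real"
  assumes "\<And>x. (G has_real_derivative g x) (at x)"
  shows "((\<lambda>x. g x * sgn (cos x)) has_integral
    2 * G (pi / 2) - 2 * G (3 * pi / 2) + G (2 * pi) - G 0) {0..2 * pi}"
proof -
  have G: "(g has_integral G b - G a) {a..b}" if "a \<le> b" for a b
    using that assms by (intro fundamental_theorem_of_calculus)
      (auto simp: has_real_derivative_iff_has_vector_derivative intro: has_vector_derivative_at_within)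
  have "((\<lambda>x. g x * sgn (cos x)) has_integral 1 *\<^sub>R (G (pi / 2) - G 0)) {0..pi / 2}"
    by (rule has_integral_const_on_interior[OF _ _ G]) (auto simp: sgn_cos_pieces)
  moreover have "((\<lambda>x. g x * sgn (cos x)) has_integral (- 1) *\<^sub>R (G (3 * pi / 2) - G (pi / 2))) {pi / 2..3 * pi / 2}"
    by (rule has_integral_const_on_interior[OF _ _ G]) (auto simp: sgn_cos_pieces(2))
  moreover have "((\<lambda>x. g x * sgn (cos x)) has_integral 1 *\<^sub>R (G (2 * pi) - G (3 * pi / 2))) {3 * pi / 2..2 * pi}"
    by (rule has_integral_const_on_interior[OF _ _ G]) (auto simp: sgn_cos_pieces(3))
  ultimately have "((\<lambda>x. g x * sgn (cos x)) has_integral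
      (1 *\<^sub>R (G (pi / 2) - G 0) + (- 1) *\<^sub>R (G (3 * pi / 2) - G (pi / 2)))
      + 1 *\<^sub>R (G (2 * pi) - G (3 * pi / 2))) {0..2 * pi}"
    by (intro has_integral_combine[where c = "3 * pi / 2"] has_integral_combine[where c = "pi / 2" and b = "3 * pi / 2"]) auto
  then show ?thesis by (simp add: algebra_simps)
qed

text \<open>A shift by the argument of \<open>w\<close> reduces the integrand to
  \<open>cis x * sgn (cos x)\<close>. Its real part is the modulus of the cosine, with integral 4;
  its imaginary part integrates to zero.\<close>

lemma unit_vector_as_average:
  assumes "cmod w = 1"
  shows "(LINT x|circ. cis x * of_real (sgn (Re (cis (- x) * w)))) = 4 * w"
proof -
  obtain \<xi> where \<xi>: "0 \<le> \<xi>" "\<xi> \<le> 2 * pi" "w = cis \<xi>" using unimodular_cis assms by blast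
  let ?g = "\<lambda>x. cis x * of_real (sgn (cos x))"
  have m: "?g \<in> borel_measurable borel"
    by (intro borel_measurable_times borel_measurable_continuous_onI[of cis] continuous_intros) measurable
  have bd: "norm (?g x) \<le> 1" for x by (simp add: norm_mult sgn_if)
  have per: "?g (x + 2 * pi) = ?g x" for x by (simp flip: cis_mult)
  have "cis x * of_real (sgn (Re (cis (- x) * w))) = cis \<xi> * ?g (x - \<xi>)" for x
    unfolding \<xi>(3) sgn_Re_cis by (simp add: cis_mult mult.assoc[symmetric])
  then have "(LINT x|circ. cis x * of_real (sgn (Re (cis (- x) * w)))) = cis \<xi> * (LINT x|circ. ?g (x - \<xi>))"
    by simp
  also have "(LINT x|circ. ?g (x - \<xi>)) = (LINT x|circ. ?g x)"
    by (rule circ_shift_neg[OF m bd per \<xi>(1,2)])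
  also have "\<dots> = 4"
  proof (rule complex_eqI)
    have i: "integrable circ ?g" by (intro integrable_circ[OF _ bd] m)
    have "Re (LINT x|circ. ?g x) = (LINT x|circ. cos x * sgn (cos x))"
      using integral_Re[OF i] by simp
    also have "\<dots> = 4"
      using integral_sgn_cos_aux[of sin cos]
      by (intro has_integral_circ[where B = 1]) (auto simp: sgn_if sin_3pi_half intro!: derivative_eq_intros)
    finally show "Re (LINT x|circ. ?g x) = Re 4" by simp
    have "Im (LINT x|circ. ?g x) = (LINT x|circ. sin x * sgn (cos x))"
      using integral_Im[OF i] by simp
    also have "\<dots> = 0"
      using integral_sgn_cos_aux[of "\<lambda>x. - cos x" sin, OF DERIV_minus[OF DERIV_cos, simplified]]
      by (intro has_integral_circ[where B = 1]) (auto simp: sgn_if cos_3pi_half intro!: derivative_eq_intros)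
    finally show "Im (LINT x|circ. ?g x) = Im 4" by simp
  qed
  finally show ?thesis using \<xi> by simp
qed

text \<open>The two signs disagree for \<open>x\<close> in two intervals of length \<open>u\<close>.
  That the value does not depend on \<open>w\<close> is the point: it later makes an average over
  \<open>x\<close> independent of the boundary function.\<close>

lemma sector_average:
  assumes "cmod w = 1" and u: "0 \<le> u" "u \<le> pi"
  shows "(LINT x|circ. sgn (Re (cis (- x) * w)) * sgn (Re (cis (- (x + u)) * w))) = 2 * pi - 4 * u"
proof -
  obtain \<xi> where \<xi>: "0 \<le> \<xi>" "\<xi> \<le> 2 * pi" "w = cis \<xi>" using unimodular_cis assms by blast
  let ?g = "\<lambda>x. sgn (cos x) * sgn (cos (x + u)) :: real"
  let ?h = "\<lambda>x. sgn (sin x) * sgn (sin (x + u)) :: real"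
  have m: "?g \<in> borel_measurable borel" by measurable
  have m': "?h \<in> borel_measurable borel" by measurable
  have bd: "norm (?g x) \<le> 1" for x by (simp add: norm_mult sgn_if)
  have bd': "norm (?h x) \<le> 1" for x by (simp add: norm_mult sgn_if)
  have per: "?g (x + 2 * pi) = ?g x" for x
    using cos_periodic[of "x + u"] by (simp add: add_ac)
  have "x + u - \<xi> = x - \<xi> + u" for x by simp
  then have "(LINT x|circ. sgn (Re (cis (- x) * w)) * sgn (Re (cis (- (x + u)) * w))) = (LINT x|circ. ?g (x - \<xi>))"
    unfolding \<xi>(3) sgn_Re_cis by presburger
  also have "\<dots> = (LINT x|circ. ?g x)" by (rule circ_shift_neg[OF m bd per \<xi>(1,2)])
  \<comment> \<open>The quarter turn replaces cosines by sines, so that the sign changes are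
    \<open>pi - u\<close>, \<open>pi\<close>, \<open>2 * pi - u\<close> and the end
    \<open>2 * pi\<close>, and no piece wraps around.\<close>
  also have "\<dots> = (LINT x|circ. ?g (x - pi / 2))" by (rule circ_shift_neg[OF m bd per, symmetric]) auto
  also have "\<dots> = (LINT x|circ. ?h x)"
  proof -
    have "?g (x - pi / 2) = ?h x" for x
      using cos_diff[of "x + u" "pi / 2"] by (simp add: cos_diff algebra_simps)
    then show ?thesis by simp
  qed
  also have "\<dots> = 2 * pi - 4 * u"
  proof (rule has_integral_circ[OF m' bd'])
    have G: "((\<lambda>x. 1) has_integral b - a) {a..b}" if "a \<le> b" for a b :: real
      using has_integral_const_real[of "1::real" a b] that by simp
    have p: "sgn (sin x) = 1" if "0 < x" "x < pi" for x using sin_gt_zero that by simp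
    have n: "sgn (sin x) = -1" if "pi < x" "x < 2 * pi" for x using sin_lt_zero that by simp
    have p2: "sgn (sin x) = 1" if "2 * pi < x" "x < 3 * pi" for x using sin_gt_zero[of "x - 2 * pi"] that by (simp add: sin_diff)
    have "(?h has_integral 1 *\<^sub>R ((pi - u) - 0)) {0..pi - u}"
      using u p by (intro has_integral_const_on_interior[OF _ _ G]) auto
    moreover have "(?h has_integral (- 1) *\<^sub>R (pi - (pi - u))) {pi - u..pi}"
      using u p n by (intro has_integral_const_on_interior[OF _ _ G]) auto
    moreover have "(?h has_integral 1 *\<^sub>R ((2 * pi - u) - pi)) {pi..2 * pi - u}"
      using u n by (intro has_integral_const_on_interior[OF _ _ G]) auto
    moreover have "(?h has_integral (- 1) *\<^sub>R (2 * pi - (2 * pi - u))) {2 * pi - u..2 * pi}"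
      using u n p2 by (intro has_integral_const_on_interior[OF _ _ G]) auto
    ultimately have "(?h has_integral ((1 *\<^sub>R ((pi - u) - 0) + (- 1) *\<^sub>R (pi - (pi - u))) + 1 *\<^sub>R ((2 * pi - u) - pi)) + (- 1) *\<^sub>R (2 * pi - (2 * pi - u))) {0..2 * pi}"
      using u by (intro has_integral_combine[where c = "2 * pi - u"] has_integral_combine[where c = pi and b = "2 * pi - u"]
        has_integral_combine[where c = "pi - u" and b = pi]) auto
    then show "(?h has_integral 2 * pi - 4 * u) {0..2 * pi}" by (simp add: algebra_simps)
  qed
  finally show ?thesis .
qed

interpretation circ_prod: finite_measure "circ \<Otimes>\<^sub>M circ"
  by (rule finite_measure_pair_measure) unfold_locales

lemma borel_measurable_cis [measurable (raw)]:
  assumes [measurable]: "f \<in> borel_measurable M"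
  shows "(\<lambda>x. cis (f x)) \<in> borel_measurable M"
proof -
  have [measurable]: "cis \<in> borel_measurable borel"
    by (intro borel_measurable_continuous_onI continuous_intros)
  show ?thesis by measurable
qed

lemma borel_measurable_cnj [measurable (raw)]:
  assumes [measurable]: "f \<in> borel_measurable M"
  shows "(\<lambda>x. cnj (f x)) \<in> borel_measurable M"
proof -
  have [measurable]: "cnj \<in> borel_measurable borel"
    by (intro borel_measurable_continuous_onI continuous_intros)
  show ?thesis by measurable
qed

lemma integrable_circ_prod:
  fixes f :: "real \<Rightarrow> real \<Rightarrow> 'a::{banach, second_countable_topology}"
  assumes "case_prod f \<in> borel_measurable (borel \<Otimes>\<^sub>M borel)" "\<And>x y. norm (f x y) \<le> B"
  shows "integrable (circ \<Otimes>\<^sub>M circ) (case_prod f)"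
proof (rule circ_prod.integrable_const_bound[where B = B])
  show "case_prod f \<in> borel_measurable (circ \<Otimes>\<^sub>M circ)"
    using assms(1) by (simp cong: measurable_cong_sets)
qed (use assms(2) in auto)

lemma circ_Fubini:
  fixes f :: "real \<Rightarrow> real \<Rightarrow> 'a::{banach, second_countable_topology}"
  assumes "case_prod f \<in> borel_measurable (borel \<Otimes>\<^sub>M borel)" "\<And>x y. norm (f x y) \<le> B"
  shows "(LINT y|circ. LINT x|circ. f x y) = (LINT x|circ. LINT y|circ. f x y)"
  by (rule circ2.Fubini_integral[OF integrable_circ_prod[OF assms]])

lemma norm_integral_circ_le:
  fixes f :: "real \<Rightarrow> 'a::{banach, second_countable_topology}"
  assumes "\<And>x. norm (f x) \<le> B" "0 \<le> B"
  shows "norm (LINT x|circ. f x) \<le> B * (2 * pi)"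
proof (cases "integrable circ f")
  case True
  then have "norm (LINT x|circ. f x) \<le> (LINT x|circ. B)"
    using assms by (intro order_trans[OF integral_norm_bound] integral_mono) auto
  then show ?thesis by (simp add: measure_circ mult.commute)
next
  case False
  then show ?thesis using assms by (simp add: not_integrable_integral_eq)
qed

text \<open>An arc through the angle 0 is described by the complementary interval with the opposite
  sign; this is why a factor \<sigma> accompanies this function later.\<close>

definition interval_sign :: "real \<Rightarrow> real \<Rightarrow> real \<Rightarrow> real" where
  "interval_sign a b \<theta> = (if a < \<theta> \<and> \<theta> < b then 1 else - 1)"

lemma interval_sign_measurable [measurable]: "interval_sign a b \<in> borel_measurable borel"
  unfolding interval_sign_def by measurable

lemma abs_interval_sign [simp]: "\<bar>interval_sign a b \<theta>\<bar> = 1"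
  by (simp add: interval_sign_def)

lemma fourier_interval_sign:
  assumes ab: "0 \<le> a" "a \<le> b" "b \<le> 2 * pi" and n: "n \<noteq> 0"
  shows "(LINT \<theta>|circ. of_real (interval_sign a b \<theta>) * cis (- (real_of_int n * \<theta>)))
    = 2 * \<i> / of_int n * (cis (- (real_of_int n * b)) - cis (- (real_of_int n * a)))"
proof (rule has_integral_circ[where B = 1])
  define g where "g = (\<lambda>\<theta>. cis (- (real_of_int n * \<theta>)))"
  define G where "G \<theta> = \<i> / of_int n * cis (- (real_of_int n * \<theta>))" for \<theta> :: real
  have dG: "(G has_vector_derivative g \<theta>) (at \<theta>)" for \<theta>
  proof -
    have "((\<lambda>z. \<i> / of_int n * exp (\<i> * (- (of_int n * z)))) has_field_derivative exp (\<i> * (- (of_int n * of_real \<theta>))))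
        (at (of_real \<theta>))"
      using n by (auto intro!: derivative_eq_intros simp: field_simps)
    from has_vector_derivative_real_field[OF this]
    show ?thesis by (simp add: cis_conv_exp G_def[abs_def] g_def)
  qed
  have g: "(g has_integral G d - G c) {c..d}" if "c \<le> d" for c d
    by (rule fundamental_theorem_of_calculus[OF that]) (rule has_vector_derivative_at_within[OF dG])
  let ?f = "\<lambda>\<theta>. of_real (interval_sign a b \<theta>) * g \<theta>"
  have "(?f has_integral (- 1) *\<^sub>R (G a - G 0)) {0..a}"
    using ab by (intro has_integral_const_on_interior[OF _ _ g]) (auto simp: interval_sign_def)
  moreover have "(?f has_integral 1 *\<^sub>R (G b - G a)) {a..b}"
    using ab by (intro has_integral_const_on_interior[OF _ _ g]) (auto simp: interval_sign_def)
  moreover have "(?f has_integral (- 1) *\<^sub>R (G (2 * pi) - G b)) {b..2 * pi}"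
    using ab by (intro has_integral_const_on_interior[OF _ _ g]) (auto simp: interval_sign_def)
  ultimately have "(?f has_integral ((- 1) *\<^sub>R (G a - G 0) + 1 *\<^sub>R (G b - G a)) + (- 1) *\<^sub>R (G (2 * pi) - G b)) {0..2 * pi}"
    using ab by (intro has_integral_combine[where c = b] has_integral_combine[where c = a and b = b]) auto
  moreover have "((- 1) *\<^sub>R (G a - G 0) + 1 *\<^sub>R (G b - G a)) + (- 1) *\<^sub>R (G (2 * pi) - G b)
      = 2 * \<i> / of_int n * (cis (- (real_of_int n * b)) - cis (- (real_of_int n * a)))"
  proof -
    have "cis (- (real_of_int n * (2 * pi))) = 1"
      using cis_multiple_2pi[of "- of_int n"] by (simp add: mult_ac)
    then have "G (2 * pi) = G 0" by (simp add: G_def)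
    then have "((- 1) *\<^sub>R (G a - G 0) + 1 *\<^sub>R (G b - G a)) + (- 1) *\<^sub>R (G (2 * pi) - G b) = 2 * (G b - G a)"
      by simp
    also have "\<dots> = 2 * \<i> / of_int n * (cis (- (real_of_int n * b)) - cis (- (real_of_int n * a)))"
      by (simp add: G_def right_diff_distrib mult.assoc)
    finally show ?thesis .
  qed
  ultimately show "((\<lambda>\<theta>. of_real (interval_sign a b \<theta>) * cis (- (real_of_int n * \<theta>))) has_integral
      2 * \<i> / of_int n * (cis (- (real_of_int n * b)) - cis (- (real_of_int n * a)))) {0..2 * pi}"
    by (simp only: g_def)
qed (auto simp: norm_mult)

text \<open>The pieces \<open>[0, a]\<close> and \<open>[b', 2 * pi]\<close> form one gap on the
  circle. Hence four circular gaps, on which agreement and disagreement alternate.\<close>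

lemma integral_linked_interval_signs:
  assumes "0 \<le> a" "a \<le> a'" "a' \<le> b" "b \<le> b'" "b' \<le> 2 * pi"
  shows "(LINT \<theta>|circ. interval_sign a b \<theta> * interval_sign a' b' \<theta>)
    = (b - a') + (2 * pi - (b' - a)) - (a' - a) - (b' - b)"
proof (rule has_integral_circ[where B = 1])
  let ?h = "\<lambda>\<theta>. interval_sign a b \<theta> * interval_sign a' b' \<theta>"
  have G: "((\<lambda>x. 1) has_integral d - c) {c..d}" if "c \<le> d" for c d :: real
    using has_integral_const_real[of "1::real" c d] that by simp
  have "(?h has_integral 1 *\<^sub>R (a - 0)) {0..a}"
    using assms by (intro has_integral_const_on_interior[OF _ _ G]) (auto simp: interval_sign_def)
  moreover have "(?h has_integral (- 1) *\<^sub>R (a' - a)) {a..a'}"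
    using assms by (intro has_integral_const_on_interior[OF _ _ G]) (auto simp: interval_sign_def)
  moreover have "(?h has_integral 1 *\<^sub>R (b - a')) {a'..b}"
    using assms by (intro has_integral_const_on_interior[OF _ _ G]) (auto simp: interval_sign_def)
  moreover have "(?h has_integral (- 1) *\<^sub>R (b' - b)) {b..b'}"
    using assms by (intro has_integral_const_on_interior[OF _ _ G]) (auto simp: interval_sign_def)
  moreover have "(?h has_integral 1 *\<^sub>R (2 * pi - b')) {b'..2 * pi}"
    using assms by (intro has_integral_const_on_interior[OF _ _ G]) (auto simp: interval_sign_def)
  ultimately have "(?h has_integral (((1 *\<^sub>R (a - 0) + (- 1) *\<^sub>R (a' - a)) + 1 *\<^sub>R (b - a')) + (- 1) *\<^sub>R (b' - b)) + 1 *\<^sub>R (2 * pi - b')) {0..2 * pi}"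
    using assms by (intro has_integral_combine[where c = b'] has_integral_combine[where c = b and b = b']
      has_integral_combine[where c = a' and b = b] has_integral_combine[where c = a and b = a']) auto
  then show "(?h has_integral (b - a') + (2 * pi - (b' - a)) - (a' - a) - (b' - b)) {0..2 * pi}"
    by (simp add: algebra_simps)
qed (auto simp: abs_mult)

text \<open>The product of two endpoint differences expands into one exponential per pair of
  endpoints from different arcs, hence into one sine per gap. The two factors \<open>1 / n\<close>
  of the coefficients, multiplied by \<open>n\<close>, leave the weight \<open>1 / n\<close> of the
  kernel.\<close>

lemma Im_fourier_product:
  fixes n :: int and a b a' b' :: real
  assumes "n \<noteq> 0"
  shows "- of_int n * Im ((2 * \<i> / of_int n * (cis (- (of_int n * b')) - cis (- (of_int n * a'))))
      * cnj (2 * \<i> / of_int n * (cis (- (of_int n * b)) - cis (- (of_int n * a)))))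
    = 4 * ((sin (of_int n * (b' - b)) + sin (of_int n * (b - a')) + sin (of_int n * (a' - a))
        - sin (of_int n * (b' - a))) / of_int n)"
proof -
  have "(2 * \<i> / of_int n * (cis (- (of_int n * b')) - cis (- (of_int n * a'))))
      * cnj (2 * \<i> / of_int n * (cis (- (of_int n * b)) - cis (- (of_int n * a))))
    = of_real (4 / (of_int n)\<^sup>2) * ((cis (- (of_int n * b')) - cis (- (of_int n * a')))
      * (cis (of_int n * b) - cis (of_int n * a)))"
  proof -
    have "p * A * (q * B) = (p * q) * (A * B)" for p q A B :: complex by (simp only: mult_ac)
    from this[of "2 * \<i> / of_int n" "cis (- (of_int n * b')) - cis (- (of_int n * a'))" "- (2 * \<i> / of_int n)"]
    show ?thesis by (simp only: complex_cnj_mult complex_cnj_diff cis_cnj complex_cnj_divide complex_cnj_i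
      complex_cnj_numeral complex_cnj_of_int minus_minus minus_mult_left[symmetric] minus_mult_right[symmetric]
      minus_divide_left) (simp add: power2_eq_square)
  qed
  also have "Im \<dots> = (4 / (of_int n)\<^sup>2) * Im ((cis (- (of_int n * b')) - cis (- (of_int n * a')))
      * (cis (of_int n * b) - cis (of_int n * a)))"
    by (simp only: times_complex.sel Re_complex_of_real Im_complex_of_real mult_zero_left add_0_right)
  also have "(cis (- (of_int n * b')) - cis (- (of_int n * a'))) * (cis (of_int n * b) - cis (of_int n * a))
    = cis (- (of_int n * (b' - b))) - cis (- (of_int n * (b' - a))) - cis (of_int n * (b - a')) + cis (- (of_int n * (a' - a)))"
    by (simp add: algebra_simps cis_mult)
  finally have key: "Im ((2 * \<i> / of_int n * (cis (- (of_int n * b')) - cis (- (of_int n * a'))))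
      * cnj (2 * \<i> / of_int n * (cis (- (of_int n * b)) - cis (- (of_int n * a)))))
    = 4 / (of_int n)\<^sup>2 * Im (cis (- (of_int n * (b' - b))) - cis (- (of_int n * (b' - a)))
      - cis (of_int n * (b - a')) + cis (- (of_int n * (a' - a))))" .
  have r: "- x * (4 / x\<^sup>2 * y) = 4 * (- y / x)" if "x \<noteq> 0" for x y :: real
    using that by (simp add: power2_eq_square)
  have nz: "(of_int n :: real) \<noteq> 0" using assms by simp
  show ?thesis unfolding key r[OF nz] by simp
qed


section \<open>Half-plane sides of a unimodular boundary function\<close>

locale circle_boundary =
  fixes F :: "real \<Rightarrow> complex"
  assumes F_measurable [measurable]: "F \<in> borel_measurable borel"
    and F_unit [simp]: "\<And>\<theta>. cmod (F \<theta>) = 1"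
begin

text \<open>The side of the line through 0 perpendicular to \<open>cis x\<close> on which the
  boundary value lies, with value 0 on the line itself.\<close>

definition side :: "real \<Rightarrow> real \<Rightarrow> real" where
  "side x \<theta> = sgn (Re (cis (- x) * F \<theta>))"

text \<open>Fourier coefficients without the factor \<open>1 / (2 * pi)\<close>, so they are
  \<open>2 * pi\<close> times the Taylor data.\<close>

definition coeff :: "int \<Rightarrow> complex" where
  "coeff n = (LINT \<theta>|circ. F \<theta> * cis (- (real_of_int n * \<theta>)))"

definition side_coeff :: "int \<Rightarrow> real \<Rightarrow> complex" where
  "side_coeff n x = (LINT \<theta>|circ. of_real (side x \<theta>) * cis (- (real_of_int n * \<theta>)))"

definition side_corr :: "real \<Rightarrow> real \<Rightarrow> real" where
  "side_corr x y = (LINT \<theta>|circ. side x \<theta> * side y \<theta>)"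

lemma side_measurable [measurable (raw)]:
  assumes [measurable]: "f \<in> borel_measurable M" "g \<in> borel_measurable M"
  shows "(\<lambda>z. side (f z) (g z)) \<in> borel_measurable M"
  unfolding side_def by measurable

lemma abs_side_le [simp]: "\<bar>side x \<theta>\<bar> \<le> 1"
  by (simp add: side_def sgn_if)

lemma side_antiperiodic: "side (x + pi) \<theta> = - side x \<theta>"
proof -
  have "cis (- (x + pi)) = - cis (- x)" by (simp add: complex_eq_iff)
  then show ?thesis
    by (simp only: side_def mult_minus_left uminus_complex.sel sgn_minus)
qed

lemma side_periodic: "side (x + 2 * pi) \<theta> = side x \<theta>"
  using side_antiperiodic[of "x + pi"] side_antiperiodic[of x] by (simp add: add.assoc)

lemma side_coeff_measurable [measurable]: "side_coeff n \<in> borel_measurable borel"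
  unfolding side_coeff_def[abs_def]
  by (rule circ.borel_measurable_lebesgue_integral) measurable

lemma side_corr_measurable [measurable]: "(\<lambda>x. side_corr x (x + u)) \<in> borel_measurable borel"
  unfolding side_corr_def
  by (rule circ.borel_measurable_lebesgue_integral) measurable

lemma norm_side_coeff: "norm (side_coeff n x) \<le> 2 * pi"
  unfolding side_coeff_def
  using norm_integral_circ_le[of "\<lambda>\<theta>. of_real (side x \<theta>) * cis (- (real_of_int n * \<theta>))" 1]
  by (simp add: norm_mult)

lemma abs_side_corr: "\<bar>side_corr x y\<bar> \<le> 2 * pi"
  unfolding side_corr_def
  using norm_integral_circ_le[of "\<lambda>\<theta>. side x \<theta> * side y \<theta>" 1]
  by (simp add: abs_mult mult_le_one)

lemma side_coeff_antiperiodic: "side_coeff n (x + pi) = - side_coeff n x"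
  by (simp add: side_coeff_def side_antiperiodic)

lemma side_coeff_periodic: "side_coeff n (x + 2 * pi) = side_coeff n x"
  by (simp add: side_coeff_def side_periodic)

lemma side_coeff_uminus: "side_coeff (- n) x = cnj (side_coeff n x)"
  unfolding side_coeff_def by (subst Bochner_Integration.integral_cnj[symmetric]) (simp add: cis_cnj)

text \<open>The representation of a unit vector as an average over half planes is inserted for
  \<open>F \<theta>\<close>, and the two integrals are exchanged.\<close>

lemma coeff_eq_average: "4 * coeff n = (LINT x|circ. cis x * side_coeff n x)"
proof -
  have "4 * coeff n = (LINT \<theta>|circ. (4 * F \<theta>) * cis (- (real_of_int n * \<theta>)))"
    unfolding coeff_def by (simp add: mult.assoc)
  also have "\<dots> = (LINT \<theta>|circ. LINT x|circ. cis x * of_real (side x \<theta>) * cis (- (real_of_int n * \<theta>)))"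
    unfolding unit_vector_as_average[OF F_unit, symmetric] side_def by simp
  also have "\<dots> = (LINT x|circ. LINT \<theta>|circ. cis x * of_real (side x \<theta>) * cis (- (real_of_int n * \<theta>)))"
    by (rule circ_Fubini[where B = 1]) (measurable, simp add: norm_mult)
  also have "\<dots> = (LINT x|circ. cis x * side_coeff n x)"
    unfolding side_coeff_def by (simp add: mult.assoc)
  finally show ?thesis .
qed

text \<open>An autocorrelation: it collects all pairs of half planes that differ by the rotation
  angle \<open>u\<close>.\<close>

definition side_conv :: "int \<Rightarrow> real \<Rightarrow> complex" where
  "side_conv n u = (LINT x|circ. side_coeff n (x + u) * cnj (side_coeff n x))"

lemma side_conv_antiperiodic: "side_conv n (u + pi) = - side_conv n u"
  using side_coeff_antiperiodic[of n "_ + u"] by (simp add: side_conv_def add.assoc)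

lemma side_conv_uminus: "side_conv (- n) u = cnj (side_conv n u)"
  unfolding side_conv_def by (subst Bochner_Integration.integral_cnj[symmetric]) (simp add: side_coeff_uminus)

lemma side_conv_measurable [measurable]: "side_conv n \<in> borel_measurable borel"
  unfolding side_conv_def[abs_def]
  by (rule circ.borel_measurable_lebesgue_integral) measurable

lemma norm_side_conv: "norm (side_conv n u) \<le> (2 * pi) ^ 3"
proof -
  have "norm (side_coeff n (x + u) * cnj (side_coeff n x)) \<le> (2 * pi) * (2 * pi)" for x
    unfolding norm_mult complex_mod_cnj by (intro mult_mono norm_side_coeff) auto
  from norm_integral_circ_le[of "\<lambda>x. side_coeff n (x + u) * cnj (side_coeff n x)", OF this]
  show ?thesis by (simp add: side_conv_def power3_eq_cube mult_ac)
qed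

text \<open>The squared modulus is a double integral over directions \<open>x\<close> and
  \<open>y\<close>. As the integrand has period \<open>2 * pi\<close> in \<open>y\<close>, the
  substitution \<open>y = u + x\<close> keeps the domain and separates off the factor
  \<open>cis u\<close>.\<close>

lemma norm_coeff_squared: "of_real (16 * (cmod (coeff n))\<^sup>2) = (LINT u|circ. cis u * side_conv n u)"
proof -
  let ?I = "LINT x|circ. cis x * side_coeff n x"
  let ?f = "\<lambda>x y. cis (y - x) * (side_coeff n y * cnj (side_coeff n x))"
  have bd: "norm (side_coeff n y * cnj (side_coeff n x)) \<le> (2 * pi) * (2 * pi)" for x y
    unfolding norm_mult complex_mod_cnj by (intro mult_mono norm_side_coeff) auto
  have pt: "cis y * side_coeff n y * cnj (cis x * side_coeff n x) = ?f x y" for x y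
  proof -
    have "cis (y - x) = cis y * cis (- x)" by (simp add: cis_mult)
    then show ?thesis by (simp only: complex_cnj_mult cis_cnj mult_ac)
  qed
  have "of_real (16 * (cmod (coeff n))\<^sup>2) = 4 * coeff n * cnj (4 * coeff n)"
    by (simp add: complex_norm_square[symmetric])
  also have "\<dots> = ?I * cnj ?I" unfolding coeff_eq_average ..
  also have "\<dots> = (LINT x|circ. ?I * cnj (cis x * side_coeff n x))"
    by (subst Bochner_Integration.integral_cnj[symmetric]) (rule integral_mult_right_zero[symmetric])
  also have "\<dots> = (LINT x|circ. LINT y|circ. cis y * side_coeff n y * cnj (cis x * side_coeff n x))"
    by (simp only: integral_mult_left_zero)
  also have "\<dots> = (LINT x|circ. LINT y|circ. ?f x y)"
    by (simp only: pt)
  also have "\<dots> = (LINT x|circ. LINT u|circ. ?f x (u + x))"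
  proof (rule integral_cong_AE)
    have "(LINT y|circ. ?f x y) = (LINT u|circ. ?f x (u + x))" if "x \<in> {0..2 * pi}" for x
    proof (rule circ_shift[symmetric, where B = "(2 * pi) * (2 * pi)"])
      show "norm (?f x y) \<le> (2 * pi) * (2 * pi)" for y using bd[of y x] by (simp add: norm_mult)
      show "?f x (y + 2 * pi) = ?f x y" for y
      proof -
        have "cis (y + 2 * pi - x) = cis (y - x)" by (simp add: complex_eq_iff cos_diff sin_diff)
        then show ?thesis by (simp add: side_coeff_periodic)
      qed
    qed (use that in \<open>simp_all\<close>)
    then show "AE x in circ. (LINT y|circ. ?f x y) = (LINT u|circ. ?f x (u + x))"
      unfolding AE_circ by simp
  qed measurable
  also have "\<dots> = (LINT x|circ. LINT u|circ. cis u * (side_coeff n (x + u) * cnj (side_coeff n x)))"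
    by (simp add: add.commute)
  also have "\<dots> = (LINT u|circ. LINT x|circ. cis u * (side_coeff n (x + u) * cnj (side_coeff n x)))"
    by (rule circ_Fubini[where B = "(2 * pi) * (2 * pi)"]) (measurable, use bd in \<open>simp add: norm_mult\<close>)
  also have "\<dots> = (LINT u|circ. cis u * side_conv n u)"
    by (simp add: side_conv_def)
  finally show ?thesis .
qed

text \<open>Passing from \<open>n\<close> to \<open>- n\<close> conjugates \<open>side_conv\<close>,
  so the difference contains \<open>2 * \<i> * Im (side_conv n u)\<close>, of which multiplication
  by \<open>cis u\<close> leaves the sine in the real part.\<close>

lemma coeff_difference:
  "8 * ((cmod (coeff n))\<^sup>2 - (cmod (coeff (- n)))\<^sup>2) = - (LINT u|circ. sin u * Im (side_conv n u))"
proof -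
  have int: "integrable circ (\<lambda>u. cis u * side_conv m u)" for m
    by (rule integrable_circ[where B = "(2 * pi) ^ 3"]) (measurable, use norm_side_conv in \<open>simp add: norm_mult\<close>)
  have "complex_of_real (16 * (cmod (coeff n))\<^sup>2 - 16 * (cmod (coeff (- n)))\<^sup>2)
      = (LINT u|circ. cis u * side_conv n u - cis u * side_conv (- n) u)"
    unfolding of_real_diff norm_coeff_squared by (rule Bochner_Integration.integral_diff[OF int int, symmetric])
  from arg_cong[OF this, of Re]
  have "16 * (cmod (coeff n))\<^sup>2 - 16 * (cmod (coeff (- n)))\<^sup>2
      = (LINT u|circ. Re (cis u * side_conv n u - cis u * side_conv (- n) u))"
    by (subst (asm) integral_Re[symmetric]) (auto intro: int Bochner_Integration.integrable_diff)
  also have "\<dots> = (LINT u|circ. - 2 * (sin u * Im (side_conv n u)))"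
    by (intro Bochner_Integration.integral_cong refl) (simp add: side_conv_uminus)
  also have "\<dots> = - 2 * (LINT u|circ. sin u * Im (side_conv n u))" by simp
  finally show ?thesis by simp
qed

text \<open>After exchanging the integrals the inner one is computed pointwise in \<theta> and does
  not see \<open>F\<close>. This makes the linear error of the tangent estimate vanish on
  average.\<close>

lemma side_corr_average:
  assumes "0 \<le> u" "u \<le> pi"
  shows "(LINT x|circ. side_corr x (x + u)) = 2 * pi * (2 * pi - 4 * u)"
proof -
  have "(LINT x|circ. side_corr x (x + u)) = (LINT \<theta>|circ. LINT x|circ. side x \<theta> * side (x + u) \<theta>)"
    unfolding side_corr_def
    by (rule circ_Fubini[where B = 1]) (measurable, simp add: abs_mult mult_le_one)
  also have "\<dots> = (LINT \<theta>|circ. 2 * pi - 4 * u)"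
    unfolding side_def using sector_average[OF F_unit assms] by simp
  finally show ?thesis by (simp add: measure_circ)
qed

text \<open>For each fixed \<theta> only countably many directions put \<open>F \<theta>\<close> on
  the dividing line; exchanging the two almost-everywhere quantifiers transfers this to almost every
  direction.\<close>

lemma AE_side_nonzero: "AE x in circ. AE \<theta> in circ. side (x + u) \<theta> \<noteq> 0"
proof -
  have "AE x in circ. side (x + u) \<theta> \<noteq> 0" for \<theta>
  proof -
    obtain \<xi> where \<xi>: "F \<theta> = cis \<xi>" using unimodular_cis[OF F_unit] by metis
    have "{x. side (x + u) \<theta> = 0} \<subseteq> range (\<lambda>i::int. of_int i * pi + pi / 2 - u + \<xi>)"
    proof
      fix x assume "x \<in> {x. side (x + u) \<theta> = 0}"
      then have "cos (x + u - \<xi>) = 0" by (simp only: side_def \<xi> sgn_Re_cis sgn_0_0 mem_Collect_eq)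
      then obtain i :: int where "x + u - \<xi> = of_int i * pi + pi / 2" using cos_zero_iff_int2 by blast
      then have "x = of_int i * pi + pi / 2 - u + \<xi>" by simp
      then show "x \<in> range (\<lambda>i::int. of_int i * pi + pi / 2 - u + \<xi>)" by blast
    qed
    then have "countable {x. side (x + u) \<theta> = 0}" by (rule countable_subset) simp
    then have "{x. side (x + u) \<theta> = 0} \<in> null_sets lborel" by (rule countable_imp_null_set_lborel)
    then have "AE x in lborel. side (x + u) \<theta> \<noteq> 0" by (rule AE_I') auto
    then show ?thesis unfolding AE_circ by auto
  qed
  then have "AE \<theta> in circ. AE x in circ. side (x + u) \<theta> \<noteq> 0" by simp
  moreover have "{z \<in> space (circ \<Otimes>\<^sub>M circ). side (fst z + u) (snd z) \<noteq> 0} \<in> sets (circ \<Otimes>\<^sub>M circ)"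
    by measurable
  ultimately show ?thesis using circ2.AE_commute[of "\<lambda>x \<theta>. side (x + u) \<theta> \<noteq> 0"] by blast
qed

end

section \<open>Finite kernel sums tested against the sine\<close>

lemma integral_circ_cos: "(LINT u|circ. cos (real_of_int m * u)) = (if m = 0 then 2 * pi else 0)"
proof -
  have "integrable circ (\<lambda>u. cis (real_of_int m * u))"
    by (rule integrable_circ[where B = 1]) auto
  from integral_Re[OF this] show ?thesis by (simp add: integral_circ_cis)
qed

lemma integral_sin_sin:
  assumes "1 \<le> n"
  shows "(LINT u|circ. sin u * sin (real n * u)) = (if n = 1 then pi else 0)"
proof -
  have int: "integrable circ (\<lambda>u. cos (real_of_int m * u))" for m
    by (rule integrable_circ[where B = 1]) auto
  have "sin u * sin (real n * u) = cos (real_of_int (int n - 1) * u) / 2 - cos (real_of_int (int n + 1) * u) / 2" for u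
    using sin_times_sin[of "real n * u" u] by (simp add: algebra_simps)
  then have "(LINT u|circ. sin u * sin (real n * u))
    = (LINT u|circ. cos (real_of_int (int n - 1) * u)) / 2 - (LINT u|circ. cos (real_of_int (int n + 1) * u)) / 2"
    using int[of "int n - 1"] int[of "int n + 1"] by (simp add: Bochner_Integration.integral_diff)
  then show ?thesis unfolding integral_circ_cos using assms by auto
qed

text \<open>Truncated, so that sums and integrals exchange trivially; the distance to the full
  kernel is carried along as \<epsilon>.\<close>

definition kernel_sum :: "(nat \<Rightarrow> real) \<Rightarrow> nat \<Rightarrow> real \<Rightarrow> real" where
  "kernel_sum w N v = (\<Sum>n=1..N. w n * sin (real n * v) / real n)"

lemma kernel_sum_measurable [measurable]: "kernel_sum w N \<in> borel_measurable borel"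
  unfolding kernel_sum_def[abs_def] by measurable

lemma abs_kernel_sum_le: "\<bar>kernel_sum w N v\<bar> \<le> (\<Sum>n=1..N. \<bar>w n\<bar>)"
  unfolding kernel_sum_def
proof (rule order_trans[OF sum_abs], rule sum_mono)
  fix n assume "n \<in> {1..N}"
  then have "\<bar>sin (real n * v)\<bar> / real n \<le> 1" by (auto simp: divide_le_eq intro: order_trans[OF abs_sin_le_one])
  then have "\<bar>w n\<bar> * (\<bar>sin (real n * v)\<bar> / real n) \<le> \<bar>w n\<bar> * 1" by (intro mult_left_mono) auto
  then show "\<bar>w n * sin (real n * v) / real n\<bar> \<le> \<bar>w n\<bar>" by (simp add: abs_mult)
qed

text \<open>Orthogonality removes every term except \<open>n = 1\<close>; this is why only
  \<open>w 1\<close> appears in the final bound and why lowering \<open>w 1\<close> yields a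
  gain.\<close>

lemma integral_sin_kernel_sum:
  assumes "1 \<le> N"
  shows "(LINT u|circ. sin u * kernel_sum w N u) = pi * w 1"
proof -
  have int: "integrable circ (\<lambda>u. sin u * sin (real n * u))" for n
    by (rule integrable_circ[where B = 1]) (auto simp: abs_mult intro!: mult_le_one)
  have "(LINT u|circ. sin u * kernel_sum w N u) = (LINT u|circ. (\<Sum>n=1..N. (w n / real n) * (sin u * sin (real n * u))))"
    unfolding kernel_sum_def by (simp add: sum_distrib_left mult_ac)
  also have "\<dots> = (\<Sum>n=1..N. (w n / real n) * (LINT u|circ. sin u * sin (real n * u)))"
    by (subst Bochner_Integration.integral_sum) (intro Bochner_Integration.integrable_mult_right int, simp only: integral_mult_right_zero)
  also have "\<dots> = (\<Sum>n=1..N. if n = 1 then pi * w 1 else 0)"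
    by (intro sum.cong refl) (auto simp: integral_sin_sin)
  also have "\<dots> = pi * w 1" using assms by simp
  finally show ?thesis .
qed

lemma integral_sin_kernel_sum_shift:
  assumes "1 \<le> N"
  shows "(LINT u|circ. sin u * kernel_sum w N (u + pi)) = - pi * w 1"
proof -
  let ?f = "\<lambda>u. sin u * kernel_sum w N u"
  have "kernel_sum w N (u + 2 * pi) = kernel_sum w N u" for u
  proof -
    have "sin (real n * (u + 2 * pi)) = sin (real n * u)" for n
      using sin_int_2pin[of "int n"] cos_int_2pin[of "int n"] by (simp add: distrib_left sin_add mult_ac)
    then show ?thesis unfolding kernel_sum_def by simp
  qed
  then have per: "?f (u + 2 * pi) = ?f u" for u by simp
  have bd: "norm (?f u) \<le> (\<Sum>n=1..N. \<bar>w n\<bar>)" for u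
    using mult_mono[OF abs_sin_le_one[of u] abs_kernel_sum_le[of w N u]] by (simp add: abs_mult)
  have "(LINT u|circ. ?f (u + pi)) = (LINT u|circ. ?f u)"
  proof (rule circ_shift[where B = "\<Sum>n=1..N. \<bar>w n\<bar>"])
    show "norm (?f u) \<le> (\<Sum>n=1..N. \<bar>w n\<bar>)" for u by (rule bd)
    show "?f (u + 2 * pi) = ?f u" for u by (rule per)
  qed auto
  then show ?thesis using integral_sin_kernel_sum[OF assms, of w] by (simp add: minus_equation_iff)
qed

text \<open>The two facts required of the geometry, both up to null sets: a half plane through 0
  corresponds to an arc, and no open sector cut out by two lines is avoided. The second makes arcs
  of different half planes linked.\<close>

locale monotone_boundary = circle_boundary +
  assumes arcs: "\<And>x. (AE \<theta> in circ. side x \<theta> \<noteq> 0) \<Longrightarrow>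
      \<exists>a b \<sigma>. 0 \<le> a \<and> a \<le> b \<and> b \<le> 2 * pi \<and> (\<sigma> = 1 \<or> \<sigma> = - 1) \<and>
        (AE \<theta> in circ. side x \<theta> = \<sigma> * interval_sign a b \<theta>)"
    and sectors: "\<And>x u \<sigma> \<tau>. 0 < u \<Longrightarrow> u < pi \<Longrightarrow> \<sigma> \<in> {1, - 1} \<Longrightarrow> \<tau> \<in> {1, - 1} \<Longrightarrow>
      \<not> (AE \<theta> in circ. \<not> (side x \<theta> = \<sigma> \<and> side (x + u) \<theta> = \<tau>))"
begin

lemma side_coeff_arc:
  assumes "AE \<theta> in circ. side x \<theta> = \<sigma> * interval_sign a b \<theta>"
    and "0 \<le> a" "a \<le> b" "b \<le> 2 * pi" "n \<noteq> 0"
  shows "side_coeff n x = of_real \<sigma> * (2 * \<i> / of_int n * (cis (- (real_of_int n * b)) - cis (- (real_of_int n * a))))"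
proof -
  have "side_coeff n x = (LINT \<theta>|circ. of_real \<sigma> * (of_real (interval_sign a b \<theta>) * cis (- (real_of_int n * \<theta>))))"
    unfolding side_coeff_def
    by (rule integral_cong_AE) (measurable, use assms(1) in \<open>auto elim!: eventually_mono\<close>)
  also have "\<dots> = of_real \<sigma> * (LINT \<theta>|circ. of_real (interval_sign a b \<theta>) * cis (- (real_of_int n * \<theta>)))"
    by simp
  finally show ?thesis using fourier_interval_sign[OF assms(2-5)] by (simp only:)
qed

lemma side_corr_arcs:
  assumes "AE \<theta> in circ. side x \<theta> = \<sigma> * interval_sign a b \<theta>"
    and "AE \<theta> in circ. side y \<theta> = \<sigma>' * interval_sign a' b' \<theta>"
  shows "side_corr x y = \<sigma> * \<sigma>' * (LINT \<theta>|circ. interval_sign a b \<theta> * interval_sign a' b' \<theta>)"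
proof -
  have "side_corr x y = (LINT \<theta>|circ. (\<sigma> * \<sigma>') * (interval_sign a b \<theta> * interval_sign a' b' \<theta>))"
    unfolding side_corr_def
  proof (rule integral_cong_AE)
    show "AE \<theta> in circ. side x \<theta> * side y \<theta> = (\<sigma> * \<sigma>') * (interval_sign a b \<theta> * interval_sign a' b' \<theta>)"
      using assms by eventually_elim (simp add: mult_ac)
  qed measurable
  then show ?thesis by simp
qed

text \<open>For two linked boundary arcs, \<open>g1\<close> to \<open>g4\<close> are the lengths of the four arcs cut out by their
  endpoints in cyclic order; \<open>\<kappa>\<close> and \<open>\<kappa>'\<close> record the two signs (complements, orientation).\<close>
definition gap_form :: "real \<Rightarrow> real \<Rightarrow> bool" where
  "gap_form x y \<longleftrightarrow> (\<exists>g1 g2 g3 g4 \<kappa> \<kappa>'. 0 \<le> g1 \<and> 0 \<le> g2 \<and> 0 \<le> g3 \<and> 0 \<le> g4 \<and> g1 + g2 + g3 + g4 = 2 * pi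
    \<and> \<bar>\<kappa>\<bar> = 1 \<and> \<bar>\<kappa>'\<bar> = 1 \<and> side_corr x y = \<kappa> * (g2 + g4 - g1 - g3)
    \<and> (\<forall>n::int. n \<noteq> 0 \<longrightarrow> - of_int n * Im (side_coeff n y * cnj (side_coeff n x))
        = \<kappa>' * (4 * ((sin (of_int n * g1) + sin (of_int n * g2) + sin (of_int n * g3) + sin (of_int n * g4)) / of_int n))))"

lemma gap_form_linked:
  assumes x: "AE \<theta> in circ. side x \<theta> = \<sigma> * interval_sign a b \<theta>" "\<bar>\<sigma>\<bar> = 1"
    and y: "AE \<theta> in circ. side y \<theta> = \<sigma>' * interval_sign a' b' \<theta>" "\<bar>\<sigma>'\<bar> = 1"
    and o: "0 \<le> a" "a \<le> a'" "a' \<le> b" "b \<le> b'" "b' \<le> 2 * pi"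
  shows "gap_form x y"
proof -
  let ?g1 = "a' - a" let ?g2 = "b - a'" let ?g3 = "b' - b" let ?g4 = "2 * pi - (b' - a)"
  have "side_corr x y = (\<sigma> * \<sigma>') * (?g2 + ?g4 - ?g1 - ?g3)"
    using side_corr_arcs[OF x(1) y(1)] integral_linked_interval_signs[OF o] by simp
  moreover have "- of_int n * Im (side_coeff n y * cnj (side_coeff n x))
        = (\<sigma> * \<sigma>') * (4 * ((sin (of_int n * ?g1) + sin (of_int n * ?g2) + sin (of_int n * ?g3) + sin (of_int n * ?g4)) / of_int n))"
    if n: "n \<noteq> 0" for n :: int
  proof -
    define A where "A = 2 * \<i> / of_int n * (cis (- (real_of_int n * b)) - cis (- (real_of_int n * a)))"
    define B where "B = 2 * \<i> / of_int n * (cis (- (real_of_int n * b')) - cis (- (real_of_int n * a')))"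
    have "side_coeff n x = of_real \<sigma> * A" unfolding A_def
      using o n by (intro side_coeff_arc x(1)) auto
    moreover have "side_coeff n y = of_real \<sigma>' * B" unfolding B_def
      using o n by (intro side_coeff_arc y(1)) auto
    ultimately have "side_coeff n y * cnj (side_coeff n x) = of_real (\<sigma> * \<sigma>') * (B * cnj A)"
      by (simp only: complex_cnj_mult complex_cnj_complex_of_real of_real_mult mult_ac)
    then have "Im (side_coeff n y * cnj (side_coeff n x)) = (\<sigma> * \<sigma>') * Im (B * cnj A)"
      by (simp only: times_complex.sel Re_complex_of_real Im_complex_of_real mult_zero_left add_0_right)
    then have "- of_int n * Im (side_coeff n y * cnj (side_coeff n x)) = (\<sigma> * \<sigma>') * (- of_int n * Im (B * cnj A))"
      by (simp only: mult_ac)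
    also have "- of_int n * Im (B * cnj A) = 4 * ((sin (of_int n * ?g3) + sin (of_int n * ?g2) + sin (of_int n * ?g1)
        - sin (of_int n * (b' - a))) / of_int n)"
      unfolding A_def B_def by (rule Im_fourier_product[OF n])
    \<comment> \<open>Reflection at a multiple of \<open>2 * pi\<close> turns the only sine with a
      negative sign into that of the gap through the angle 0.\<close>
    also have "- sin (of_int n * (b' - a)) = sin (of_int n * ?g4)"
    proof -
      have "sin (of_int n * (2 * pi)) = 0" "cos (of_int n * (2 * pi)) = 1"
        using sin_int_2pin[of n] cos_int_2pin[of n] by (simp_all add: mult_ac)
      then show ?thesis by (simp add: right_diff_distrib[of _ "2 * pi"] sin_diff)
    qed
    then have "sin (of_int n * ?g3) + sin (of_int n * ?g2) + sin (of_int n * ?g1) - sin (of_int n * (b' - a))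
       = sin (of_int n * ?g1) + sin (of_int n * ?g2) + sin (of_int n * ?g3) + sin (of_int n * ?g4)"
      by linarith
    finally show ?thesis .
  qed
  moreover have "\<bar>\<sigma> * \<sigma>'\<bar> = 1" using x y by (simp add: abs_mult)
  moreover have "0 \<le> ?g1" "0 \<le> ?g2" "0 \<le> ?g3" "0 \<le> ?g4" "?g1 + ?g2 + ?g3 + ?g4 = 2 * pi" using o by auto
  ultimately show ?thesis unfolding gap_form_def by blast
qed

text \<open>Exchanging the two lines conjugates the product, which flips \<kappa>' only. It covers
  the case in which the interval of the second line starts first.\<close>

lemma gap_form_sym:
  assumes "gap_form x y" shows "gap_form y x"
proof -
  obtain g1 g2 g3 g4 \<kappa> \<kappa>' where g: "0 \<le> g1" "0 \<le> g2" "0 \<le> g3" "0 \<le> g4" "g1 + g2 + g3 + g4 = 2 * pi"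
    "\<bar>\<kappa>\<bar> = 1" "\<bar>\<kappa>'\<bar> = 1" "side_corr x y = \<kappa> * (g2 + g4 - g1 - g3)"
    and s: "\<And>n::int. n \<noteq> 0 \<Longrightarrow> - of_int n * Im (side_coeff n y * cnj (side_coeff n x))
        = \<kappa>' * (4 * ((sin (of_int n * g1) + sin (of_int n * g2) + sin (of_int n * g3) + sin (of_int n * g4)) / of_int n))"
    using assms unfolding gap_form_def by blast
  have "side_corr y x = \<kappa> * (g2 + g4 - g1 - g3)"
    using g(8) by (simp add: side_corr_def mult.commute)
  moreover have "- of_int n * Im (side_coeff n x * cnj (side_coeff n y))
        = (- \<kappa>') * (4 * ((sin (of_int n * g1) + sin (of_int n * g2) + sin (of_int n * g3) + sin (of_int n * g4)) / of_int n))"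
    if "n \<noteq> 0" for n :: int
  proof -
    have "Im (side_coeff n x * cnj (side_coeff n y)) = - Im (side_coeff n y * cnj (side_coeff n x))" by simp
    then show ?thesis using s[OF that] by (simp only: minus_mult_left[symmetric] minus_mult_right[symmetric])
  qed
  moreover have "\<bar>- \<kappa>'\<bar> = 1" using g by simp
  ultimately show ?thesis using g(1-6) unfolding gap_form_def by blast
qed

text \<open>Since no sector is avoided, neither arc is contained in the other or in its complement, so their
  endpoints interlace.\<close>
lemma gap_form:
  assumes u: "0 < u" "u < pi" and "AE \<theta> in circ. side x \<theta> \<noteq> 0" "AE \<theta> in circ. side (x + u) \<theta> \<noteq> 0"
  shows "gap_form x (x + u)"
proof -
  obtain a b \<sigma> where o: "0 \<le> a" "a \<le> b" "b \<le> 2 * pi" and \<sigma>: "\<sigma> = 1 \<or> \<sigma> = - 1"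
    and x: "AE \<theta> in circ. side x \<theta> = \<sigma> * interval_sign a b \<theta>" using arcs assms(3) by blast
  obtain a' b' \<sigma>' where o': "0 \<le> a'" "a' \<le> b'" "b' \<le> 2 * pi" and \<sigma>': "\<sigma>' = 1 \<or> \<sigma>' = - 1"
    and y: "AE \<theta> in circ. side (x + u) \<theta> = \<sigma>' * interval_sign a' b' \<theta>" using arcs assms(4) by blast
  have ex: "\<exists>\<theta>. interval_sign a b \<theta> = \<alpha> \<and> interval_sign a' b' \<theta> = \<beta>" if "\<alpha> \<in> {1, - 1}" "\<beta> \<in> {1, - 1}" for \<alpha> \<beta>
  proof (rule ccontr)
    assume no: "\<not> ?thesis"
    have "AE \<theta> in circ. \<not> (side x \<theta> = \<sigma> * \<alpha> \<and> side (x + u) \<theta> = \<sigma>' * \<beta>)"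
      using x y
    proof eventually_elim
      case (elim \<theta>)
      show ?case using no elim \<sigma> \<sigma>' by auto
    qed
    then show False using sectors[OF u, of "\<sigma> * \<alpha>" "\<sigma>' * \<beta>" x] \<sigma> \<sigma>' that by auto
  qed
  \<comment> \<open>A common point, together with a point of each interval outside the other, means
    that the intervals overlap without being nested.\<close>
  obtain t1 where t1: "a < t1" "t1 < b" "a' < t1" "t1 < b'"
    using ex[of 1 1] by (auto simp: interval_sign_def split: if_splits)
  obtain t2 where t2: "a < t2" "t2 < b" "t2 \<le> a' \<or> b' \<le> t2"
    using ex[of 1 "- 1"] by (auto simp: interval_sign_def not_less split: if_splits)
  obtain t3 where "interval_sign a b t3 = - 1" "interval_sign a' b' t3 = 1"
    using ex[of "- 1" 1] by auto
  then have t3: "a' < t3" "t3 < b'" "t3 \<le> a \<or> b \<le> t3"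
    by (auto simp: interval_sign_def split: if_splits)
  have s: "\<bar>\<sigma>\<bar> = 1" "\<bar>\<sigma>'\<bar> = 1" using \<sigma> \<sigma>' by auto
  consider "a \<le> a'" "a' \<le> b" "b \<le> b'" | "a' \<le> a" "a \<le> b'" "b' \<le> b"
    using t1 t2 t3 by linarith
  then show ?thesis
  proof cases
    case 1 then show ?thesis using gap_form_linked[OF x s(1) y s(2)] o o' by blast
  next
    case 2 then show ?thesis using gap_form_linked[OF y s(2) x s(1)] o o' gap_form_sym by blast
  qed
qed

definition pair_sum :: "(nat \<Rightarrow> real) \<Rightarrow> nat \<Rightarrow> real \<Rightarrow> real \<Rightarrow> real" where
  "pair_sum w N x y = (\<Sum>n=1..N. w n * (- real n * Im (side_coeff (int n) y * cnj (side_coeff (int n) x))))"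

text \<open>The tangent point is \<open>pi - u\<close> for the two gaps where the sides agree and
  \<open>u\<close> for the two where they differ. Whatever the sign \<kappa> is, these pairs have
  total lengths \<open>(2 * pi + side_corr x (x + u)) / 2\<close> and
  \<open>(2 * pi - side_corr x (x + u)) / 2\<close>, so the correction is linear in
  \<open>side_corr\<close>.\<close>

lemma pair_sum_bound:
  assumes K: "concave_kernel \<Phi> \<phi>"
    and approx: "\<And>v. \<bar>\<Phi> v - kernel_sum w N v\<bar> \<le> \<epsilon>"
    and u: "0 < u" "u < pi" and gap: "gap_form x (x + u)"
  shows "\<bar>pair_sum w N x (x + u)\<bar> \<le> 8 * \<Phi> u + 8 * \<Phi> (pi - u) + 16 * \<epsilon>
    + (2 * \<phi> (pi - u) - 2 * \<phi> u) * (side_corr x (x + u) - (2 * pi - 4 * u))"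
proof -
  interpret concave_kernel \<Phi> \<phi> by (rule K)
  obtain g1 g2 g3 g4 \<kappa> \<kappa>' where g: "0 \<le> g1" "0 \<le> g2" "0 \<le> g3" "0 \<le> g4" "g1 + g2 + g3 + g4 = 2 * pi"
    "\<bar>\<kappa>\<bar> = 1" "\<bar>\<kappa>'\<bar> = 1" "side_corr x (x + u) = \<kappa> * (g2 + g4 - g1 - g3)"
    and s: "\<And>n::int. n \<noteq> 0 \<Longrightarrow> - of_int n * Im (side_coeff n (x + u) * cnj (side_coeff n x))
        = \<kappa>' * (4 * ((sin (of_int n * g1) + sin (of_int n * g2) + sin (of_int n * g3) + sin (of_int n * g4)) / of_int n))"
    using gap unfolding gap_form_def by blast
  let ?P = "kernel_sum w N"
  have "pair_sum w N x (x + u) = (\<Sum>n=1..N. \<kappa>' * 4 * (w n * sin (real n * g1) / real n + w n * sin (real n * g2) / real n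
      + w n * sin (real n * g3) / real n + w n * sin (real n * g4) / real n))"
    unfolding pair_sum_def
  proof (rule sum.cong[OF refl])
    fix n assume "n \<in> {1..N}"
    then show "w n * (- real n * Im (side_coeff (int n) (x + u) * cnj (side_coeff (int n) x)))
      = \<kappa>' * 4 * (w n * sin (real n * g1) / real n + w n * sin (real n * g2) / real n
      + w n * sin (real n * g3) / real n + w n * sin (real n * g4) / real n)"
      using s[of "int n"] by (simp only: of_int_of_nat_eq) (simp add: algebra_simps add_divide_distrib)
  qed
  also have "\<dots> = \<kappa>' * 4 * (?P g1 + ?P g2 + ?P g3 + ?P g4)"
    unfolding kernel_sum_def by (simp only: sum.distrib sum_distrib_left[symmetric])
  finally have "\<bar>pair_sum w N x (x + u)\<bar> = 4 * \<bar>?P g1 + ?P g2 + ?P g3 + ?P g4\<bar>" using g by (simp add: abs_mult)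
  also have "\<dots> \<le> 4 * (\<Phi> g1 + \<Phi> g2 + \<Phi> g3 + \<Phi> g4 + 4 * \<epsilon>)"
  proof -
    have "\<bar>?P g1 + ?P g2 + ?P g3 + ?P g4\<bar> \<le> \<Phi> g1 + \<Phi> g2 + \<Phi> g3 + \<Phi> g4 + 4 * \<epsilon>"
      using approx[of g1, unfolded abs_le_iff] approx[of g2, unfolded abs_le_iff] approx[of g3, unfolded abs_le_iff]
        approx[of g4, unfolded abs_le_iff] four_gaps_nonneg[OF g(1-5)] by (intro abs_leI) linarith+
    then show ?thesis by simp
  qed
  also have "\<Phi> g1 + \<Phi> g2 + \<Phi> g3 + \<Phi> g4 \<le> 2 * \<Phi> (pi - u) + 2 * \<Phi> u
     + \<phi> (pi - u) * ((2 * pi + side_corr x (x + u)) / 2 - 2 * (pi - u)) + \<phi> u * ((2 * pi - side_corr x (x + u)) / 2 - 2 * u)"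
  proof (cases "\<kappa> = 1")
    case True
    have e: "(2 * pi + side_corr x (x + u)) / 2 = g2 + g4" "(2 * pi - side_corr x (x + u)) / 2 = g1 + g3"
      using g(5,8) True by auto
    show ?thesis unfolding e
      using four_gaps[of g2 g1 g4 g3 "pi - u" u] g(1-5) u by (simp add: algebra_simps)
  next
    case False
    then have "\<kappa> = - 1" using g(6) by linarith
    then have e: "(2 * pi + side_corr x (x + u)) / 2 = g1 + g3" "(2 * pi - side_corr x (x + u)) / 2 = g2 + g4"
      using g(5,8) by auto
    show ?thesis unfolding e
      using four_gaps[of g1 g2 g3 g4 "pi - u" u] g(1-5) u by (simp add: algebra_simps)
  qed
  finally show ?thesis by (simp add: algebra_simps add_divide_distrib diff_divide_distrib)
qed

lemma pair_sum_conv: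
  "(LINT x|circ. pair_sum w N x (x + u)) = (\<Sum>n=1..N. w n * (- real n * Im (side_conv (int n) u)))"
proof -
  have bd: "norm (side_coeff n y * cnj (side_coeff n x)) \<le> (2 * pi) * (2 * pi)" for x y n
    unfolding norm_mult complex_mod_cnj by (intro mult_mono norm_side_coeff) auto
  have int: "integrable circ (\<lambda>x. side_coeff n (x + u) * cnj (side_coeff n x))" for n
    by (rule integrable_circ[OF _ bd]) measurable
  have "(LINT x|circ. pair_sum w N x (x + u))
      = (\<Sum>n=1..N. LINT x|circ. w n * (- real n * Im (side_coeff (int n) (x + u) * cnj (side_coeff (int n) x))))"
    unfolding pair_sum_def
    by (intro Bochner_Integration.integral_sum Bochner_Integration.integrable_mult_right integrable_Im int)
  also have "\<dots> = (\<Sum>n=1..N. w n * (- real n * Im (side_conv (int n) u)))"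
    using integral_Im[OF int] by (simp only: integral_mult_right_zero side_conv_def)
  finally show ?thesis .
qed

lemma pair_sum_measurable [measurable]: "(\<lambda>x. pair_sum w N x (x + u)) \<in> borel_measurable borel"
  unfolding pair_sum_def by measurable

lemma abs_pair_sum_le: "\<bar>pair_sum w N x y\<bar> \<le> (\<Sum>n=1..N. \<bar>w n\<bar> * (real n * ((2 * pi) * (2 * pi))))"
  unfolding pair_sum_def
proof (rule order_trans[OF sum_abs], rule sum_mono)
  fix n
  have "norm (side_coeff (int n) y * cnj (side_coeff (int n) x)) \<le> (2 * pi) * (2 * pi)"
    unfolding norm_mult complex_mod_cnj by (intro mult_mono norm_side_coeff) auto
  then have "\<bar>Im (side_coeff (int n) y * cnj (side_coeff (int n) x))\<bar> \<le> (2 * pi) * (2 * pi)"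
    using abs_Im_le_cmod order_trans by blast
  then show "\<bar>w n * (- real n * Im (side_coeff (int n) y * cnj (side_coeff (int n) x)))\<bar>
      \<le> \<bar>w n\<bar> * (real n * ((2 * pi) * (2 * pi)))"
    unfolding abs_mult abs_minus_cancel abs_of_nat by (intro mult_left_mono) auto
qed

text \<open>Integration over \<open>x\<close> of \<open>pair_sum_bound\<close>: the linear
  correction disappears by \<open>side_corr_average\<close>, and only the kernel at the mean gaps
  remains.\<close>

lemma conv_sum_bound:
  assumes K: "concave_kernel \<Phi> \<phi>"
    and approx: "\<And>v. \<bar>\<Phi> v - kernel_sum w N v\<bar> \<le> \<epsilon>"
    and u: "0 < u" "u < pi"
  shows "\<bar>\<Sum>n=1..N. w n * (- real n * Im (side_conv (int n) u))\<bar> \<le> 16 * pi * (\<Phi> u + \<Phi> (pi - u)) + 32 * pi * \<epsilon>"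
proof -
  let ?b = "\<lambda>x. 8 * \<Phi> u + 8 * \<Phi> (pi - u) + 16 * \<epsilon> + (2 * \<phi> (pi - u) - 2 * \<phi> u) * (side_corr x (x + u) - (2 * pi - 4 * u))"
  have ic: "integrable circ (\<lambda>x. side_corr x (x + u))"
    by (rule integrable_circ[where B = "2 * pi"]) (simp_all add: abs_side_corr)
  have ib: "integrable circ ?b"
    by (intro Bochner_Integration.integrable_add Bochner_Integration.integrable_mult_right
        Bochner_Integration.integrable_diff ic) simp_all
  have ip: "integrable circ (\<lambda>x. pair_sum w N x (x + u))"
    by (rule integrable_circ[OF pair_sum_measurable]) (unfold real_norm_def, rule abs_pair_sum_le)
  have "AE x in circ. gap_form x (x + u)"
    using AE_side_nonzero[of 0] AE_side_nonzero[of u]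
    by eventually_elim (use gap_form[OF u] in simp)
  then have "AE x in circ. \<bar>pair_sum w N x (x + u)\<bar> \<le> ?b x"
    by eventually_elim (rule pair_sum_bound[OF K approx u])
  then have "\<bar>LINT x|circ. pair_sum w N x (x + u)\<bar> \<le> (LINT x|circ. ?b x)"
    by (intro order_trans[OF integral_abs_bound] integral_mono_AE ip ib integrable_abs)
  also have "(LINT x|circ. ?b x) = (LINT x|circ. 8 * \<Phi> u + 8 * \<Phi> (pi - u) + 16 * \<epsilon>)
      + (2 * \<phi> (pi - u) - 2 * \<phi> u) * ((LINT x|circ. side_corr x (x + u)) - (LINT x|circ. 2 * pi - 4 * u))"
    using ic by (simp add: Bochner_Integration.integral_diff)
  also have "\<dots> = 16 * pi * (\<Phi> u + \<Phi> (pi - u)) + 32 * pi * \<epsilon>"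
    using u by (subst side_corr_average) (auto simp: measure_circ algebra_simps)
  finally show ?thesis unfolding pair_sum_conv .
qed

end

context monotone_boundary
begin

text \<open>By \<open>coeff_difference\<close> the weighted sum is one eighth of the integral of
  \<open>sin u * k u\<close>. Replacing \<open>k\<close> by its bound leaves a sine test of the
  kernel sum, which is evaluated exactly.\<close>

theorem coefficient_inequality:
  assumes K: "concave_kernel \<Phi> \<phi>"
    and approx: "\<And>v. \<bar>\<Phi> v - kernel_sum w N v\<bar> \<le> \<epsilon>" and N: "1 \<le> N"
  shows "\<bar>\<Sum>n=1..N. w n * (real n * ((cmod (coeff (int n)))\<^sup>2 - (cmod (coeff (- int n)))\<^sup>2))\<bar>
    \<le> 4 * pi\<^sup>2 * w 1 + 16 * pi\<^sup>2 * \<epsilon>"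
proof -
  interpret concave_kernel \<Phi> \<phi> by (rule K)
  define k where "k u = (\<Sum>n=1..N. w n * (- real n * Im (side_conv (int n) u)))" for u
  \<comment> \<open>Writing \<open>\<Phi> (pi - u)\<close> as \<open>- \<Phi> (u + pi)\<close> makes
    the bound antiperiodic under \<open>pi\<close>, as \<open>k\<close> is. Multiplied by the sine
    both become periodic under \<open>pi\<close>, so the estimate on \<open>(0, pi)\<close> extends
    to the whole circle.\<close>
  define B where "B u = 16 * pi * (\<Phi> u - \<Phi> (u + pi))" for u
  have [measurable]: "k \<in> borel_measurable borel" unfolding k_def[abs_def] by measurable
  have [measurable]: "\<Phi> \<in> borel_measurable borel"
    by (intro borel_measurable_continuous_onI continuous_at_imp_continuous_on ballI DERIV_isCont[OF deriv])
  have [measurable]: "B \<in> borel_measurable borel" unfolding B_def[abs_def] by measurable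
  have \<epsilon>: "0 \<le> \<epsilon>" using approx[of 0] by linarith
  have k_le: "\<bar>k u\<bar> \<le> B u + 32 * pi * \<epsilon>" if "0 < u" "u < pi" for u
  proof -
    have "\<Phi> (pi - u) = - \<Phi> (u + pi)" using reflect[of "u + pi"] by (simp add: algebra_simps)
    then show ?thesis using conv_sum_bound[OF K approx that] by (simp add: k_def B_def)
  qed
  have k_anti: "k (u + pi) = - k u" for u
    unfolding k_def side_conv_antiperiodic by (simp add: sum_negf)
  have B_anti: "B (u + pi) = - B u" for u
    using periodic[of u] by (simp add: B_def algebra_simps)
  have pt: "\<bar>sin u * k u\<bar> \<le> sin u * B u + 32 * pi * \<epsilon>"
    if "0 < u \<and> u < pi \<or> pi < u \<and> u < 2 * pi" for u
  proof -
    have main: "\<bar>sin u * k u\<bar> \<le> sin u * B u + 32 * pi * \<epsilon>" if u: "0 < u" "u < pi" for u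
    proof -
      have s: "0 < sin u" using u by (rule sin_gt_zero)
      have "\<bar>sin u * k u\<bar> \<le> sin u * (B u + 32 * pi * \<epsilon>)"
        using s k_le[OF u] by (simp add: abs_mult mult_left_mono)
      moreover have "sin u * (32 * pi * \<epsilon>) \<le> 1 * (32 * pi * \<epsilon>)"
        using \<epsilon> by (intro mult_right_mono) auto
      ultimately show ?thesis unfolding distrib_left by linarith
    qed
    show ?thesis
    proof (cases "u < pi")
      case True then show ?thesis using main that by auto
    next
      case False
      then show ?thesis using main[of "u - pi"] that k_anti[of "u - pi"] B_anti[of "u - pi"] by (simp add: sin_diff)
    qed
  qed
  define P where "P = kernel_sum w N"
  \<comment> \<open>Back from the kernel to its truncation, at the cost of \<epsilon> for each of
    the two values, in order to use orthogonality.\<close>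
  have PB: "sin u * B u \<le> 16 * pi * (sin u * P u - sin u * P (u + pi)) + 32 * pi * \<epsilon>" for u
  proof -
    have "\<bar>(\<Phi> u - \<Phi> (u + pi)) - (P u - P (u + pi))\<bar> \<le> 2 * \<epsilon>"
      using approx[of u] approx[of "u + pi"] unfolding P_def by linarith
    then have "\<bar>sin u * ((\<Phi> u - \<Phi> (u + pi)) - (P u - P (u + pi)))\<bar> \<le> 1 * (2 * \<epsilon>)"
      unfolding abs_mult by (intro mult_mono) auto
    then have "sin u * (\<Phi> u - \<Phi> (u + pi)) \<le> sin u * (P u - P (u + pi)) + 2 * \<epsilon>"
      by (simp add: right_diff_distrib)
    then have "16 * pi * (sin u * (\<Phi> u - \<Phi> (u + pi))) \<le> 16 * pi * (sin u * (P u - P (u + pi)) + 2 * \<epsilon>)"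
      by (intro mult_left_mono) auto
    then show ?thesis by (simp add: B_def algebra_simps)
  qed
  have iP: "integrable circ (\<lambda>u. sin u * P (u + c))" for c
    by (rule integrable_circ[where B = "\<Sum>n=1..N. \<bar>w n\<bar>"])
      (use mult_mono[OF abs_sin_le_one abs_kernel_sum_le] in \<open>auto simp: abs_mult P_def\<close>)
  have ik: "integrable circ (\<lambda>u. sin u * k u)"
  proof (rule integrable_circ)
    have "\<bar>k u\<bar> \<le> (\<Sum>n=1..N. \<bar>w n\<bar> * (real n * (2 * pi) ^ 3))" for u
      unfolding k_def
    proof (rule order_trans[OF sum_abs], rule sum_mono)
      fix n
      have "\<bar>Im (side_conv (int n) u)\<bar> \<le> (2 * pi) ^ 3"
        by (rule order_trans[OF abs_Im_le_cmod norm_side_conv])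
      then show "\<bar>w n * (- real n * Im (side_conv (int n) u))\<bar> \<le> \<bar>w n\<bar> * (real n * (2 * pi) ^ 3)"
        unfolding abs_mult abs_minus_cancel abs_of_nat by (intro mult_left_mono) auto
    qed
    from mult_mono[OF abs_sin_le_one this]
    show "norm (sin u * k u) \<le> 1 * (\<Sum>n=1..N. \<bar>w n\<bar> * (real n * (2 * pi) ^ 3))" for u by (simp add: abs_mult)
  qed measurable
  have "8 * (\<Sum>n=1..N. w n * (real n * ((cmod (coeff (int n)))\<^sup>2 - (cmod (coeff (- int n)))\<^sup>2)))
    = (\<Sum>n=1..N. w n * (real n * (8 * ((cmod (coeff (int n)))\<^sup>2 - (cmod (coeff (- int n)))\<^sup>2))))"
    by (simp only: sum_distrib_left mult.left_commute)
  also have "\<dots> = (\<Sum>n=1..N. LINT u|circ. w n * (- real n * (sin u * Im (side_conv (int n) u))))"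
    unfolding coeff_difference integral_mult_right_zero by (simp only: mult_minus_left mult_minus_right)
  also have "\<dots> = (LINT u|circ. (\<Sum>n=1..N. w n * (- real n * (sin u * Im (side_conv (int n) u)))))"
  proof (rule Bochner_Integration.integral_sum[symmetric], intro Bochner_Integration.integrable_mult_right)
    fix n
    show "integrable circ (\<lambda>u. sin u * Im (side_conv (int n) u))"
    proof (rule integrable_circ)
      show "norm (sin u * Im (side_conv (int n) u)) \<le> 1 * (2 * pi) ^ 3" for u
        unfolding real_norm_def abs_mult
        by (intro mult_mono abs_sin_le_one order_trans[OF abs_Im_le_cmod norm_side_conv]) auto
    qed measurable
  qed
  also have "\<dots> = (LINT u|circ. sin u * k u)"
    unfolding k_def by (simp add: sum_distrib_left mult_ac)
  finally have eq: "8 * (\<Sum>n=1..N. w n * (real n * ((cmod (coeff (int n)))\<^sup>2 - (cmod (coeff (- int n)))\<^sup>2)))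
    = (LINT u|circ. sin u * k u)" .
  have "\<bar>LINT u|circ. sin u * k u\<bar> \<le> (LINT u|circ. \<bar>sin u * k u\<bar>)"
    by (rule integral_abs_bound)
  also have "\<dots> \<le> (LINT u|circ. 16 * pi * (sin u * P u - sin u * P (u + pi)) + 64 * pi * \<epsilon>)"
  proof (rule integral_mono_AE)
    show "integrable circ (\<lambda>u. 16 * pi * (sin u * P u - sin u * P (u + pi)) + 64 * pi * \<epsilon>)"
      using iP[of 0] iP[of pi] by (intro Bochner_Integration.integrable_add Bochner_Integration.integrable_mult_right
        Bochner_Integration.integrable_diff) simp_all
    have "AE u in lborel. u \<noteq> 0 \<and> u \<noteq> pi \<and> u \<noteq> 2 * pi"
      using AE_lborel_singleton[of 0] AE_lborel_singleton[of pi] AE_lborel_singleton[of "2 * pi"]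
      by eventually_elim simp
    then show "AE u in circ. \<bar>sin u * k u\<bar> \<le> 16 * pi * (sin u * P u - sin u * P (u + pi)) + 64 * pi * \<epsilon>"
      unfolding AE_circ
    proof eventually_elim
      case (elim u)
      show ?case
      proof
        assume "u \<in> {0..2 * pi}"
        then have "0 < u \<and> u < pi \<or> pi < u \<and> u < 2 * pi" using elim by (auto simp: less_le)
        from pt[OF this] PB[of u]
        show "\<bar>sin u * k u\<bar> \<le> 16 * pi * (sin u * P u - sin u * P (u + pi)) + 64 * pi * \<epsilon>" by linarith
      qed
    qed
  qed (intro integrable_abs ik)
  also have "\<dots> = 16 * pi * ((LINT u|circ. sin u * P u) - (LINT u|circ. sin u * P (u + pi))) + 64 * pi * \<epsilon> * (2 * pi)"
    using iP[of 0] iP[of pi] by (simp add: measure_circ Bochner_Integration.integral_diff)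
  also have "\<dots> = 8 * (4 * pi\<^sup>2 * w 1 + 16 * pi\<^sup>2 * \<epsilon>)"
    unfolding P_def integral_sin_kernel_sum[OF N] integral_sin_kernel_sum_shift[OF N]
    by (simp add: power2_eq_square algebra_simps)
  finally show ?thesis unfolding eq[symmetric] by (simp add: abs_mult)
qed

end


section \<open>Harmonic functions on the disc\<close>

text \<open>Two mean value theorems, the first along \<open>e\<close>, the second along
  \<open>e'\<close>. The left-hand side is symmetric in the two directions although the right-hand
  side is not visibly so. The condition on \<open>s\<close> keeps the parallelogram inside the
  ball.\<close>

lemma second_difference:
  fixes u :: "complex \<Rightarrow> real" and Du :: "complex \<Rightarrow> complex \<Rightarrow>\<^sub>L real"
    and D2u :: "complex \<Rightarrow> complex \<Rightarrow>\<^sub>L (complex \<Rightarrow>\<^sub>L real)"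
  assumes u: "\<And>w. w \<in> S \<Longrightarrow> (u has_derivative blinfun_apply (Du w)) (at w)"
    and Du: "\<And>w. w \<in> S \<Longrightarrow> (Du has_derivative blinfun_apply (D2u w)) (at w)"
    and S: "ball z \<delta> \<subseteq> S" and s: "0 < s" "3 * s < \<delta>" and e: "cmod e = 1" "cmod e' = 1"
  shows "\<exists>w\<in>ball z \<delta>. u (z + of_real s * e + of_real s * e') - u (z + of_real s * e) - u (z + of_real s * e') + u z
    = s * s * blinfun_apply (blinfun_apply (D2u w) e') e"
proof -
  have inb: "z + of_real x * e + of_real y * e' \<in> ball z \<delta>" if "0 \<le> x" "x \<le> s" "0 \<le> y" "y \<le> s" for x y
  proof -
    have "cmod (of_real x * e + of_real y * e') \<le> x + y"
      using norm_triangle_ineq[of "of_real x * e" "of_real y * e'"] that e by (simp add: norm_mult)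
    moreover have "dist z (z + of_real x * e + of_real y * e') = cmod (of_real x * e + of_real y * e')"
      by (metis add.assoc add_diff_cancel_left' dist_commute dist_norm)
    ultimately show ?thesis using that s by (simp only: mem_ball)
  qed
  have sc: "blinfun_apply L (of_real h * a) = blinfun_apply L a * h" for L :: "complex \<Rightarrow>\<^sub>L real" and h a
    by (metis blinfun.scaleR_right mult.commute real_scaleR_def scaleR_conv_of_real)
  have sc': "blinfun_apply (blinfun_apply M (of_real h * a)) b = blinfun_apply (blinfun_apply M a) b * h"
    for M :: "complex \<Rightarrow>\<^sub>L (complex \<Rightarrow>\<^sub>L real)" and h a b
    by (metis blinfun.scaleR_right blinfun.scaleR_left mult.commute real_scaleR_def scaleR_conv_of_real)
  have line: "((\<lambda>x. z + of_real x * e + of_real y * e') has_derivative (\<lambda>h. of_real h * e)) (at x)" for x y :: real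
    by (auto intro!: derivative_eq_intros)
  have line': "((\<lambda>y. z + of_real x * e + of_real y * e') has_derivative (\<lambda>h. of_real h * e')) (at y)" for x y :: real
    by (auto intro!: derivative_eq_intros)
  have d: "((\<lambda>x. u (z + of_real x * e + of_real y * e')) has_real_derivative
      blinfun_apply (Du (z + of_real x * e + of_real y * e')) e) (at x)" if "0 \<le> x" "x \<le> s" "0 \<le> y" "y \<le> s" for x y
  proof -
    have "((\<lambda>x. u (z + of_real x * e + of_real y * e')) has_derivative
      (\<lambda>h. blinfun_apply (Du (z + of_real x * e + of_real y * e')) (of_real h * e))) (at x)"
      using has_derivative_compose[OF line u] inb[OF that] S by blast
    then show ?thesis unfolding has_field_derivative_def by (simp only: sc)
  qed
  have d': "((\<lambda>y. blinfun_apply (Du (z + of_real x * e + of_real y * e')) e) has_real_derivative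
      blinfun_apply (blinfun_apply (D2u (z + of_real x * e + of_real y * e')) e') e) (at y)"
    if "0 \<le> x" "x \<le> s" "0 \<le> y" "y \<le> s" for x y
  proof -
    have "((\<lambda>y. Du (z + of_real x * e + of_real y * e')) has_derivative
      (\<lambda>h. blinfun_apply (D2u (z + of_real x * e + of_real y * e')) (of_real h * e'))) (at y)"
      using has_derivative_compose[OF line' Du] inb[OF that] S by blast
    then have "((\<lambda>y. blinfun_apply (Du (z + of_real x * e + of_real y * e')) e) has_derivative
      (\<lambda>h. blinfun_apply (blinfun_apply (D2u (z + of_real x * e + of_real y * e')) (of_real h * e')) e)) (at y)"
      by (rule bounded_linear.has_derivative[OF blinfun.bounded_linear_left])
    then show ?thesis unfolding has_field_derivative_def by (simp only: sc')
  qed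
  let ?\<phi> = "\<lambda>x. u (z + of_real x * e + of_real s * e') - u (z + of_real x * e + of_real 0 * e')"
  have "\<exists>x>0. x < s \<and> ?\<phi> s - ?\<phi> 0 = (s - 0) *
      (blinfun_apply (Du (z + of_real x * e + of_real s * e')) e - blinfun_apply (Du (z + of_real x * e + of_real 0 * e')) e)"
  proof (rule MVT2[OF s(1)])
    fix x assume "0 \<le> x" "x \<le> s"
    then show "(?\<phi> has_real_derivative blinfun_apply (Du (z + of_real x * e + of_real s * e')) e
        - blinfun_apply (Du (z + of_real x * e + of_real 0 * e')) e) (at x)"
      using s(1) by (intro DERIV_diff d) auto
  qed
  then obtain x where x: "0 < x" "x < s" "?\<phi> s - ?\<phi> 0 = (s - 0) *
      (blinfun_apply (Du (z + of_real x * e + of_real s * e')) e - blinfun_apply (Du (z + of_real x * e + of_real 0 * e')) e)"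
    by blast
  let ?\<psi> = "\<lambda>y. blinfun_apply (Du (z + of_real x * e + of_real y * e')) e"
  have "\<exists>y>0. y < s \<and> ?\<psi> s - ?\<psi> 0 = (s - 0) * blinfun_apply (blinfun_apply (D2u (z + of_real x * e + of_real y * e')) e') e"
    by (rule MVT2[OF s(1)]) (use d' x in auto)
  then obtain y where y: "0 < y" "y < s" "?\<psi> s - ?\<psi> 0 = (s - 0) * blinfun_apply (blinfun_apply (D2u (z + of_real x * e + of_real y * e')) e') e"
    by blast
  have "u (z + of_real s * e + of_real s * e') - u (z + of_real s * e) - u (z + of_real s * e') + u z
     = s * s * blinfun_apply (blinfun_apply (D2u (z + of_real x * e + of_real y * e')) e') e"
    using x(3) unfolding y(3) by simp
  moreover have "z + of_real x * e + of_real y * e' \<in> ball z \<delta>" using x y by (intro inb) auto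
  ultimately show ?thesis by blast
qed

text \<open>Schwarz's theorem. The second derivative is given as an iterated derivative, so its
  symmetry has to be derived: the symmetric second difference expresses both orders at points near
  \<open>z\<close>, and continuity of \<open>D2u\<close> does the rest.\<close>

lemma mixed_partials_commute:
  fixes u :: "complex \<Rightarrow> real" and Du :: "complex \<Rightarrow> complex \<Rightarrow>\<^sub>L real"
    and D2u :: "complex \<Rightarrow> complex \<Rightarrow>\<^sub>L (complex \<Rightarrow>\<^sub>L real)"
  assumes u: "\<And>w. w \<in> S \<Longrightarrow> (u has_derivative blinfun_apply (Du w)) (at w)"
    and Du: "\<And>w. w \<in> S \<Longrightarrow> (Du has_derivative blinfun_apply (D2u w)) (at w)"
    and cont: "continuous_on S D2u" and S: "open S" "z \<in> S" and e: "cmod e = 1" "cmod e' = 1"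
  shows "blinfun_apply (blinfun_apply (D2u z) e) e' = blinfun_apply (blinfun_apply (D2u z) e') e"
proof -
  have "\<bar>blinfun_apply (blinfun_apply (D2u z) e) e' - blinfun_apply (blinfun_apply (D2u z) e') e\<bar> \<le> \<epsilon>" if "\<epsilon> > 0" for \<epsilon>
  proof -
    have "\<epsilon> / 2 > 0" using that by simp
    then obtain d1 where d1: "d1 > 0" "\<And>w. w \<in> S \<Longrightarrow> dist w z < d1 \<Longrightarrow> dist (D2u w) (D2u z) < \<epsilon> / 2"
      using cont[unfolded continuous_on_iff, rule_format, OF S(2)] by blast
    obtain d2 where d2: "d2 > 0" "ball z d2 \<subseteq> S" using S openE by blast
    define d where "d = min d1 d2"
    define s where "s = d / 4"
    have d: "d > 0" "ball z d \<subseteq> S" using d1 d2 by (auto simp: d_def)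
    have s: "0 < s" "3 * s < d" using d by (auto simp: s_def)
    obtain w where w: "w \<in> ball z d" "u (z + of_real s * e + of_real s * e') - u (z + of_real s * e) - u (z + of_real s * e') + u z
      = s * s * blinfun_apply (blinfun_apply (D2u w) e') e"
      using second_difference[OF u Du d(2) s e] by blast
    obtain w' where w': "w' \<in> ball z d" "u (z + of_real s * e' + of_real s * e) - u (z + of_real s * e') - u (z + of_real s * e) + u z
      = s * s * blinfun_apply (blinfun_apply (D2u w') e) e'"
      using second_difference[OF u Du d(2) s e(2,1)] by blast
    have "s * s * blinfun_apply (blinfun_apply (D2u w') e) e' = s * s * blinfun_apply (blinfun_apply (D2u w) e') e"
    proof -
      have "z + of_real s * e' + of_real s * e = z + of_real s * e + of_real s * e'" by (simp only: add_ac)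
      then show ?thesis using w(2) w'(2) by (simp only:)
    qed
    then have eq: "blinfun_apply (blinfun_apply (D2u w') e) e' = blinfun_apply (blinfun_apply (D2u w) e') e"
      using s by simp
    have close: "\<bar>blinfun_apply (blinfun_apply (D2u v) a) b - blinfun_apply (blinfun_apply (D2u z) a) b\<bar> \<le> \<epsilon> / 2"
      if "v \<in> ball z d" "cmod a = 1" "cmod b = 1" for v a b
    proof -
      have "norm (blinfun_apply (blinfun_apply (D2u v - D2u z) a) b) \<le> norm (D2u v - D2u z) * norm a * norm b"
        by (meson norm_blinfun mult_right_mono norm_ge_zero order_trans)
      also have "\<dots> \<le> \<epsilon> / 2"
      proof -
        have "v \<in> S" using that d by blast
        moreover have "dist v z < d1" using that by (simp add: d_def dist_commute)
        ultimately have "dist (D2u v) (D2u z) < \<epsilon> / 2" by (rule d1(2))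
        then show ?thesis using that by (simp add: dist_norm)
      qed
      finally show ?thesis by (simp add: blinfun.diff_left)
    qed
    show ?thesis using close[OF w(1) e(2,1)] close[OF w'(1) e] eq by linarith
  qed
  then show ?thesis using field_le_epsilon[of "\<bar>blinfun_apply (blinfun_apply (D2u z) e) e' - blinfun_apply (blinfun_apply (D2u z) e') e\<bar>" 0]
    by simp
qed

text \<open>The function \<open>u_x - \<i> * u_y\<close> is holomorphic: one Cauchy-Riemann equation
  is Laplace's equation, the other the symmetry of mixed partials. Its primitive on the disc has
  real part \<open>u\<close> up to a constant.\<close>

lemma harmonic_real_eq_Re_holomorphic:
  assumes "harmonic_real_on u (ball 0 1)"
  obtains k where "k holomorphic_on ball 0 1" "\<And>z. z \<in> ball 0 1 \<Longrightarrow> u z = Re (k z)"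
proof -
  obtain Du D2u where
    u: "\<And>z. z \<in> ball 0 1 \<Longrightarrow> (u has_derivative blinfun_apply (Du z)) (at z)"
    and Du: "\<And>z. z \<in> ball 0 1 \<Longrightarrow> (Du has_derivative blinfun_apply (D2u z)) (at z)"
    and cont: "continuous_on (ball 0 1) D2u"
    and lap: "\<And>z. z \<in> ball 0 1 \<Longrightarrow> blinfun_apply (blinfun_apply (D2u z) 1) 1 + blinfun_apply (blinfun_apply (D2u z) \<i>) \<i> = 0"
    using assms unfolding harmonic_real_on_def by blast
  define G where "G z = of_real (blinfun_apply (Du z) 1) - \<i> * of_real (blinfun_apply (Du z) \<i>)" for z
  have lin: "blinfun_apply (L :: complex \<Rightarrow>\<^sub>L 'b) h = Re h *\<^sub>R blinfun_apply L 1 + Im h *\<^sub>R blinfun_apply L \<i>"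
    for L :: "complex \<Rightarrow>\<^sub>L 'b::real_normed_vector" and h
  proof -
    have "h = Re h *\<^sub>R 1 + Im h *\<^sub>R \<i>" by (simp add: complex_eq_iff)
    then show ?thesis by (metis blinfun.add_right blinfun.scaleR_right)
  qed
  have dG: "(G has_field_derivative of_real (blinfun_apply (blinfun_apply (D2u z) 1) 1)
      - \<i> * of_real (blinfun_apply (blinfun_apply (D2u z) 1) \<i>)) (at z)" if z: "z \<in> ball 0 1" for z
  proof -
    have sym: "blinfun_apply (blinfun_apply (D2u z) \<i>) 1 = blinfun_apply (blinfun_apply (D2u z) 1) \<i>"
      by (rule mixed_partials_commute[OF u Du cont open_ball z]) auto
    have c: "blinfun_apply (blinfun_apply (D2u z) \<i>) \<i> = - blinfun_apply (blinfun_apply (D2u z) 1) 1"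
      using lap[OF z] by simp
    have ap: "((\<lambda>w. blinfun_apply (Du w) e) has_derivative (\<lambda>h. blinfun_apply (blinfun_apply (D2u z) h) e)) (at z)" for e
      by (rule bounded_linear.has_derivative[OF blinfun.bounded_linear_left Du[OF z]])
    have "(G has_derivative (\<lambda>h. of_real (blinfun_apply (blinfun_apply (D2u z) h) 1)
        - \<i> * of_real (blinfun_apply (blinfun_apply (D2u z) h) \<i>))) (at z)"
      unfolding G_def by (intro derivative_intros ap)
    moreover have "(\<lambda>h. of_real (blinfun_apply (blinfun_apply (D2u z) h) 1)
        - \<i> * of_real (blinfun_apply (blinfun_apply (D2u z) h) \<i>))
       = (*) (of_real (blinfun_apply (blinfun_apply (D2u z) 1) 1) - \<i> * of_real (blinfun_apply (blinfun_apply (D2u z) 1) \<i>))"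
    proof
      fix h :: complex
      show "of_real (blinfun_apply (blinfun_apply (D2u z) h) 1) - \<i> * of_real (blinfun_apply (blinfun_apply (D2u z) h) \<i>)
        = (of_real (blinfun_apply (blinfun_apply (D2u z) 1) 1) - \<i> * of_real (blinfun_apply (blinfun_apply (D2u z) 1) \<i>)) * h"
        unfolding lin[of "D2u z" h] blinfun.add_left blinfun.scaleR_left sym c by (simp add: complex_eq_iff algebra_simps)
    qed
    ultimately show ?thesis by (simp add: has_field_derivative_def)
  qed
  then have "G holomorphic_on ball 0 1" by (metis holomorphic_on_open open_ball)
  then obtain g where g: "\<And>z. z \<in> ball 0 1 \<Longrightarrow> (g has_field_derivative G z) (at z)"
    using holomorphic_convex_primitive'[of "ball 0 1" G] by (metis at_within_open convex_ball open_ball)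
  have "((\<lambda>w. Re (g w) - u w) has_derivative (\<lambda>h. 0)) (at z within ball 0 1)" if z: "z \<in> ball 0 1" for z
  proof -
    have "((\<lambda>w. Re (g w)) has_derivative (\<lambda>h. Re (G z * h))) (at z)"
      using g[OF z] unfolding has_field_derivative_def by (rule has_derivative_Re)
    then have "((\<lambda>w. Re (g w) - u w) has_derivative (\<lambda>h. Re (G z * h) - blinfun_apply (Du z) h)) (at z)"
      by (intro has_derivative_diff u[OF z])
    moreover have "Re (G z * h) - blinfun_apply (Du z) h = 0" for h
      unfolding lin[of "Du z" h] by (simp add: G_def)
    ultimately show ?thesis by (simp add: has_derivative_at_withinI)
  qed
  then obtain c where c: "\<And>z. z \<in> ball 0 1 \<Longrightarrow> Re (g z) - u z = c"
    using has_derivative_zero_constant[of "ball 0 1" "\<lambda>w. Re (g w) - u w"] by auto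
  show thesis
  proof (rule that[of "\<lambda>z. g z - of_real c"])
    have "g holomorphic_on ball 0 1" using g by (metis holomorphic_on_open open_ball)
    then show "(\<lambda>z. g z - of_real c) holomorphic_on ball 0 1" by (intro holomorphic_intros)
    show "u z = Re (g z - of_real c)" if "z \<in> ball 0 1" for z using c[OF that] by simp
  qed
qed

lemma harmonic_decomposition:
  assumes "harmonic_on f (ball 0 1)"
  obtains h g where "h holomorphic_on ball 0 1" "g holomorphic_on ball 0 1" "g 0 = 0"
    "\<And>z. z \<in> ball 0 1 \<Longrightarrow> f z = h z + cnj (g z)"
proof -
  obtain k1 where k1: "k1 holomorphic_on ball 0 1" "\<And>z. z \<in> ball 0 1 \<Longrightarrow> Re (f z) = Re (k1 z)"
    using harmonic_real_eq_Re_holomorphic assms unfolding harmonic_on_def by metis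
  obtain k2 where k2: "k2 holomorphic_on ball 0 1" "\<And>z. z \<in> ball 0 1 \<Longrightarrow> Im (f z) = Re (k2 z)"
    using harmonic_real_eq_Re_holomorphic assms unfolding harmonic_on_def by metis
  \<comment> \<open>This constant is moved from \<open>g\<close> to \<open>h\<close>, so that the
    zeroth Fourier coefficient is counted only once.\<close>
  define c where "c = (k1 0 - \<i> * k2 0) / 2"
  show thesis
  proof (rule that[of "\<lambda>z. (k1 z + \<i> * k2 z) / 2 + cnj c" "\<lambda>z. (k1 z - \<i> * k2 z) / 2 - c"])
    show "(\<lambda>z. (k1 z + \<i> * k2 z) / 2 + cnj c) holomorphic_on ball 0 1"
      by (intro holomorphic_intros k1 k2) auto
    show "(\<lambda>z. (k1 z - \<i> * k2 z) / 2 - c) holomorphic_on ball 0 1"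
      by (intro holomorphic_intros k1 k2) auto
    show "f z = (k1 z + \<i> * k2 z) / 2 + cnj c + cnj ((k1 z - \<i> * k2 z) / 2 - c)" if "z \<in> ball 0 1" for z
      using k1(2)[OF that] k2(2)[OF that] by (simp add: complex_eq_iff add_divide_distrib diff_divide_distrib)
  qed (simp add: c_def)
qed


section \<open>Taylor coefficients and Parseval\<close>

lemma integral_circ_series:
  fixes \<phi> :: "real \<Rightarrow> complex" and k :: "nat \<Rightarrow> int"
  assumes [measurable]: "\<phi> \<in> borel_measurable borel" and B: "\<And>\<theta>. cmod (\<phi> \<theta>) \<le> B"
    and sum: "summable (\<lambda>n. cmod (\<beta> n))"
  shows "(\<lambda>n. \<beta> n * (LINT \<theta>|circ. \<phi> \<theta> * cis (real_of_int (k n) * \<theta>))) sums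
    (LINT \<theta>|circ. \<phi> \<theta> * (\<Sum>n. \<beta> n * cis (real_of_int (k n) * \<theta>)))"
proof -
  let ?f = "\<lambda>n \<theta>. \<phi> \<theta> * (\<beta> n * cis (real_of_int (k n) * \<theta>))"
  have B0: "0 \<le> B" using B[of 0] norm_ge_zero order_trans by blast
  have bd: "cmod (?f n \<theta>) \<le> B * cmod (\<beta> n)" for n \<theta>
    using B by (simp add: norm_mult mult_right_mono)
  have sB: "summable (\<lambda>n. B * cmod (\<beta> n))" using sum by (rule summable_mult)
  have "(\<lambda>n. LINT \<theta>|circ. ?f n \<theta>) sums (LINT \<theta>|circ. (\<Sum>n. ?f n \<theta>))"
  proof (rule sums_integral)
    show "integrable circ (?f n)" for n by (rule integrable_circ[OF _ bd]) measurable
    have "summable (\<lambda>n. norm (?f n \<theta>))" for \<theta>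
      by (rule summable_comparison_test'[OF sB]) (use bd in simp)
    then show "AE \<theta> in circ. summable (\<lambda>n. norm (?f n \<theta>))" by simp
    show "summable (\<lambda>n. LINT \<theta>|circ. norm (?f n \<theta>))"
    proof (rule summable_comparison_test'[OF summable_mult2[OF sB, of "2 * pi"]])
      fix n
      have "norm (LINT \<theta>|circ. norm (?f n \<theta>)) \<le> (B * cmod (\<beta> n)) * (2 * pi)"
        by (rule norm_integral_circ_le) (use bd B0 in auto)
      then show "norm (LINT \<theta>|circ. norm (?f n \<theta>)) \<le> B * cmod (\<beta> n) * (2 * pi)" .
    qed
  qed
  moreover have "(\<Sum>n. ?f n \<theta>) = \<phi> \<theta> * (\<Sum>n. \<beta> n * cis (real_of_int (k n) * \<theta>))" for \<theta>
    by (rule suminf_mult, rule summable_norm_cancel) (use sum in \<open>simp add: norm_mult\<close>)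
  ultimately show ?thesis by (simp add: mult.left_commute)
qed

definition taylor :: "(complex \<Rightarrow> complex) \<Rightarrow> nat \<Rightarrow> complex" where
  "taylor h n = (deriv ^^ n) h 0 / fact n"

context
  fixes h :: "complex \<Rightarrow> complex"
  assumes h: "h holomorphic_on ball 0 1"
begin

lemma taylor_sums: "cmod z < 1 \<Longrightarrow> (\<lambda>n. taylor h n * z ^ n) sums h z"
  using holomorphic_power_series[OF h, of z] by (simp add: taylor_def)

lemma taylor_summable:
  assumes "0 \<le> R" "R < 1" shows "summable (\<lambda>n. cmod (taylor h n) * R ^ n)"
proof -
  define S where "S = (1 + R) / 2"
  have S: "0 \<le> R" "R < S" "S < 1" using assms by (auto simp: S_def)
  have "summable (\<lambda>n. norm (taylor h n * (of_real R) ^ n))"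
    by (rule powser_insidea[where x = "of_real S"]) (use S taylor_sums[of "of_real S"] in \<open>auto simp: sums_iff\<close>)
  then show ?thesis using assms by (simp add: norm_mult norm_power)
qed

lemma circle_series:
  assumes "0 \<le> R" "R < 1"
  shows "h (of_real R * cis \<theta>) = (\<Sum>n. taylor h n * of_real (R ^ n) * cis (real_of_int (int n) * \<theta>))"
proof -
  have "cmod (of_real R * cis \<theta>) < 1" using assms by (simp add: norm_mult)
  from taylor_sums[OF this] have "h (of_real R * cis \<theta>) = (\<Sum>n. taylor h n * (of_real R * cis \<theta>) ^ n)"
    by (simp add: sums_iff)
  also have "(\<lambda>n. taylor h n * (of_real R * cis \<theta>) ^ n) = (\<lambda>n. taylor h n * of_real (R ^ n) * cis (real_of_int (int n) * \<theta>))"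
  proof
    fix n
    have "(of_real R * cis \<theta>) ^ n = of_real (R ^ n) * cis (real n * \<theta>)"
      by (simp only: power_mult_distrib Complex.DeMoivre of_real_power)
    then show "taylor h n * (of_real R * cis \<theta>) ^ n = taylor h n * of_real (R ^ n) * cis (real_of_int (int n) * \<theta>)"
      by (simp only: of_int_of_nat_eq mult.assoc)
  qed
  finally show ?thesis .
qed

lemma circle_summable:
  assumes "0 \<le> R" "R < 1"
  shows "summable (\<lambda>n. cmod (taylor h n * of_real (R ^ n)))"
  using taylor_summable[OF assms] assms by (simp add: norm_mult norm_power)

lemma circle_continuous:
  assumes "0 \<le> R" "R < 1" shows "continuous_on UNIV (\<lambda>\<theta>. h (of_real R * cis \<theta>))"
proof (rule continuous_on_compose2[OF holomorphic_on_imp_continuous_on[OF h]])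
  show "continuous_on UNIV (\<lambda>\<theta>. of_real R * cis \<theta>)" by (intro continuous_intros)
qed (use assms in \<open>auto simp: norm_mult\<close>)

lemma circle_measurable:
  assumes "0 \<le> R" "R < 1" shows "(\<lambda>\<theta>. h (of_real R * cis \<theta>)) \<in> borel_measurable borel"
  by (rule borel_measurable_continuous_onI[OF circle_continuous[OF assms]])

lemma circle_bounded:
  assumes "0 \<le> R" "R < 1" shows "\<exists>B. \<forall>\<theta>. cmod (h (of_real R * cis \<theta>)) \<le> B"
proof -
  have "compact (h ` cball 0 R)"
    by (intro compact_continuous_image continuous_on_subset[OF holomorphic_on_imp_continuous_on[OF h]])
      (use assms in auto)
  then have "bounded (h ` cball 0 R)" by (rule compact_imp_bounded)
  then obtain B where B: "\<forall>w\<in>h ` cball 0 R. cmod w \<le> B" unfolding bounded_iff ..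
  have "of_real R * cis \<theta> \<in> cball 0 R" for \<theta> using assms by (simp add: norm_mult)
  then have "cmod (h (of_real R * cis \<theta>)) \<le> B" for \<theta> using B by blast
  then show ?thesis by blast
qed

text \<open>The test function is \<open>cis (m * \<theta>)\<close> without the usual minus sign, so
  the Taylor index \<open>n\<close> is met at \<open>m = - n\<close>.\<close>

lemma circle_coeff:
  assumes R: "0 \<le> R" "R < 1"
  shows "(LINT \<theta>|circ. h (of_real R * cis \<theta>) * cis (real_of_int m * \<theta>))
    = (if m \<le> 0 then 2 * pi * of_real (R ^ nat (- m)) * taylor h (nat (- m)) else 0)"
proof -
  have "(\<lambda>n. taylor h n * of_real (R ^ n) * (LINT \<theta>|circ. cis (real_of_int m * \<theta>) * cis (real_of_int (int n) * \<theta>))) sums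
    (LINT \<theta>|circ. cis (real_of_int m * \<theta>) * (\<Sum>n. taylor h n * of_real (R ^ n) * cis (real_of_int (int n) * \<theta>)))"
    by (rule integral_circ_series[where B = 1, OF _ _ circle_summable[OF R]]) auto
  also have "(\<lambda>n. taylor h n * of_real (R ^ n) * (LINT \<theta>|circ. cis (real_of_int m * \<theta>) * cis (real_of_int (int n) * \<theta>)))
    = (\<lambda>n. if n = nat (- m) \<and> m \<le> 0 then 2 * pi * of_real (R ^ nat (- m)) * taylor h (nat (- m)) else 0)"
  proof
    fix n
    have "cis (real_of_int m * \<theta>) * cis (real_of_int (int n) * \<theta>) = cis (real_of_int (m + int n) * \<theta>)" for \<theta>
      by (simp add: cis_mult distrib_right)
    moreover have "m + int n = 0 \<longleftrightarrow> n = nat (- m) \<and> m \<le> 0" by auto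
    ultimately show "taylor h n * of_real (R ^ n) * (LINT \<theta>|circ. cis (real_of_int m * \<theta>) * cis (real_of_int (int n) * \<theta>))
      = (if n = nat (- m) \<and> m \<le> 0 then 2 * pi * of_real (R ^ nat (- m)) * taylor h (nat (- m)) else 0)"
      by (simp only: integral_circ_cis) auto
  qed
  also have "(\<lambda>\<theta>. cis (real_of_int m * \<theta>) * (\<Sum>n. taylor h n * of_real (R ^ n) * cis (real_of_int (int n) * \<theta>)))
    = (\<lambda>\<theta>. h (of_real R * cis \<theta>) * cis (real_of_int m * \<theta>))"
    unfolding circle_series[OF R] by (simp only: mult.commute)
  finally have s: "(\<lambda>n. if n = nat (- m) \<and> m \<le> 0 then 2 * pi * of_real (R ^ nat (- m)) * taylor h (nat (- m)) else 0) sums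
      (LINT \<theta>|circ. h (of_real R * cis \<theta>) * cis (real_of_int m * \<theta>))" .
  show ?thesis
  proof (cases "m \<le> 0")
    case True
    have "(\<lambda>n. if n = nat (- m) then 2 * pi * of_real (R ^ nat (- m)) * taylor h (nat (- m)) else 0) sums
       (2 * pi * of_real (R ^ nat (- m)) * taylor h (nat (- m)))"
      by (rule sums_single)
    then show ?thesis using sums_unique2[OF s] True by simp
  next
    case False
    then show ?thesis using sums_unique2[OF s] sums_zero by simp
  qed
qed

end

locale harmonic_pair =
  fixes h g :: "complex \<Rightarrow> complex"
  assumes h: "h holomorphic_on ball 0 1" and g: "g holomorphic_on ball 0 1" and g0: "g 0 = 0"
begin

definition hp :: "complex \<Rightarrow> complex" where "hp z = h z + cnj (g z)"

abbreviation (input) "a \<equiv> taylor h"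
abbreviation (input) "b \<equiv> taylor g"

lemma b0: "b 0 = 0" by (simp add: taylor_def g0)

lemma hp_continuous: "continuous_on (ball 0 1) hp"
  unfolding hp_def[abs_def] by (intro continuous_intros holomorphic_on_imp_continuous_on h g)

lemma hp_circle_continuous:
  assumes "0 \<le> R" "R < 1" shows "continuous_on UNIV (\<lambda>\<theta>. hp (of_real R * cis \<theta>))"
  unfolding hp_def by (intro continuous_intros circle_continuous[OF h assms] circle_continuous[OF g assms])

lemma hp_circle_measurable:
  assumes "0 \<le> R" "R < 1" shows "(\<lambda>\<theta>. hp (of_real R * cis \<theta>)) \<in> borel_measurable borel"
  by (rule borel_measurable_continuous_onI[OF hp_circle_continuous[OF assms]])

lemma hp_circle_bounded:
  assumes "0 \<le> R" "R < 1" shows "\<exists>B. \<forall>\<theta>. cmod (hp (of_real R * cis \<theta>)) \<le> B"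
proof -
  obtain B1 where "\<And>\<theta>. cmod (h (of_real R * cis \<theta>)) \<le> B1" using circle_bounded[OF h assms] by blast
  moreover obtain B2 where "\<And>\<theta>. cmod (g (of_real R * cis \<theta>)) \<le> B2" using circle_bounded[OF g assms] by blast
  ultimately have "cmod (hp (of_real R * cis \<theta>)) \<le> B1 + B2" for \<theta>
    unfolding hp_def by (intro order_trans[OF norm_triangle_ineq] add_mono) auto
  then show ?thesis by blast
qed

lemma hp_coeff:
  assumes R: "0 \<le> R" "R < 1"
  shows "(LINT \<theta>|circ. hp (of_real R * cis \<theta>) * cis (- (real_of_int (int n) * \<theta>))) = 2 * pi * of_real (R ^ n) * a n"
    and "(LINT \<theta>|circ. hp (of_real R * cis \<theta>) * cis (real_of_int (int n) * \<theta>))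
      = (if n = 0 then 2 * pi * a 0 else 2 * pi * of_real (R ^ n) * cnj (b n))"
proof -
  obtain B1 where B1: "\<And>\<theta>. cmod (h (of_real R * cis \<theta>)) \<le> B1" using circle_bounded[OF h assms] by blast
  obtain B2 where B2: "\<And>\<theta>. cmod (g (of_real R * cis \<theta>)) \<le> B2" using circle_bounded[OF g assms] by blast
  note [measurable] = circle_measurable[OF h R] circle_measurable[OF g R]
  have ih: "integrable circ (\<lambda>\<theta>. h (of_real R * cis \<theta>) * cis (real_of_int m * \<theta>))" for m
    by (rule integrable_circ[where B = B1]) (measurable, simp add: norm_mult B1)
  have ig: "integrable circ (\<lambda>\<theta>. cnj (g (of_real R * cis \<theta>) * cis (real_of_int (- m) * \<theta>)))" for m
    by (rule integrable_circ[where B = B2]) (measurable, simp add: norm_mult B2)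
  have *: "(LINT \<theta>|circ. hp (of_real R * cis \<theta>) * cis (real_of_int m * \<theta>))
    = (if m \<le> 0 then 2 * pi * of_real (R ^ nat (- m)) * a (nat (- m)) else 0)
     + cnj (if - m \<le> 0 then 2 * pi * of_real (R ^ nat m) * b (nat m) else 0)" for m
  proof -
    have "hp (of_real R * cis \<theta>) * cis (real_of_int m * \<theta>) = h (of_real R * cis \<theta>) * cis (real_of_int m * \<theta>)
       + cnj (g (of_real R * cis \<theta>) * cis (real_of_int (- m) * \<theta>))" for \<theta>
      by (simp add: hp_def cis_cnj distrib_right)
    then have "(LINT \<theta>|circ. hp (of_real R * cis \<theta>) * cis (real_of_int m * \<theta>))
      = (LINT \<theta>|circ. h (of_real R * cis \<theta>) * cis (real_of_int m * \<theta>))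
       + (LINT \<theta>|circ. cnj (g (of_real R * cis \<theta>) * cis (real_of_int (- m) * \<theta>)))"
      by (simp only: Bochner_Integration.integral_add[OF ih ig])
    then show ?thesis
      by (simp only: Bochner_Integration.integral_cnj circle_coeff[OF h R] circle_coeff[OF g R] minus_minus)
  qed
  show "(LINT \<theta>|circ. hp (of_real R * cis \<theta>) * cis (- (real_of_int (int n) * \<theta>))) = 2 * pi * of_real (R ^ n) * a n"
    using *[of "- int n"] b0 by (cases "n = 0") auto
  show "(LINT \<theta>|circ. hp (of_real R * cis \<theta>) * cis (real_of_int (int n) * \<theta>))
      = (if n = 0 then 2 * pi * a 0 else 2 * pi * of_real (R ^ n) * cnj (b n))"
    using *[of "int n"] b0 by (cases "n = 0") auto
qed

text \<open>Polarised to two radii, because L2 distances between restrictions to different circles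
  are needed. Only the second factor is expanded; the Fourier coefficients of the first are already
  known.\<close>

lemma hp_Parseval:
  assumes R: "0 \<le> R" "R < 1" and S: "0 \<le> S" "S < 1"
  shows "(\<lambda>n. 2 * pi * of_real (((cmod (a n))\<^sup>2 + (cmod (b n))\<^sup>2) * (R * S) ^ n)) sums
    (LINT \<theta>|circ. hp (of_real R * cis \<theta>) * cnj (hp (of_real S * cis \<theta>)))"
proof -
  obtain B where B: "\<And>\<theta>. cmod (hp (of_real R * cis \<theta>)) \<le> B" using hp_circle_bounded[OF R] by blast
  obtain B1 where B1: "\<And>\<theta>. cmod (h (of_real S * cis \<theta>)) \<le> B1" using circle_bounded[OF h S] by blast
  obtain B2 where B2: "\<And>\<theta>. cmod (g (of_real S * cis \<theta>)) \<le> B2" using circle_bounded[OF g S] by blast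
  note [measurable] = circle_measurable[OF h S] circle_measurable[OF g S] hp_circle_measurable[OF R]
  have B0: "0 \<le> B" using B[of 0] norm_ge_zero order_trans by blast
  have "(\<lambda>n. cnj (a n) * of_real (S ^ n) * (LINT \<theta>|circ. hp (of_real R * cis \<theta>) * cis (real_of_int (- int n) * \<theta>))) sums
     (LINT \<theta>|circ. hp (of_real R * cis \<theta>) * (\<Sum>n. cnj (a n) * of_real (S ^ n) * cis (real_of_int (- int n) * \<theta>)))"
    by (rule integral_circ_series[where B = B]) (use B circle_summable[OF h S] in \<open>simp_all add: norm_mult\<close>)
  moreover have "(\<Sum>n. cnj (a n) * of_real (S ^ n) * cis (real_of_int (- int n) * \<theta>)) = cnj (h (of_real S * cis \<theta>))" for \<theta>
  proof -
    have "summable (\<lambda>n. a n * of_real (S ^ n) * cis (real_of_int (int n) * \<theta>))"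
      by (rule summable_norm_cancel) (use circle_summable[OF h S] in \<open>simp add: norm_mult\<close>)
    from sums_cnj[THEN iffD2, OF summable_sums[OF this]] show ?thesis
      unfolding circle_series[OF h S] by (simp add: sums_iff cis_cnj)
  qed
  moreover have "cnj (a n) * of_real (S ^ n) * (LINT \<theta>|circ. hp (of_real R * cis \<theta>) * cis (real_of_int (- int n) * \<theta>))
     = 2 * pi * of_real ((cmod (a n))\<^sup>2 * (R * S) ^ n)" for n
  proof -
    have "(LINT \<theta>|circ. hp (of_real R * cis \<theta>) * cis (real_of_int (- int n) * \<theta>)) = 2 * pi * of_real (R ^ n) * a n"
      using hp_coeff(1)[OF R, of n] by simp
    then show ?thesis by (simp only: of_real_mult complex_norm_square power_mult_distrib mult_ac of_real_eq_id id_apply)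
  qed
  ultimately have 1: "(\<lambda>n. 2 * pi * of_real ((cmod (a n))\<^sup>2 * (R * S) ^ n)) sums
     (LINT \<theta>|circ. hp (of_real R * cis \<theta>) * cnj (h (of_real S * cis \<theta>)))"
    by (simp only:)
  have "(\<lambda>n. b n * of_real (S ^ n) * (LINT \<theta>|circ. hp (of_real R * cis \<theta>) * cis (real_of_int (int n) * \<theta>))) sums
     (LINT \<theta>|circ. hp (of_real R * cis \<theta>) * (\<Sum>n. b n * of_real (S ^ n) * cis (real_of_int (int n) * \<theta>)))"
    by (rule integral_circ_series[where B = B]) (use B circle_summable[OF g S] in \<open>simp_all add: norm_mult\<close>)
  moreover have "b n * of_real (S ^ n) * (LINT \<theta>|circ. hp (of_real R * cis \<theta>) * cis (real_of_int (int n) * \<theta>))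
     = 2 * pi * of_real ((cmod (b n))\<^sup>2 * (R * S) ^ n)" for n
  proof (cases "n = 0")
    case True
    then show ?thesis using b0 by simp
  next
    case False
    have "(LINT \<theta>|circ. hp (of_real R * cis \<theta>) * cis (real_of_int (int n) * \<theta>)) = 2 * pi * of_real (R ^ n) * cnj (b n)"
      unfolding hp_coeff(2)[OF R] using False by simp
    then show ?thesis by (simp only: of_real_mult complex_norm_square power_mult_distrib mult_ac of_real_eq_id id_apply)
  qed
  ultimately have 2: "(\<lambda>n. 2 * pi * of_real ((cmod (b n))\<^sup>2 * (R * S) ^ n)) sums
     (LINT \<theta>|circ. hp (of_real R * cis \<theta>) * g (of_real S * cis \<theta>))"
    unfolding circle_series[OF g S, symmetric] by (simp only:)
  have "(LINT \<theta>|circ. hp (of_real R * cis \<theta>) * cnj (h (of_real S * cis \<theta>)))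
      + (LINT \<theta>|circ. hp (of_real R * cis \<theta>) * g (of_real S * cis \<theta>))
    = (LINT \<theta>|circ. hp (of_real R * cis \<theta>) * cnj (h (of_real S * cis \<theta>)) + hp (of_real R * cis \<theta>) * g (of_real S * cis \<theta>))"
  proof (rule Bochner_Integration.integral_add[symmetric])
    show "integrable circ (\<lambda>\<theta>. hp (of_real R * cis \<theta>) * cnj (h (of_real S * cis \<theta>)))"
      by (rule integrable_circ[where B = "B * B1"]) (measurable, use B B1 B0 in \<open>simp add: norm_mult mult_mono\<close>)
    show "integrable circ (\<lambda>\<theta>. hp (of_real R * cis \<theta>) * g (of_real S * cis \<theta>))"
      by (rule integrable_circ[where B = "B * B2"]) (measurable, use B B2 B0 in \<open>simp add: norm_mult mult_mono\<close>)
  qed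
  also have "\<dots> = (LINT \<theta>|circ. hp (of_real R * cis \<theta>) * cnj (hp (of_real S * cis \<theta>)))"
    by (simp add: hp_def[of "of_real S * cis _"] distrib_left)
  finally show ?thesis using sums_add[OF 1 2] by (simp add: distrib_left distrib_right)
qed

end


section \<open>Poisson integrals and boundary values\<close>

text \<open>The Riesz-Fischer argument: along a fast subsequence the L1 norms of consecutive
  differences are summable, so the telescoping series converges absolutely almost
  everywhere.\<close>

lemma circ_L2_Cauchy_subseq:
  fixes u :: "nat \<Rightarrow> real \<Rightarrow> complex"
  assumes [measurable]: "\<And>k. u k \<in> borel_measurable borel" and bd: "\<And>k \<theta>. cmod (u k \<theta>) \<le> 1"
    and Cauchy: "\<And>\<epsilon>. 0 < \<epsilon> \<Longrightarrow> \<exists>K. \<forall>k\<ge>K. \<forall>j\<ge>K. (LINT \<theta>|circ. (cmod (u k \<theta> - u j \<theta>))\<^sup>2) \<le> \<epsilon>"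
  obtains r :: "nat \<Rightarrow> nat" where "strict_mono r" "AE \<theta> in circ. convergent (\<lambda>i. u (r i) \<theta>)"
proof -
  have "\<forall>i. \<exists>K. \<forall>k\<ge>K. \<forall>j\<ge>K. (LINT \<theta>|circ. (cmod (u k \<theta> - u j \<theta>))\<^sup>2) \<le> (1 / 8) ^ i" using Cauchy by simp
  then obtain K where K: "\<And>i k j. k \<ge> K i \<Longrightarrow> j \<ge> K i \<Longrightarrow> (LINT \<theta>|circ. (cmod (u k \<theta> - u j \<theta>))\<^sup>2) \<le> (1 / 8) ^ i"
    by metis
  \<comment> \<open>Each \<open>r i\<close> dominates \<open>K i\<close>, and the added ones make
    the sequence strictly increasing.\<close>
  define r where "r i = (\<Sum>j\<le>i. K j + 1)" for i
  have sm: "strict_mono r" unfolding strict_mono_Suc_iff by (simp add: r_def)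
  have rK: "r i \<ge> K i" for i unfolding r_def using member_le_sum[of i "{..i}" "\<lambda>j. K j + 1"] by simp
  define d where "d i \<theta> = u (r (Suc i)) \<theta> - u (r i) \<theta>" for i \<theta>
  have [measurable]: "d i \<in> borel_measurable borel" for i unfolding d_def[abs_def] by measurable
  have dbd: "cmod (d i \<theta>) \<le> 2" for i \<theta>
    unfolding d_def using norm_triangle_ineq4[of "u (r (Suc i)) \<theta>" "u (r i) \<theta>"] bd[of "r (Suc i)" \<theta>] bd[of "r i" \<theta>] by linarith
  have dint: "integrable circ (\<lambda>\<theta>. cmod (d i \<theta>))" for i
    by (rule integrable_circ[where B = 2]) (use dbd in auto)
  have dint2: "integrable circ (\<lambda>\<theta>. (cmod (d i \<theta>))\<^sup>2)" for i
  proof (rule integrable_circ)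
    show "norm ((cmod (d i \<theta>))\<^sup>2) \<le> 2\<^sup>2" for \<theta>
      using power_mono[OF dbd[of i \<theta>] norm_ge_zero, where n = 2] by simp
  qed measurable
  have d1: "(LINT \<theta>|circ. cmod (d i \<theta>)) \<le> (1 / 4) ^ i / 2 + pi * (1 / 2) ^ i" for i
  proof -
    \<comment> \<open>The weight \<open>2 ^ i\<close> passes from the squared norm to the norm:
      against the rate \<open>(1 / 8) ^ i\<close> both resulting terms,
      \<open>(1 / 4) ^ i / 2\<close> and a multiple of \<open>(1 / 2) ^ i\<close>, are
      summable.\<close>
    have amgm: "x \<le> 2 ^ i / 2 * x\<^sup>2 + (1 / 2) ^ i / 2" for x :: real
    proof -
      have "0 \<le> (2 ^ i * x - 1)\<^sup>2 / (2 * 2 ^ i)" by simp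
      also have "\<dots> = 2 ^ i / 2 * x\<^sup>2 + (1 / 2) ^ i / 2 - x"
        by (simp add: power2_diff field_simps power_divide power_mult_distrib) (simp add: power2_eq_square)
      finally show ?thesis by simp
    qed
    have "(LINT \<theta>|circ. cmod (d i \<theta>)) \<le> (LINT \<theta>|circ. 2 ^ i / 2 * (cmod (d i \<theta>))\<^sup>2 + (1 / 2) ^ i / 2)"
    proof (rule integral_mono[OF dint])
      show "integrable circ (\<lambda>\<theta>. 2 ^ i / 2 * (cmod (d i \<theta>))\<^sup>2 + (1 / 2) ^ i / 2)"
        by (intro Bochner_Integration.integrable_add Bochner_Integration.integrable_mult_right dint2) simp
    qed (rule amgm)
    also have "\<dots> = 2 ^ i / 2 * (LINT \<theta>|circ. (cmod (d i \<theta>))\<^sup>2) + pi * (1 / 2) ^ i"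
      using dint2[of i] by (simp add: measure_circ)
    also have "\<dots> \<le> 2 ^ i / 2 * (1 / 8) ^ i + pi * (1 / 2) ^ i"
      unfolding d_def
      by (intro add_mono mult_left_mono K) (use rK[of i] rK[of "Suc i"] strict_monoD[OF sm, of i "Suc i"] in auto)
    also have "2 ^ i / 2 * (1 / 8) ^ i = (1 / 4 :: real) ^ i / 2"
      by (simp flip: power_mult_distrib)
    finally show ?thesis .
  qed
  have "summable (\<lambda>i. (1 / 4) ^ i / 2 + pi * (1 / 2 :: real) ^ i)"
    by (intro summable_add summable_divide summable_mult summable_geometric) auto
  then have sumd: "summable (\<lambda>i. LINT \<theta>|circ. cmod (d i \<theta>))"
    by (rule summable_comparison_test') (use d1 in auto)
  have "(\<integral>\<^sup>+\<theta>. (\<Sum>i. ennreal (cmod (d i \<theta>))) \<partial>circ) = (\<Sum>i. \<integral>\<^sup>+\<theta>. ennreal (cmod (d i \<theta>)) \<partial>circ)"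
    by (rule nn_integral_suminf) measurable
  also have "\<dots> = (\<Sum>i. ennreal (LINT \<theta>|circ. cmod (d i \<theta>)))"
    by (intro arg_cong[where f = suminf] ext nn_integral_eq_integral dint) auto
  also have "\<dots> \<noteq> \<infinity>" using sumd by (simp add: ennreal_suminf_neq_top)
  finally have "AE \<theta> in circ. (\<Sum>i. ennreal (cmod (d i \<theta>))) \<noteq> \<infinity>"
    by (intro nn_integral_PInf_AE) measurable
  then have "AE \<theta> in circ. convergent (\<lambda>i. u (r i) \<theta>)"
  proof eventually_elim
    case (elim \<theta>)
    have "summable (\<lambda>i. cmod (d i \<theta>))"
      using elim by (intro summable_suminf_not_top) (auto simp: top_unique)
    then have "summable (\<lambda>i. d i \<theta>)" by (rule summable_norm_cancel)
    then have "convergent (\<lambda>n. \<Sum>i<n. d i \<theta>)" by (simp add: summable_iff_convergent)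
    moreover have "(\<Sum>i<n. d i \<theta>) = u (r n) \<theta> - u (r 0) \<theta>" for n
      unfolding d_def by (rule sum_lessThan_telescope)
    ultimately have "convergent (\<lambda>n. (u (r n) \<theta> - u (r 0) \<theta>) + u (r 0) \<theta>)"
      by (intro convergent_add convergent_const) simp
    then show ?case by simp
  qed
  with sm show thesis by (rule that)
qed

text \<open>Without the factor \<open>1 / (2 * pi)\<close>: its total mass over the circle is
  \<open>2 * pi\<close>.\<close>

definition poisson :: "complex \<Rightarrow> real \<Rightarrow> real" where
  "poisson z \<theta> = (1 - (cmod z)\<^sup>2) / (cmod (1 - z * cis (- \<theta>)))\<^sup>2"

lemma poisson_series:
  assumes z: "cmod z < 1"
  shows "(\<Sum>n. z ^ n * cis (real_of_int (- int n) * \<theta>))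
      + (\<Sum>n. (if n = 0 then 0 else cnj z ^ n) * cis (real_of_int (int n) * \<theta>)) = of_real (poisson z \<theta>)"
proof -
  define w where "w = z * cis (- \<theta>)"
  have w: "cmod w < 1" "cmod (cnj w) < 1" using z by (auto simp: w_def norm_mult)
  then have nz: "1 - w \<noteq> 0" "1 - cnj w \<noteq> 0" by auto
  have p: "z ^ n * cis (real_of_int (- int n) * \<theta>) = w ^ n" for n
  proof -
    have "w ^ n = z ^ n * cis (real n * (- \<theta>))" unfolding w_def by (simp only: power_mult_distrib Complex.DeMoivre)
    then show ?thesis by simp
  qed
  have q: "(if n = 0 then 0 else cnj z ^ n) * cis (real_of_int (int n) * \<theta>) = cnj w ^ n - (if n = 0 then 1 else 0)" for n
  proof -
    have "cnj w ^ n = cnj z ^ n * cis (real n * \<theta>)"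
      unfolding w_def by (simp only: complex_cnj_mult cis_cnj minus_minus power_mult_distrib Complex.DeMoivre)
    then show ?thesis by simp
  qed
  have "(\<lambda>n. cnj w ^ n - (if n = 0 then 1 else 0)) sums (1 / (1 - cnj w) - 1)"
    by (intro sums_diff geometric_sums w sums_single)
  moreover have "(\<lambda>n. w ^ n) sums (1 / (1 - w))" by (intro geometric_sums w)
  ultimately have "(\<Sum>n. z ^ n * cis (real_of_int (- int n) * \<theta>))
      + (\<Sum>n. (if n = 0 then 0 else cnj z ^ n) * cis (real_of_int (int n) * \<theta>)) = 1 / (1 - w) + (1 / (1 - cnj w) - 1)"
    unfolding p q by (simp add: sums_iff)
  also have "\<dots> = (1 - w * cnj w) / ((1 - w) * cnj (1 - w))" using nz by (simp add: field_simps)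
  also have "\<dots> = of_real (poisson z \<theta>)"
  proof -
    have "w * cnj w = of_real ((cmod z)\<^sup>2)" unfolding complex_norm_square[symmetric] by (simp add: w_def norm_mult)
    moreover have "(1 - w) * cnj (1 - w) = of_real ((cmod (1 - w))\<^sup>2)" unfolding complex_norm_square ..
    ultimately show ?thesis by (simp add: poisson_def w_def)
  qed
  finally show ?thesis .
qed

lemma poisson_nonneg: "cmod z < 1 \<Longrightarrow> 0 \<le> poisson z \<theta>"
  by (simp add: poisson_def power_le_one)

lemma poisson_measurable [measurable]: "poisson z \<in> borel_measurable borel"
  unfolding poisson_def[abs_def] by measurable

lemma poisson_bounded:
  assumes "cmod z < 1" shows "\<bar>poisson z \<theta>\<bar> \<le> 1 / (1 - cmod z)\<^sup>2"
proof -
  have "1 - cmod z \<le> cmod (1 - z * cis (- \<theta>))"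
    using norm_triangle_ineq2[of 1 "z * cis (- \<theta>)"] by (simp add: norm_mult)
  then have "(1 - cmod z)\<^sup>2 \<le> (cmod (1 - z * cis (- \<theta>)))\<^sup>2" using assms by (intro power_mono) auto
  then have "poisson z \<theta> \<le> 1 / (1 - cmod z)\<^sup>2"
    unfolding poisson_def using assms by (intro frac_le) auto
  then show ?thesis using poisson_nonneg[OF assms] by simp
qed

lemma integral_poisson:
  assumes z: "cmod z < 1" and [measurable]: "\<phi> \<in> borel_measurable borel" and B: "\<And>\<theta>. cmod (\<phi> \<theta>) \<le> B"
  shows "(\<lambda>n. z ^ n * (LINT \<theta>|circ. \<phi> \<theta> * cis (real_of_int (- int n) * \<theta>))
      + (if n = 0 then 0 else cnj z ^ n) * (LINT \<theta>|circ. \<phi> \<theta> * cis (real_of_int (int n) * \<theta>)))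
    sums (LINT \<theta>|circ. \<phi> \<theta> * of_real (poisson z \<theta>))"
proof -
  have s1: "summable (\<lambda>n. cmod (z ^ n))" using z by (simp add: norm_power summable_geometric)
  have s2: "summable (\<lambda>n. cmod (if n = 0 then 0 else cnj z ^ n))"
    by (rule summable_comparison_test'[OF s1]) (simp add: norm_power)
  let ?S1 = "\<lambda>\<theta>. (\<Sum>n. z ^ n * cis (real_of_int (- int n) * \<theta>))"
  let ?S2 = "\<lambda>\<theta>. (\<Sum>n. (if n = 0 then 0 else cnj z ^ n) * cis (real_of_int (int n) * \<theta>))"
  have bound: "cmod (\<Sum>n. \<beta> n * cis (real_of_int (k n) * \<theta>)) \<le> (\<Sum>n. cmod (\<beta> n))" if "summable (\<lambda>n. cmod (\<beta> n))"
    for \<beta> :: "nat \<Rightarrow> complex" and k :: "nat \<Rightarrow> int" and \<theta>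
    using summable_norm[of "\<lambda>n. \<beta> n * cis (real_of_int (k n) * \<theta>)"] that by (simp add: norm_mult)
  have i: "integrable circ (\<lambda>\<theta>. \<phi> \<theta> * (\<Sum>n. \<beta> n * cis (real_of_int (k n) * \<theta>)))" if "summable (\<lambda>n. cmod (\<beta> n))"
    for \<beta> :: "nat \<Rightarrow> complex" and k :: "nat \<Rightarrow> int"
  proof (rule integrable_circ)
    show "norm (\<phi> \<theta> * (\<Sum>n. \<beta> n * cis (real_of_int (k n) * \<theta>))) \<le> B * (\<Sum>n. cmod (\<beta> n))" for \<theta>
      unfolding norm_mult using order_trans[OF norm_ge_zero B[of \<theta>]]
      by (intro mult_mono B bound[OF that]) auto
  qed measurable
  have "(LINT \<theta>|circ. \<phi> \<theta> * ?S1 \<theta>) + (LINT \<theta>|circ. \<phi> \<theta> * ?S2 \<theta>) = (LINT \<theta>|circ. \<phi> \<theta> * ?S1 \<theta> + \<phi> \<theta> * ?S2 \<theta>)"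
    by (rule Bochner_Integration.integral_add[symmetric]) (rule i[OF s1], rule i[OF s2])
  also have "(\<lambda>\<theta>. \<phi> \<theta> * ?S1 \<theta> + \<phi> \<theta> * ?S2 \<theta>) = (\<lambda>\<theta>. \<phi> \<theta> * of_real (poisson z \<theta>))"
    by (simp only: distrib_left[symmetric] poisson_series[OF z])
  finally show ?thesis
    using sums_add[OF integral_circ_series[OF assms(2) B s1, of "\<lambda>n. - int n"] integral_circ_series[OF assms(2) B s2, of int]]
    by simp
qed

lemma integral_poisson_1:
  assumes z: "cmod z < 1" shows "(LINT \<theta>|circ. poisson z \<theta>) = 2 * pi"
proof -
  have "(\<lambda>n. z ^ n * (LINT \<theta>|circ. 1 * cis (real_of_int (- int n) * \<theta>))
      + (if n = 0 then 0 else cnj z ^ n) * (LINT \<theta>|circ. 1 * cis (real_of_int (int n) * \<theta>)))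
    sums (LINT \<theta>|circ. 1 * of_real (poisson z \<theta>))"
    by (rule integral_poisson[OF z, of "\<lambda>_. 1" 1]) auto
  also have "(\<lambda>n. z ^ n * (LINT \<theta>|circ. 1 * cis (real_of_int (- int n) * \<theta>))
      + (if n = 0 then 0 else cnj z ^ n) * (LINT \<theta>|circ. 1 * cis (real_of_int (int n) * \<theta>)))
    = (\<lambda>n. if n = 0 then of_real (2 * pi) else 0)"
    unfolding mult_1 integral_circ_cis by (auto simp: fun_eq_iff)
  finally have "(LINT \<theta>|circ. of_real (poisson z \<theta>)) = complex_of_real (2 * pi)"
    using sums_unique2[OF _ sums_single[of 0 "\<lambda>_. complex_of_real (2 * pi)"]] by simp
  then show ?thesis by (simp only: integral_complex_of_real of_real_eq_iff)
qed

section \<open>Boundary values of a harmonic bijection of the disc\<close>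

locale harmonic_disk = harmonic_pair +
  assumes bij: "bij_betw hp (ball 0 1) (ball 0 1)"
begin

lemma hp_bound: "cmod z < 1 \<Longrightarrow> cmod (hp z) < 1"
  using bij by (auto simp: bij_betw_def)

lemma hp_inverse:
  obtains k where "continuous_on (ball 0 1) k" "k ` ball 0 1 = ball 0 1" "\<And>z. z \<in> ball 0 1 \<Longrightarrow> k (hp z) = z"
    "\<And>w. w \<in> ball 0 1 \<Longrightarrow> hp (k w) = w"
proof -
  have inj: "inj_on hp (ball 0 1)" and im: "hp ` ball 0 1 = ball 0 1" using bij by (auto simp: bij_betw_def)
  obtain k where "homeomorphism (ball 0 1) (hp ` ball 0 1) hp k"
    using invariance_of_domain_homeomorphism[OF open_ball hp_continuous _ inj] by auto
  then show thesis using that[of k] by (auto simp: homeomorphism_def im)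
qed

text \<open>The inverse is continuous by invariance of domain, so the preimage of a smaller closed
  disc is compact in the open disc; \<open>R\<close> is its largest modulus.\<close>

lemma hp_proper:
  assumes "s < 1"
  obtains R where "0 \<le> R" "R < 1" "\<And>z. R < cmod z \<Longrightarrow> cmod z < 1 \<Longrightarrow> s < cmod (hp z)"
proof -
  obtain k where k: "continuous_on (ball 0 1) k" "k ` ball 0 1 = ball 0 1" "\<And>z. z \<in> ball 0 1 \<Longrightarrow> k (hp z) = z"
    using hp_inverse by metis
  \<comment> \<open>Inserting 0 keeps the set nonempty when \<open>s\<close> is negative.\<close>
  define K where "K = insert 0 (k ` cball 0 s)"
  have sub: "cball (0::complex) s \<subseteq> ball 0 1" using assms by auto
  have "compact K" unfolding K_def
    by (intro compact_insert compact_continuous_image continuous_on_subset[OF k(1) sub] compact_cball)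
  moreover have "K \<noteq> {}" by (simp add: K_def)
  ultimately obtain m where m: "m \<in> K" "\<And>z. z \<in> K \<Longrightarrow> cmod z \<le> cmod m"
    using continuous_attains_sup[of K cmod] by (metis continuous_on_norm_id)
  have "K \<subseteq> ball 0 1" using k(2) sub by (auto simp: K_def)
  then have "cmod m < 1" using m by auto
  moreover have "s < cmod (hp z)" if "cmod m < cmod z" "cmod z < 1" for z
  proof (rule ccontr)
    assume "\<not> s < cmod (hp z)"
    then have "k (hp z) \<in> K" by (auto simp: K_def)
    then have "z \<in> K" using k(3)[of z] that by simp
    then show False using m(2)[of z] that by simp
  qed
  ultimately show thesis using that[of "cmod m"] by auto
qed

text \<open>At \<open>t = R * S\<close> this is the inner product of the restrictions to the circles
  of radii \<open>R\<close> and \<open>S\<close>; it depends on the two radii only through their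
  product.\<close>

definition energy :: "real \<Rightarrow> real" where
  "energy t = (\<Sum>n. 2 * pi * (((cmod (taylor h n))\<^sup>2 + (cmod (taylor g n))\<^sup>2) * t ^ n))"

lemma hp_inner:
  assumes R: "0 \<le> R" "R < 1" and S: "0 \<le> S" "S < 1"
  shows "(LINT \<theta>|circ. hp (of_real R * cis \<theta>) * cnj (hp (of_real S * cis \<theta>))) = of_real (energy (R * S))"
proof -
  have "(\<lambda>n. complex_of_real (2 * pi * (((cmod (taylor h n))\<^sup>2 + (cmod (taylor g n))\<^sup>2) * (R * S) ^ n))) sums
    (LINT \<theta>|circ. hp (of_real R * cis \<theta>) * cnj (hp (of_real S * cis \<theta>)))"
    using hp_Parseval[OF R S] by (simp only: of_real_mult of_real_eq_id id_apply)
  moreover from sums_Re[OF this] have "(\<lambda>n. 2 * pi * (((cmod (taylor h n))\<^sup>2 + (cmod (taylor g n))\<^sup>2) * (R * S) ^ n)) sums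
    Re (LINT \<theta>|circ. hp (of_real R * cis \<theta>) * cnj (hp (of_real S * cis \<theta>)))"
    by (simp only: Re_complex_of_real)
  then have "(\<lambda>n. complex_of_real (2 * pi * (((cmod (taylor h n))\<^sup>2 + (cmod (taylor g n))\<^sup>2) * (R * S) ^ n))) sums
    complex_of_real (energy (R * S))"
    unfolding energy_def by (intro sums_of_real) (simp add: sums_iff)
  ultimately show ?thesis by (rule sums_unique2)
qed

lemma hp_circle_le:
  assumes "0 \<le> R" "R < 1" shows "cmod (hp (of_real R * cis \<theta>)) \<le> 1"
  using hp_bound[of "of_real R * cis \<theta>"] assms by (simp add: norm_mult)

lemma energy_square:
  assumes R: "0 \<le> R" "R < 1"
  shows "energy (R * R) = (LINT \<theta>|circ. (cmod (hp (of_real R * cis \<theta>)))\<^sup>2)"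
proof -
  have "complex_of_real (energy (R * R)) = (LINT \<theta>|circ. of_real ((cmod (hp (of_real R * cis \<theta>)))\<^sup>2))"
    unfolding hp_inner[OF R R, symmetric] complex_norm_square ..
  then show ?thesis by (simp only: integral_complex_of_real of_real_eq_iff)
qed

lemma energy_difference:
  assumes R: "0 \<le> R" "R < 1" and S: "0 \<le> S" "S < 1"
  shows "(LINT \<theta>|circ. (cmod (hp (of_real R * cis \<theta>) - hp (of_real S * cis \<theta>)))\<^sup>2)
    = energy (R * R) + energy (S * S) - 2 * energy (R * S)"
proof -
  let ?f = "\<lambda>R \<theta>. hp (of_real R * cis \<theta>)"
  have int: "integrable circ (\<lambda>\<theta>. ?f R \<theta> * cnj (?f S \<theta>))" if "0 \<le> R" "R < 1" "0 \<le> S" "S < 1" for R S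
  proof -
    note [measurable] = hp_circle_measurable[OF that(1,2)] hp_circle_measurable[OF that(3,4)]
    show ?thesis
      by (rule integrable_circ[where B = 1]) (measurable, simp add: norm_mult mult_le_one hp_circle_le that)
  qed
  have "complex_of_real (LINT \<theta>|circ. (cmod (?f R \<theta> - ?f S \<theta>))\<^sup>2)
    = (LINT \<theta>|circ. of_real ((cmod (?f R \<theta> - ?f S \<theta>))\<^sup>2))"
    by (rule integral_complex_of_real[symmetric])
  also have "\<dots> = (LINT \<theta>|circ. (?f R \<theta> * cnj (?f R \<theta>) + ?f S \<theta> * cnj (?f S \<theta>))
      - (?f R \<theta> * cnj (?f S \<theta>) + ?f S \<theta> * cnj (?f R \<theta>)))"
    unfolding complex_norm_square by (simp add: algebra_simps)
  also have "\<dots> = (of_real (energy (R * R)) + of_real (energy (S * S))) - (of_real (energy (R * S)) + of_real (energy (S * R)))"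
    using int[OF R R] int[OF S S] int[OF R S] int[OF S R]
    by (simp add: hp_inner R S Bochner_Integration.integral_add Bochner_Integration.integral_diff)
  also have "\<dots> = of_real (energy (R * R) + energy (S * S) - 2 * energy (R * S))" by (simp add: mult.commute)
  finally show ?thesis by (simp only: of_real_eq_iff)
qed

lemma energy_le:
  assumes "0 \<le> t" "t < 1" shows "energy t \<le> 2 * pi"
proof -
  define R where "R = sqrt t"
  have R: "0 \<le> R" "R < 1" "t = R * R" using assms by (auto simp: R_def)
  note [measurable] = hp_circle_measurable[OF R(1,2)]
  have bd: "(cmod (hp (of_real R * cis \<theta>)))\<^sup>2 \<le> 1" for \<theta>
    using hp_circle_le[OF R(1,2), of \<theta>] by (simp add: power_le_one)
  have "(LINT \<theta>|circ. (cmod (hp (of_real R * cis \<theta>)))\<^sup>2) \<le> 1 * (2 * pi)"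
    using norm_integral_circ_le[of "\<lambda>\<theta>. (cmod (hp (of_real R * cis \<theta>)))\<^sup>2" 1] bd by simp
  then show ?thesis unfolding R(3) energy_square[OF R(1,2)] by simp
qed

lemma energy_ge:
  assumes "0 < \<epsilon>"
  obtains T where "0 \<le> T" "T < 1" "\<And>t. T < t \<Longrightarrow> t < 1 \<Longrightarrow> 2 * pi - \<epsilon> \<le> energy t"
proof -
  \<comment> \<open>The choice \<open>s\<^sup>2 = 1 - \<delta>\<close> costs
    \<open>2 * pi * \<delta> \<le> \<epsilon>\<close> in energy; the cap at 1 keeps the square root
    meaningful.\<close>
  define \<delta> where "\<delta> = min 1 (\<epsilon> / (2 * pi))"
  have \<delta>: "0 < \<delta>" "\<delta> \<le> 1" "2 * pi * \<delta> \<le> \<epsilon>"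
    using assms by (auto simp: \<delta>_def min_def field_simps)
  define s where "s = sqrt (1 - \<delta>)"
  have s: "0 \<le> s" "s < 1" "s\<^sup>2 = 1 - \<delta>" using \<delta> by (auto simp: s_def)
  obtain R where R: "0 \<le> R" "R < 1" "\<And>z. R < cmod z \<Longrightarrow> cmod z < 1 \<Longrightarrow> s < cmod (hp z)"
    using hp_proper[OF s(2)] by blast
  have "2 * pi - \<epsilon> \<le> energy t" if t: "R * R < t" "t < 1" for t
  proof -
    define S where "S = sqrt t"
    have t0: "0 \<le> t" using t R(1) by (meson less_imp_le mult_nonneg_nonneg order_trans)
    have S: "0 \<le> S" "S < 1" "t = S * S" using t0 t by (auto simp: S_def)
    have "R < S" using t R(1) S by (metis linorder_not_le mult_mono)
    note [measurable] = hp_circle_measurable[OF S(1,2)]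
    have bd: "(cmod (hp (of_real S * cis \<theta>)))\<^sup>2 \<le> 1" for \<theta>
      using hp_circle_le[OF S(1,2), of \<theta>] by (simp add: power_le_one)
    have "s\<^sup>2 * (2 * pi) = (LINT \<theta>|circ. s\<^sup>2)" by (simp add: measure_circ)
    also have "\<dots> \<le> (LINT \<theta>|circ. (cmod (hp (of_real S * cis \<theta>)))\<^sup>2)"
    proof (rule integral_mono)
      show "integrable circ (\<lambda>\<theta>. (cmod (hp (of_real S * cis \<theta>)))\<^sup>2)"
        by (rule integrable_circ[where B = 1]) (use bd in auto)
      show "s\<^sup>2 \<le> (cmod (hp (of_real S * cis \<theta>)))\<^sup>2" for \<theta>
        using R(3)[of "of_real S * cis \<theta>"] S \<open>R < S\<close> s(1) by (intro power_mono) (auto simp: norm_mult)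
    qed simp
    also have "\<dots> = energy t" using energy_square[OF S(1,2)] S(3) by simp
    finally show ?thesis using \<delta>(3) s(3) by (simp add: algebra_simps)
  qed
  moreover have "R * R < 1" using R by (metis mult_less_cancel_left2 less_eq_real_def mult_le_one not_less order_le_less_trans mult_left_le)
  ultimately show thesis using that[of "R * R"] R by auto
qed

definition radius :: "nat \<Rightarrow> real" where "radius k = 1 - 1 / (real k + 2)"

lemma radius: "0 \<le> radius k" "radius k < 1"
  by (auto simp: radius_def)

lemma radius_pos: "0 < radius k"
  by (auto simp: radius_def divide_less_eq)

lemma radius_tendsto: "radius \<longlonglongrightarrow> 1"
  unfolding radius_def by real_asymp

text \<open>Each of the two squared norms is at most \<open>2 * pi\<close>, while the mixed term is
  at least \<open>2 * pi - \<epsilon> / 2\<close>, so the squared distance is at most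
  \<epsilon>.\<close>

lemma radial_subsequence:
  obtains r where "strict_mono r" "AE \<theta> in circ. convergent (\<lambda>i. hp (of_real (radius (r i)) * cis \<theta>))"
proof (rule circ_L2_Cauchy_subseq[of "\<lambda>k \<theta>. hp (of_real (radius k) * cis \<theta>)"])
  show "(\<lambda>\<theta>. hp (of_real (radius k) * cis \<theta>)) \<in> borel_measurable borel" for k
    by (rule hp_circle_measurable[OF radius])
  show "cmod (hp (of_real (radius k) * cis \<theta>)) \<le> 1" for k \<theta> by (rule hp_circle_le[OF radius])
  fix \<epsilon> :: real assume "0 < \<epsilon>"
  then have "0 < \<epsilon> / 2" by simp
  from energy_ge[OF this] obtain T where T: "0 \<le> T" "T < 1" "\<And>t. T < t \<Longrightarrow> t < 1 \<Longrightarrow> 2 * pi - \<epsilon> / 2 \<le> energy t" by blast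
  \<comment> \<open>The square root makes the product of two such radii exceed
    \<open>T\<close>.\<close>
  have "eventually (\<lambda>k. sqrt T < radius k) sequentially"
    using order_tendstoD(1)[OF radius_tendsto] T by simp
  then obtain K where K: "\<And>k. k \<ge> K \<Longrightarrow> sqrt T < radius k" by (auto simp: eventually_sequentially)
  have "(LINT \<theta>|circ. (cmod (hp (of_real (radius k) * cis \<theta>) - hp (of_real (radius j) * cis \<theta>)))\<^sup>2) \<le> \<epsilon>"
    if "k \<ge> K" "j \<ge> K" for k j
  proof -
    have sq: "radius k * radius k < 1" "radius j * radius j < 1" "radius k * radius j < 1"
      using mult_strict_mono[OF radius(2)[of k] radius(2)[of k]] mult_strict_mono[OF radius(2)[of j] radius(2)[of j]]
        mult_strict_mono[OF radius(2)[of k] radius(2)[of j]] radius(1) by auto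
    have "sqrt T * sqrt T < radius k * radius j"
      using K that T radius radius_pos by (intro mult_strict_mono) auto
    then have "T < radius k * radius j" using T by simp
    from T(3)[OF this sq(3)] energy_le[of "radius k * radius k"] energy_le[of "radius j * radius j"] sq radius(1)
    show ?thesis unfolding energy_difference[OF radius radius] by simp
  qed
  then show "\<exists>K. \<forall>k\<ge>K. \<forall>j\<ge>K. (LINT \<theta>|circ. (cmod (hp (of_real (radius k) * cis \<theta>) - hp (of_real (radius j) * cis \<theta>)))\<^sup>2) \<le> \<epsilon>"
    by blast
qed

end

context harmonic_disk
begin

lemma boundary_function:
  obtains F r where "F \<in> borel_measurable borel" "\<And>\<theta>. cmod (F \<theta>) = 1" "strict_mono r"
    "AE \<theta> in circ. (\<lambda>i. hp (of_real (radius (r i)) * cis \<theta>)) \<longlonglongrightarrow> F \<theta>"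
proof -
  obtain r where r: "strict_mono r" "AE \<theta> in circ. convergent (\<lambda>i. hp (of_real (radius (r i)) * cis \<theta>))"
    using radial_subsequence by blast
  let ?u = "\<lambda>i \<theta>. hp (of_real (radius (r i)) * cis \<theta>)"
  have [measurable]: "?u i \<in> borel_measurable borel" for i by (rule hp_circle_measurable[OF radius])
  define F0 where "F0 \<theta> = lim (\<lambda>i. ?u i \<theta>)" for \<theta>
  have [measurable]: "F0 \<in> borel_measurable borel"
    unfolding F0_def[abs_def] by (rule borel_measurable_lim_metric) measurable
  \<comment> \<open>On the exceptional null set the value 1 keeps the boundary function unimodular
    everywhere; elsewhere properness forces modulus 1.\<close>
  define F where "F \<theta> = (if cmod (F0 \<theta>) = 1 then F0 \<theta> else 1)" for \<theta>
  have rad: "(\<lambda>i. radius (r i)) \<longlonglongrightarrow> 1"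
    using LIMSEQ_subseq_LIMSEQ[OF radius_tendsto r(1)] by (simp add: o_def)
  have unit: "cmod l = 1" if "(\<lambda>i. ?u i \<theta>) \<longlonglongrightarrow> l" for l \<theta>
  proof (rule antisym)
    have n: "(\<lambda>i. cmod (?u i \<theta>)) \<longlonglongrightarrow> cmod l" using that by (rule tendsto_norm)
    show "cmod l \<le> 1" by (rule LIMSEQ_le_const2[OF n]) (use hp_circle_le[OF radius] in blast)
    show "1 \<le> cmod l"
    proof (rule dense_le)
      fix s :: real assume s: "s < 1"
      obtain R where R: "R < 1" "\<And>z. R < cmod z \<Longrightarrow> cmod z < 1 \<Longrightarrow> s < cmod (hp z)"
        using hp_proper[OF s] by blast
      have "eventually (\<lambda>i. s \<le> cmod (?u i \<theta>)) sequentially"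
        using order_tendstoD(1)[OF rad R(1)]
      proof eventually_elim
        case (elim i)
        then show ?case using R(2)[of "of_real (radius (r i)) * cis \<theta>"] radius[of "r i"] by (simp add: norm_mult)
      qed
      then show "s \<le> cmod l" using tendsto_lowerbound[OF n] by simp
    qed
  qed
  show thesis
  proof (rule that[of F r])
    show "F \<in> borel_measurable borel" unfolding F_def[abs_def] by measurable
    show "cmod (F \<theta>) = 1" for \<theta> by (simp add: F_def)
    show "AE \<theta> in circ. (\<lambda>i. ?u i \<theta>) \<longlonglongrightarrow> F \<theta>" using r(2)
    proof eventually_elim
      case (elim \<theta>)
      then have "(\<lambda>i. ?u i \<theta>) \<longlonglongrightarrow> F0 \<theta>" unfolding F0_def by (simp add: convergent_LIMSEQ_iff)
      then show ?case using unit[of \<theta> "F0 \<theta>"] by (simp add: F_def)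
    qed
  qed (rule r(1))
qed

end

locale harmonic_boundary = harmonic_disk h g + circle_boundary F
  for h g :: "complex \<Rightarrow> complex" and F :: "real \<Rightarrow> complex" +
  fixes r :: "nat \<Rightarrow> nat"
  assumes r: "strict_mono r"
    and radial_limit: "AE \<theta> in circ. (\<lambda>i. hp (of_real (radius (r i)) * cis \<theta>)) \<longlonglongrightarrow> F \<theta>"
begin

lemma radius_subseq: "(\<lambda>i. radius (r i)) \<longlonglongrightarrow> 1"
  using LIMSEQ_subseq_LIMSEQ[OF radius_tendsto r] by (simp add: o_def)

lemma coeff_limit:
  "(\<lambda>i. LINT \<theta>|circ. hp (of_real (radius (r i)) * cis \<theta>) * cis (real_of_int m * \<theta>)) \<longlonglongrightarrow>
    (LINT \<theta>|circ. F \<theta> * cis (real_of_int m * \<theta>))"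
proof (rule integral_dominated_convergence[where w = "\<lambda>_. 1"])
  note [measurable] = hp_circle_measurable[OF radius]
  show "(\<lambda>\<theta>. hp (of_real (radius (r i)) * cis \<theta>) * cis (real_of_int m * \<theta>)) \<in> borel_measurable circ" for i
    by measurable
  show "AE \<theta> in circ. (\<lambda>i. hp (of_real (radius (r i)) * cis \<theta>) * cis (real_of_int m * \<theta>))
      \<longlonglongrightarrow> F \<theta> * cis (real_of_int m * \<theta>)"
    using radial_limit by eventually_elim (intro tendsto_intros)
  show "AE \<theta> in circ. norm (hp (of_real (radius (r i)) * cis \<theta>) * cis (real_of_int m * \<theta>)) \<le> 1" for i
    using hp_circle_le[OF radius] by (simp add: norm_mult)
qed auto

lemma coeff_nonneg: "coeff (int n) = 2 * pi * taylor h n"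
proof -
  have "(\<lambda>i. LINT \<theta>|circ. hp (of_real (radius (r i)) * cis \<theta>) * cis (real_of_int (- int n) * \<theta>)) \<longlonglongrightarrow> coeff (int n)"
    using coeff_limit[of "- int n"] by (simp add: coeff_def)
  moreover have "(LINT \<theta>|circ. hp (of_real (radius (r i)) * cis \<theta>) * cis (real_of_int (- int n) * \<theta>))
     = of_real (radius (r i)) ^ n * (2 * pi * taylor h n)" for i
    using hp_coeff(1)[OF radius, of "r i" n] by (simp add: mult_ac)
  moreover have "(\<lambda>i. of_real (radius (r i)) ^ n * (2 * pi * taylor h n)) \<longlonglongrightarrow> of_real 1 ^ n * (2 * pi * taylor h n)"
    by (intro tendsto_intros tendsto_of_real radius_subseq)
  ultimately show ?thesis using LIMSEQ_unique by simp
qed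

lemma coeff_neg:
  assumes "n \<noteq> 0" shows "coeff (- int n) = 2 * pi * cnj (taylor g n)"
proof -
  have "(\<lambda>i. LINT \<theta>|circ. hp (of_real (radius (r i)) * cis \<theta>) * cis (real_of_int (int n) * \<theta>)) \<longlonglongrightarrow> coeff (- int n)"
    using coeff_limit[of "int n"] by (simp add: coeff_def)
  moreover have "(LINT \<theta>|circ. hp (of_real (radius (r i)) * cis \<theta>) * cis (real_of_int (int n) * \<theta>))
     = of_real (radius (r i)) ^ n * (2 * pi * cnj (taylor g n))" for i
    using hp_coeff(2)[OF radius, of "r i" n] assms by (simp add: mult_ac)
  moreover have "(\<lambda>i. of_real (radius (r i)) ^ n * (2 * pi * cnj (taylor g n))) \<longlonglongrightarrow> of_real 1 ^ n * (2 * pi * cnj (taylor g n))"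
    by (intro tendsto_intros tendsto_of_real radius_subseq)
  ultimately show ?thesis using LIMSEQ_unique by simp
qed

text \<open>Both sides have the same expansion in powers of \<open>z\<close> and
  \<open>cnj z\<close>: the Fourier coefficients of \<open>F\<close> are the limits of those on the
  circles, hence the Taylor data times \<open>2 * pi\<close>.\<close>

lemma poisson_representation:
  assumes z: "cmod z < 1"
  shows "(LINT \<theta>|circ. F \<theta> * of_real (poisson z \<theta>)) = 2 * pi * hp z"
proof -
  have c1: "(LINT \<theta>|circ. F \<theta> * cis (real_of_int (- int n) * \<theta>)) = 2 * pi * taylor h n" for n
    using coeff_nonneg[of n] by (simp add: coeff_def)
  have c2: "(LINT \<theta>|circ. F \<theta> * cis (real_of_int (int n) * \<theta>)) = 2 * pi * cnj (taylor g n)" if "n \<noteq> 0" for n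
    using coeff_neg[OF that] by (simp add: coeff_def)
  have "z ^ n * (LINT \<theta>|circ. F \<theta> * cis (real_of_int (- int n) * \<theta>))
      + (if n = 0 then 0 else cnj z ^ n) * (LINT \<theta>|circ. F \<theta> * cis (real_of_int (int n) * \<theta>))
     = 2 * pi * (taylor h n * z ^ n + cnj (taylor g n * z ^ n))" for n
  proof (cases "n = 0")
    case True
    then show ?thesis using c1[of n] b0 by simp
  next
    case False
    show ?thesis unfolding c1 c2[OF False] using False by (simp add: algebra_simps)
  qed
  then have "(\<lambda>n. 2 * pi * (taylor h n * z ^ n + cnj (taylor g n * z ^ n))) sums
      (LINT \<theta>|circ. F \<theta> * of_real (poisson z \<theta>))"
    using integral_poisson[OF z F_measurable, of 1] by simp
  moreover have "(\<lambda>n. 2 * pi * (taylor h n * z ^ n + cnj (taylor g n * z ^ n))) sums (2 * pi * (h z + cnj (g z)))"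
    by (intro sums_mult sums_add sums_cnj[THEN iffD2] taylor_sums h g z)
  ultimately show ?thesis unfolding hp_def by (rule sums_unique2)
qed

lemma half_plane_bound:
  assumes "AE \<theta> in circ. Re (cis (- \<gamma>) * F \<theta>) \<le> c" and z: "cmod z < 1"
  shows "Re (cis (- \<gamma>) * hp z) \<le> c"
proof -
  have pb: "\<bar>poisson z \<theta>\<bar> \<le> 1 / (1 - cmod z)\<^sup>2" for \<theta> by (rule poisson_bounded[OF z])
  have ip: "integrable circ (poisson z)" by (rule integrable_circ[where B = "1 / (1 - cmod z)\<^sup>2"]) (use pb in auto)
  have iF: "integrable circ (\<lambda>\<theta>. cis (- \<gamma>) * (F \<theta> * of_real (poisson z \<theta>)))"
    by (rule integrable_circ[where B = "1 / (1 - cmod z)\<^sup>2"]) (measurable, use pb in \<open>simp add: norm_mult\<close>)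
  have "2 * pi * Re (cis (- \<gamma>) * hp z) = Re (cis (- \<gamma>) * (LINT \<theta>|circ. F \<theta> * of_real (poisson z \<theta>)))"
    unfolding poisson_representation[OF z] by (simp add: algebra_simps)
  also have "\<dots> = (LINT \<theta>|circ. Re (cis (- \<gamma>) * (F \<theta> * of_real (poisson z \<theta>))))"
    using integral_Re[OF iF] by (simp only: integral_mult_right_zero)
  also have "\<dots> \<le> (LINT \<theta>|circ. c * poisson z \<theta>)"
  proof (rule integral_mono_AE)
    show "AE \<theta> in circ. Re (cis (- \<gamma>) * (F \<theta> * of_real (poisson z \<theta>))) \<le> c * poisson z \<theta>"
      using assms(1)
    proof eventually_elim
      case (elim \<theta>)
      have "cis (- \<gamma>) * (F \<theta> * of_real (poisson z \<theta>)) = (cis (- \<gamma>) * F \<theta>) * of_real (poisson z \<theta>)" by simp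
      then have "Re (cis (- \<gamma>) * (F \<theta> * of_real (poisson z \<theta>))) = Re (cis (- \<gamma>) * F \<theta>) * poisson z \<theta>"
        by (simp only: times_complex.sel Re_complex_of_real Im_complex_of_real mult_zero_right diff_zero)
      then show ?case using mult_right_mono[OF elim poisson_nonneg[OF z]] by simp
    qed
  qed (intro integrable_Re iF Bochner_Integration.integrable_mult_right ip)+
  also have "\<dots> = c * (2 * pi)" by (simp add: integral_poisson_1[OF z])
  finally show ?thesis by simp
qed

text \<open>The sector has axis direction \<open>x + u / 2\<close> and opening
  \<open>pi - u\<close>. If \<open>F\<close> avoids it, its values have component at most
  \<open>sin (u / 2)\<close> along the axis; the Poisson integral inherits this bound, contradicting
  surjectivity.\<close>

lemma sector_hit:
  assumes u: "0 < u" "u < pi"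
  shows "\<not> (AE \<theta> in circ. \<not> (side x \<theta> = 1 \<and> side (x + u) \<theta> = 1))"
proof
  assume ae: "AE \<theta> in circ. \<not> (side x \<theta> = 1 \<and> side (x + u) \<theta> = 1)"
  define \<gamma> where "\<gamma> = x + u / 2"
  \<comment> \<open>The cosine of half the opening angle of the sector.\<close>
  define c where "c = sin (u / 2)"
  have pos: "0 < sin (u / 2)" "0 < cos (u / 2)" using u by (auto intro!: sin_gt_zero cos_gt_zero)
  have "c < 1"
  proof -
    have "(sin (u / 2))\<^sup>2 < 1" using sin_cos_squared_add[of "u / 2"] zero_less_power[OF pos(2), of 2] by linarith
    then show ?thesis unfolding c_def using power2_less_imp_less[of "sin (u / 2)" 1] by simp
  qed
  have "AE \<theta> in circ. Re (cis (- \<gamma>) * F \<theta>) \<le> c" using ae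
  proof eventually_elim
    case (elim \<theta>)
    obtain \<xi> where \<xi>: "F \<theta> = cis \<xi>" using unimodular_cis[OF F_unit] by metis
    have Re: "Re (cis (- y) * F \<theta>) = cos (\<xi> - y)" for y unfolding \<xi> by (simp add: cis_mult)
    define \<delta> where "\<delta> = \<xi> - \<gamma>"
    show ?case
    proof (rule ccontr)
      assume "\<not> Re (cis (- \<gamma>) * F \<theta>) \<le> c"
      then have c: "sin (u / 2) < cos \<delta>" by (simp only: Re \<delta>_def c_def not_le)
      have "(sin (u / 2))\<^sup>2 < (cos \<delta>)\<^sup>2" using c pos by (intro power_strict_mono) auto
      then have "(sin \<delta>)\<^sup>2 < (cos (u / 2))\<^sup>2" using sin_cos_squared_add[of \<delta>] sin_cos_squared_add[of "u / 2"] by linarith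
      then have s: "\<bar>sin \<delta>\<bar> < cos (u / 2)" using power2_less_imp_less[of "\<bar>sin \<delta>\<bar>" "cos (u / 2)"] pos(2) by simp
      have "\<bar>sin \<delta> * sin (u / 2)\<bar> < cos (u / 2) * sin (u / 2)" using s pos by (simp add: abs_mult)
      moreover have "cos (u / 2) * sin (u / 2) < cos \<delta> * cos (u / 2)" using c pos by simp
      ultimately have "0 < cos \<delta> * cos (u / 2) - sin \<delta> * sin (u / 2)" "0 < cos \<delta> * cos (u / 2) + sin \<delta> * sin (u / 2)" by linarith+
      then have "0 < cos (\<delta> + u / 2)" "0 < cos (\<delta> - u / 2)" by (simp_all add: cos_add cos_diff)
      moreover have "\<delta> + u / 2 = \<xi> - x" "\<delta> - u / 2 = \<xi> - (x + u)" by (simp_all add: \<delta>_def \<gamma>_def)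
      ultimately have "side x \<theta> = 1" "side (x + u) \<theta> = 1" unfolding side_def Re by simp_all
      then show False using elim by simp
    qed
  qed
  then have b: "Re (cis (- \<gamma>) * hp z) \<le> c" if "cmod z < 1" for z by (rule half_plane_bound[OF _ that])
  \<comment> \<open>A point of the disc on the axis, halfway between the bound \<open>c\<close> and
    the circle.\<close>
  define w where "w = of_real ((1 + c) / 2) * cis \<gamma>"
  have "cmod w = \<bar>(1 + c) / 2\<bar>" unfolding w_def by (simp only: norm_mult norm_of_real norm_cis mult_1_right)
  then have "w \<in> ball 0 1" using \<open>c < 1\<close> pos by (simp add: c_def)
  then obtain z where "z \<in> ball 0 1" "w = hp z" using bij unfolding bij_betw_def by blast
  then have "Re (cis (- \<gamma>) * w) \<le> c" using b[of z] by simp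
  moreover have "cis (- \<gamma>) * w = of_real ((1 + c) / 2)"
    unfolding w_def by (simp only: mult.left_commute[of "cis (- \<gamma>)"] cis_mult) simp
  ultimately have "(1 + c) / 2 \<le> c" by (simp only: Re_complex_of_real)
  then show False using \<open>c < 1\<close> by simp
qed

text \<open>Adding \<open>pi\<close> to a direction flips its side, so each of the other sectors is
  again a sector of two positive sides, with angle \<open>u\<close> or
  \<open>pi - u\<close>.\<close>

lemma sectors_hit:
  assumes u: "0 < u" "u < pi" and "\<sigma> \<in> {1, - 1}" "\<tau> \<in> {1, - 1}"
  shows "\<not> (AE \<theta> in circ. \<not> (side x \<theta> = \<sigma> \<and> side (x + u) \<theta> = \<tau>))"
proof -
  have e: "side (x + u - pi) \<theta> = - side (x + u) \<theta>" for \<theta> using side_antiperiodic[of "x + u - pi" \<theta>] by simp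
  have e': "side (x + u + pi) \<theta> = - side (x + u) \<theta>" for \<theta> using side_antiperiodic[of "x + u" \<theta>] by simp
  have e'': "side (x + pi + u) \<theta> = - side (x + u) \<theta>" for \<theta> using e'[of \<theta>] by (simp add: add_ac)
  have m: "- t = 1 \<longleftrightarrow> t = - 1" for t :: real by linarith
  consider "\<sigma> = 1" "\<tau> = 1" | "\<sigma> = 1" "\<tau> = - 1" | "\<sigma> = - 1" "\<tau> = 1" | "\<sigma> = - 1" "\<tau> = - 1" using assms by auto
  then show ?thesis
  proof cases
    case 1
    then show ?thesis using sector_hit[OF u, of x] by simp
  next
    case 2
    have "x + u - pi + (pi - u) = x" by simp
    with sector_hit[of "pi - u" "x + u - pi"] u
    have "\<not> (AE \<theta> in circ. \<not> (side (x + u - pi) \<theta> = 1 \<and> side x \<theta> = 1))" by simp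
    then show ?thesis unfolding e m 2 by (rule contrapos_nn) (erule eventually_mono, blast)
  next
    case 3
    have "x + u + (pi - u) = x + pi" by simp
    with sector_hit[of "pi - u" "x + u"] u
    have "\<not> (AE \<theta> in circ. \<not> (side (x + u) \<theta> = 1 \<and> side (x + pi) \<theta> = 1))" by simp
    then show ?thesis unfolding side_antiperiodic m 3 by (rule contrapos_nn) (erule eventually_mono, blast)
  next
    case 4
    have "\<not> (AE \<theta> in circ. \<not> (side (x + pi) \<theta> = 1 \<and> side (x + pi + u) \<theta> = 1))"
      by (rule sector_hit[OF u])
    then show ?thesis unfolding e'' side_antiperiodic[of x] m 4 .
  qed
qed

end


section \<open>The boundary function is monotone\<close>

text \<open>Maximum principle against the barrier \<open>2 / \<epsilon>\<^sup>2 * (1 - Re (cnj \<zeta> * z))\<close>, which is at least \<open>1\<close>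
  on the part of the unit disc at distance \<open>\<epsilon>\<close> or more from \<open>\<zeta>\<close> and tends to \<open>0\<close> at \<open>\<zeta>\<close>.\<close>
lemma positivity_reaches_boundary:
  fixes k :: "complex \<Rightarrow> complex"
  assumes k: "k holomorphic_on ball 0 1" and k1: "\<And>z. cmod z < 1 \<Longrightarrow> Re (k z) \<le> 1"
    and \<zeta>: "cmod \<zeta> = 1" and \<epsilon>: "0 < \<epsilon>" and p: "cmod p < 1" "dist p \<zeta> < \<epsilon>"
    and big: "2 / \<epsilon>\<^sup>2 * (1 - Re (cnj \<zeta> * p)) < Re (k p)" and R: "R < 1"
  obtains \<gamma> where "path \<gamma>" "pathstart \<gamma> = p" "path_image \<gamma> \<subseteq> ball 0 1 \<inter> ball \<zeta> \<epsilon> \<inter> {z. 0 < Re (k z)}"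
    "R < cmod (pathfinish \<gamma>)"
proof -
  define W where "W = ball 0 1 \<inter> ball \<zeta> \<epsilon> \<inter> {z. 0 < Re (k z)}"
  have w0: "0 \<le> 1 - Re (cnj \<zeta> * z)" if "cmod z \<le> 1" for z
  proof -
    have "Re (cnj \<zeta> * z) \<le> cmod (cnj \<zeta> * z)" by (rule complex_Re_le_cmod)
    then show ?thesis using that \<zeta> by (simp add: norm_mult)
  qed
  have ck: "continuous_on (ball 0 1) k" using k by (rule holomorphic_on_imp_continuous_on)
  have "open (ball 0 1 \<inter> (\<lambda>z. Re (k z)) -` {0<..})"
    by (intro continuous_open_preimage continuous_intros ck) auto
  moreover have "W = (ball 0 1 \<inter> (\<lambda>z. Re (k z)) -` {0<..}) \<inter> ball \<zeta> \<epsilon>" by (auto simp: W_def)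
  ultimately have opO: "open W" by auto
  have "0 < Re (k p)"
    using big w0[of p] p \<epsilon> by (intro order.strict_trans1[OF _ big]) auto
  then have pO: "p \<in> W" using p by (simp add: W_def dist_commute)
  define C where "C = connected_component_set W p"
  have C: "C \<subseteq> W" "connected C" "open C" "p \<in> C"
    using opO pO by (auto simp: C_def connected_component_subset open_connected_component)
  have "\<exists>q\<in>C. R < cmod q"
  proof (rule ccontr)
    \<comment> \<open>Then the closure of the component lies inside the open disc, so the maximum
      principle applies to \<open>k\<close> minus the barrier and contradicts its value at
      \<open>p\<close>.\<close>
    assume "\<not> (\<exists>q\<in>C. R < cmod q)"
    then have "C \<subseteq> cball 0 R" by force
    then have cl: "closure C \<subseteq> cball 0 R" by (rule closure_minimal) simp
    then have cl1: "closure C \<subseteq> ball 0 1" using R by force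
    have "Re (k p - of_real (2 / \<epsilon>\<^sup>2) * (1 - cnj \<zeta> * p)) \<le> 0"
    proof (rule maximum_real_frontier[where S = C and \<xi> = p and B = 0
          and f = "\<lambda>z. k z - of_real (2 / \<epsilon>\<^sup>2) * (1 - cnj \<zeta> * z)"])
      show "(\<lambda>z. k z - of_real (2 / \<epsilon>\<^sup>2) * (1 - cnj \<zeta> * z)) holomorphic_on interior C"
        using cl1 closure_subset interior_subset
        by (intro holomorphic_intros holomorphic_on_subset[OF k]) blast
      show "continuous_on (closure C) (\<lambda>z. k z - of_real (2 / \<epsilon>\<^sup>2) * (1 - cnj \<zeta> * z))"
        by (intro continuous_intros continuous_on_subset[OF ck cl1])
      show "bounded C" using \<open>C \<subseteq> cball 0 R\<close> bounded_cball bounded_subset by blast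
      fix q assume q: "q \<in> frontier C"
      then have qcl: "q \<in> closure C" and qC: "q \<notin> C" using C(3) by (auto simp: frontier_def interior_open)
      then have q1: "cmod q < 1" using cl1 by auto
      have re: "Re (of_real (2 / \<epsilon>\<^sup>2) * (1 - cnj \<zeta> * q)) = 2 / \<epsilon>\<^sup>2 * (1 - Re (cnj \<zeta> * q))" by simp
      have "Re (k q) \<le> 2 / \<epsilon>\<^sup>2 * (1 - Re (cnj \<zeta> * q))"
      proof (cases "dist q \<zeta> < \<epsilon>")
        case True
        \<comment> \<open>A frontier point in the small ball cannot belong to \<open>W\<close>,
          since the component would absorb it; so \<open>Re (k q)\<close> is at most 0
          there.\<close>
        have "connected (insert q C)"
          by (rule connected_intermediate_closure[OF C(2)]) (use qcl closure_subset in auto)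
        then have "\<not> insert q C \<subseteq> W"
          using connected_component_maximal[of p "insert q C" W] C(4) qC unfolding C_def by blast
        then have "Re (k q) \<le> 0" using C(1) q1 True by (auto simp: W_def dist_commute)
        also have "0 \<le> 2 / \<epsilon>\<^sup>2 * (1 - Re (cnj \<zeta> * q))" using w0[of q] q1 by simp
        finally show ?thesis .
      next
        case False
        have "\<epsilon>\<^sup>2 \<le> (dist q \<zeta>)\<^sup>2" using False \<epsilon> by (intro power_mono) auto
        also have "(dist q \<zeta>)\<^sup>2 = (cmod q)\<^sup>2 + 1 - 2 * Re (cnj \<zeta> * q)"
        proof -
          have "(Re \<zeta>)\<^sup>2 + (Im \<zeta>)\<^sup>2 = 1" using \<zeta> cmod_power2[of \<zeta>] by simp
          then show ?thesis unfolding dist_norm cmod_power2 by (simp add: power2_eq_square algebra_simps)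
        qed
        also have "\<dots> \<le> 2 * (1 - Re (cnj \<zeta> * q))" using q1 by (simp add: power_le_one)
        finally have "1 \<le> 2 / \<epsilon>\<^sup>2 * (1 - Re (cnj \<zeta> * q))" using \<epsilon> by (simp add: field_simps)
        then show ?thesis using k1[OF q1] by linarith
      qed
      then show "Re (k q - of_real (2 / \<epsilon>\<^sup>2) * (1 - cnj \<zeta> * q)) \<le> 0"
        unfolding minus_complex.sel(1)[of "k q"] re by linarith
    qed (rule C(4))
    then show False using big by simp
  qed
  then obtain q where q: "q \<in> C" "R < cmod q" by blast
  have "path_connected C" using C by (simp add: connected_open_path_connected)
  then obtain \<gamma> where "path \<gamma>" "path_image \<gamma> \<subseteq> C" "pathstart \<gamma> = p" "pathfinish \<gamma> = q"
    using C(4) q(1) unfolding path_connected_def by blast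
  then show thesis using that[of \<gamma>] q(2) C(1) unfolding W_def by auto
qed

text \<open>Transported to \<open>real^2\<close> and enclosed in a box, both paths have their ends
  on the bottom side in interlaced order, the situation of the Fashoda meet theorem.\<close>

lemma half_plane_paths_cross:
  fixes \<alpha> \<beta> :: "real \<Rightarrow> complex"
  assumes "path \<alpha>" "path \<beta>"
    and im: "\<And>z. z \<in> path_image \<alpha> \<union> path_image \<beta> \<Longrightarrow> 0 \<le> Im z"
    and ends: "Im (pathstart \<alpha>) = 0" "Im (pathfinish \<alpha>) = 0" "Im (pathstart \<beta>) = 0" "Im (pathfinish \<beta>) = 0"
    and o: "Re (pathstart \<alpha>) < Re (pathstart \<beta>)" "Re (pathstart \<beta>) < Re (pathfinish \<alpha>)"
      "Re (pathfinish \<alpha>) < Re (pathfinish \<beta>)"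
  shows "path_image \<alpha> \<inter> path_image \<beta> \<noteq> {}"
proof -
  define V :: "complex \<Rightarrow> real^2" where "V z = Re z *\<^sub>R axis 1 1 + Im z *\<^sub>R axis 2 1" for z
  have V: "V z $ 1 = Re z" "V z $ 2 = Im z" for z by (simp_all add: V_def axis_def)
  have cV: "continuous_on A V" for A unfolding V_def[abs_def] by (intro continuous_intros)
  have "bounded (path_image \<alpha> \<union> path_image \<beta>)" using assms(1,2) by (simp add: bounded_path_image)
  then obtain M where M: "\<And>z. z \<in> path_image \<alpha> \<union> path_image \<beta> \<Longrightarrow> cmod z \<le> M" unfolding bounded_iff by blast
  define a b :: "real^2" where "a = vector [- M, 0]" and "b = vector [M, M]"
  have box: "V z \<in> cbox a b" if "z \<in> path_image \<alpha> \<union> path_image \<beta>" for z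
    using M[OF that] im[OF that] abs_Re_le_cmod[of z] abs_Im_le_cmod[of z]
    unfolding mem_box_cart forall_2 V a_def b_def vector_2 by auto
  obtain w where w: "w \<in> path_image (V \<circ> \<alpha>)" "w \<in> path_image (V \<circ> \<beta>)"
  proof (rule fashoda_interlace[of "V \<circ> \<alpha>" "V \<circ> \<beta>" a b])
    show "path (V \<circ> \<alpha>)" "path (V \<circ> \<beta>)" using assms(1,2) cV by (auto intro: path_continuous_image)
    show "path_image (V \<circ> \<alpha>) \<subseteq> cbox a b" "path_image (V \<circ> \<beta>) \<subseteq> cbox a b"
      using box by (auto simp: path_image_compose)
    show "pathstart (V \<circ> \<alpha>) $ 2 = a $ 2" "pathfinish (V \<circ> \<alpha>) $ 2 = a $ 2" "pathstart (V \<circ> \<beta>) $ 2 = a $ 2"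
      "pathfinish (V \<circ> \<beta>) $ 2 = a $ 2"
      using ends by (simp_all add: pathstart_compose pathfinish_compose V a_def)
    show "pathstart (V \<circ> \<alpha>) $ 1 < pathstart (V \<circ> \<beta>) $ 1" "pathstart (V \<circ> \<beta>) $ 1 < pathfinish (V \<circ> \<alpha>) $ 1"
      "pathfinish (V \<circ> \<alpha>) $ 1 < pathfinish (V \<circ> \<beta>) $ 1"
      using o by (simp_all add: pathstart_compose pathfinish_compose V)
  qed
  then obtain z z' where z: "z \<in> path_image \<alpha>" "w = V z" and z': "z' \<in> path_image \<beta>" "w = V z'"
    by (auto simp: path_image_compose)
  have "z = z'" using V z(2) z'(2) by (metis complex_eqI)
  then show ?thesis using z z' by blast
qed

text \<open>The Moebius map of the disc to the upper half plane with 1 sent to infinity; angles in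
  \<open>(0, 2 * pi)\<close> then run along the real line in increasing order.\<close>

definition cayley :: "complex \<Rightarrow> complex" where "cayley z = \<i> * (1 + z) / (1 - z)"

lemma Im_cayley: "Im (cayley z) = (1 - (cmod z)\<^sup>2) / (cmod (1 - z))\<^sup>2"
proof -
  have "cayley z = \<i> * (1 + z) * cnj (1 - z) / of_real ((cmod (1 - z))\<^sup>2)"
    unfolding cayley_def using complex_div_cnj[of "\<i> * (1 + z)" "1 - z"] by (simp only: of_real_power)
  then have "Im (cayley z) = Im (\<i> * (1 + z) * cnj (1 - z)) / (cmod (1 - z))\<^sup>2" by (simp only: Im_divide_of_real)
  also have "Im (\<i> * (1 + z) * cnj (1 - z)) = 1 - (cmod z)\<^sup>2"
    unfolding cmod_power2 by (simp add: power2_eq_square algebra_simps)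
  finally show ?thesis .
qed

lemma cayley_inj: "z \<noteq> 1 \<Longrightarrow> w \<noteq> 1 \<Longrightarrow> cayley z = cayley w \<Longrightarrow> z = w"
  unfolding cayley_def by (simp add: field_simps)

lemma cayley_cis:
  assumes "0 < \<theta>" "\<theta> < 2 * pi" shows "Re (cayley (cis \<theta>)) = - cot (\<theta> / 2)"
proof -
  define t where "t = \<theta> / 2"
  have s: "sin t > 0" using assms by (auto simp: t_def intro: sin_gt_zero)
  have c: "cis \<theta> = cis t * cis t" by (simp add: cis_mult t_def)
  have "1 + cis \<theta> = cis t * (cis (- t) + cis t)" "1 - cis \<theta> = cis t * (cis (- t) - cis t)"
    by (simp_all add: c distrib_left right_diff_distrib cis_mult)
  then have "cayley (cis \<theta>) = \<i> * (cis (- t) + cis t) / (cis (- t) - cis t)"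
    unfolding cayley_def by (simp add: mult.left_commute[of \<i>])
  also have "cis (- t) + cis t = of_real (2 * cos t)" by (simp add: complex_eq_iff)
  also have "cis (- t) - cis t = - \<i> * of_real (2 * sin t)" by (simp add: complex_eq_iff)
  finally have "cayley (cis \<theta>) = of_real (- (cos t / sin t))" using s by (simp add: field_simps)
  then show ?thesis by (simp only: Re_complex_of_real cot_def t_def)
qed

lemma cayley_cis_less:
  assumes "0 < \<theta>" "\<theta> < \<theta>'" "\<theta>' < 2 * pi"
  shows "Re (cayley (cis \<theta>)) < Re (cayley (cis \<theta>'))"
proof -
  define t t' where "t = \<theta> / 2" and "t' = \<theta>' / 2"
  have s: "sin t > 0" "sin t' > 0" "sin (t' - t) > 0" using assms by (auto simp: t_def t'_def intro!: sin_gt_zero)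
  then have "cot t' < cot t" by (simp add: cot_def field_simps sin_diff)
  then show ?thesis using cayley_cis assms by (simp add: t_def t'_def)
qed

text \<open>Rescaling by \<open>R\<close> and the Cayley map reduce this to the half plane. The
  point \<open>of_real R\<close> is excluded because it is sent to infinity.\<close>

lemma disc_paths_cross:
  fixes \<alpha> \<beta> :: "real \<Rightarrow> complex"
  assumes R: "0 < R" and p: "path \<alpha>" "path \<beta>"
    and im: "\<And>z. z \<in> path_image \<alpha> \<union> path_image \<beta> \<Longrightarrow> cmod z \<le> R \<and> z \<noteq> of_real R"
    and ends: "cmod (pathstart \<alpha>) = R" "cmod (pathfinish \<alpha>) = R" "cmod (pathstart \<beta>) = R" "cmod (pathfinish \<beta>) = R"
    and o: "Re (cayley (pathstart \<alpha> / of_real R)) < Re (cayley (pathstart \<beta> / of_real R))"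
      "Re (cayley (pathstart \<beta> / of_real R)) < Re (cayley (pathfinish \<alpha> / of_real R))"
      "Re (cayley (pathfinish \<alpha> / of_real R)) < Re (cayley (pathfinish \<beta> / of_real R))"
  shows "path_image \<alpha> \<inter> path_image \<beta> \<noteq> {}"
proof -
  define c where "c z = cayley (z / of_real R)" for z
  have ne: "z / of_real R \<noteq> 1" if "z \<in> path_image \<alpha> \<union> path_image \<beta>" for z
    using im[OF that] R by (auto simp: field_simps)
  have cont: "continuous_on (path_image \<alpha> \<union> path_image \<beta>) c"
    unfolding c_def cayley_def by (intro continuous_intros) (use R ne in auto)
  have "path_image (c \<circ> \<alpha>) \<inter> path_image (c \<circ> \<beta>) \<noteq> {}"
  proof (rule half_plane_paths_cross)
    show "path (c \<circ> \<alpha>)" by (rule path_continuous_image[OF p(1) continuous_on_subset[OF cont]]) simp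
    show "path (c \<circ> \<beta>)" by (rule path_continuous_image[OF p(2) continuous_on_subset[OF cont]]) simp
    show "0 \<le> Im w" if "w \<in> path_image (c \<circ> \<alpha>) \<union> path_image (c \<circ> \<beta>)" for w
    proof -
      have "w \<in> c ` (path_image \<alpha> \<union> path_image \<beta>)" using that by (simp only: path_image_compose image_Un)
      then obtain z where z: "w = c z" "z \<in> path_image \<alpha> \<union> path_image \<beta>" by (rule imageE)
      have "cmod (z / of_real R) \<le> 1" using im[OF z(2)] R by (simp add: norm_divide)
      then show ?thesis unfolding z(1) c_def Im_cayley by (simp add: power_le_one)
    qed
    show "Im (pathstart (c \<circ> \<alpha>)) = 0" "Im (pathfinish (c \<circ> \<alpha>)) = 0" "Im (pathstart (c \<circ> \<beta>)) = 0" "Im (pathfinish (c \<circ> \<beta>)) = 0"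
      using ends R by (simp_all add: pathstart_compose pathfinish_compose c_def Im_cayley norm_divide)
  qed (use o in \<open>simp_all add: pathstart_compose pathfinish_compose c_def\<close>)
  then obtain z w where zw: "z \<in> path_image \<alpha>" "w \<in> path_image \<beta>" "c z = c w" by (auto simp: path_image_compose)
  then have "z / of_real R = w / of_real R" using cayley_inj ne unfolding c_def by blast
  then have "z = w" using R by simp
  then show ?thesis using zw by blast
qed

lemma cayley_near:
  assumes \<theta>: "0 < \<theta>" "\<theta> < 2 * pi" and lo: "lo < Re (cayley (cis \<theta>))" and hi: "Re (cayley (cis \<theta>)) < hi"
  obtains \<delta> where "0 < \<delta>" "\<And>z. dist z (cis \<theta>) < \<delta> \<Longrightarrow> z \<noteq> 1 \<and> lo < Re (cayley z) \<and> Re (cayley z) < hi"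
proof -
  have ne: "cis \<theta> \<noteq> 1"
  proof
    assume "cis \<theta> = 1"
    then have "cos \<theta> = 1" by (simp add: complex_eq_iff)
    then obtain n :: int where "\<theta> = of_int n * 2 * pi" using cos_one_2pi_int by blast
    moreover from this have "0 < n" using \<theta>(1) by (simp add: zero_less_mult_iff)
    ultimately have "1 * (2 * pi) \<le> \<theta>" using mult_right_mono[of 1 "real_of_int n" "2 * pi"] by simp
    then show False using \<theta> by simp
  qed
  have t: "((\<lambda>z. Re (cayley z)) \<longlongrightarrow> Re (cayley (cis \<theta>))) (nhds (cis \<theta>))"
    unfolding cayley_def by (intro tendsto_intros filterlim_ident) (use ne in simp)
  have "eventually (\<lambda>z. z \<noteq> 1) (nhds (cis \<theta>))" using t1_space_nhds[OF ne] .
  then have "eventually (\<lambda>z. z \<noteq> 1 \<and> lo < Re (cayley z) \<and> Re (cayley z) < hi) (nhds (cis \<theta>))"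
    using order_tendstoD(1)[OF t lo] order_tendstoD(2)[OF t hi] by eventually_elim simp
  then show thesis using that unfolding eventually_nhds_metric by blast
qed

section \<open>Crosscuts in preimages of half discs\<close>

context harmonic_disk
begin

text \<open>It is the image of a convex half disc under the continuous inverse of \<open>hp\<close>;
  injectivity of the harmonic map enters the crossing argument here.\<close>

lemma half_disc_preimage_path_connected:
  "path_connected {z \<in> ball 0 1. 0 < s * Re (cis (- x) * hp z)}"
proof -
  obtain k where k: "continuous_on (ball 0 1) k" "k ` ball 0 1 = ball 0 1" "\<And>z. z \<in> ball 0 1 \<Longrightarrow> k (hp z) = z"
    "\<And>w. w \<in> ball 0 1 \<Longrightarrow> hp (k w) = w" using hp_inverse by blast
  let ?H = "ball 0 1 \<inter> {w. 0 < s * Re (cis (- x) * w)}"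
  have "{w. 0 < s * Re (cis (- x) * w)} = (\<lambda>w. s * Re (cis (- x) * w)) -` {0<..}" by auto
  moreover have "linear (\<lambda>w. s * Re (cis (- x) * w))"
    by (rule linearI) (auto simp: algebra_simps)
  ultimately have "convex {w. 0 < s * Re (cis (- x) * w)}"
    using convex_linear_vimage[of "\<lambda>w. s * Re (cis (- x) * w)" "{0<..}"] by simp
  then have "path_connected ?H" by (intro convex_imp_path_connected convex_Int convex_ball)
  then have "path_connected (k ` ?H)"
    by (intro path_connected_continuous_image continuous_on_subset[OF k(1)]) auto
  also have "k ` ?H = {z \<in> ball 0 1. 0 < s * Re (cis (- x) * hp z)}"
  proof (intro equalityI subsetI)
    fix z assume "z \<in> k ` ?H"
    then obtain w where w: "w \<in> ?H" "z = k w" by blast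
    then have "z \<in> ball 0 1" using k(2) by blast
    then show "z \<in> {z \<in> ball 0 1. 0 < s * Re (cis (- x) * hp z)}" using w k(4)[of w] by simp
  next
    fix z assume z: "z \<in> {z \<in> ball 0 1. 0 < s * Re (cis (- x) * hp z)}"
    then have "hp z \<in> ?H" using hp_bound[of z] by simp
    moreover have "z = k (hp z)" using k(3)[of z] z by simp
    ultimately show "z \<in> k ` ?H" by blast
  qed
  finally show ?thesis .
qed

end

context harmonic_boundary
begin

definition radial :: "real \<Rightarrow> bool" where
  "radial \<theta> \<longleftrightarrow> (\<lambda>i. hp (of_real (radius (r i)) * cis \<theta>)) \<longlonglongrightarrow> F \<theta>"

definition height :: "real \<Rightarrow> real \<Rightarrow> complex \<Rightarrow> real" where
  "height s x z = s * Re (cis (- x) * hp z)"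

text \<open>Under the real part \<open>cnj (g z)\<close> may be replaced by \<open>g z\<close> once
  its factor is conjugated. This supplies the holomorphic function that the maximum principle
  requires.\<close>

definition height_holo :: "real \<Rightarrow> real \<Rightarrow> complex \<Rightarrow> complex" where
  "height_holo s x z = of_real s * (cis (- x) * h z + cis x * g z)"

lemma Re_height_holo: "Re (height_holo s x z) = height s x z"
  by (simp add: height_holo_def height_def hp_def algebra_simps)

lemma height_le:
  assumes "s \<in> {1, - 1}" "cmod z < 1" shows "height s x z \<le> 1"
proof -
  have "\<bar>Re (cis (- x) * hp z)\<bar> \<le> 1"
    using abs_Re_le_cmod[of "cis (- x) * hp z"] hp_bound[OF assms(2)] by (simp add: norm_mult)
  then show ?thesis using assms(1) unfolding height_def by auto
qed

text \<open>The starting point \<open>p\<close> is fixed before \<open>R\<close>: two such points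
  are later joined once, and \<open>R\<close> is then taken beyond the joining path.\<close>

lemma height_reaches_boundary:
  assumes s: "s \<in> {1, - 1}" and rad: "radial \<theta>" and side: "side x \<theta> = s" and \<epsilon>: "0 < \<epsilon>"
  obtains p where "cmod p < 1" "0 < height s x p"
    "\<And>R. cmod p < R \<Longrightarrow> R < 1 \<Longrightarrow> \<exists>\<gamma>. path \<gamma> \<and> pathstart \<gamma> = p \<and> path_image \<gamma> \<subseteq> cball 0 R \<inter> {z. 0 < height s x z}
      \<and> cmod (pathfinish \<gamma>) = R \<and> dist (pathfinish \<gamma>) (cis \<theta>) < \<epsilon> \<and> path_image \<gamma> - {pathfinish \<gamma>} \<subseteq> ball 0 R"
proof -
  define L where "L = s * Re (cis (- x) * F \<theta>)"
  have L: "0 < L" using side s unfolding side_def L_def by (auto simp: sgn_if split: if_splits)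
  let ?p = "\<lambda>i. of_real (radius (r i)) * cis \<theta>"
  have "(\<lambda>i. height s x (?p i)) \<longlonglongrightarrow> L"
    unfolding height_def L_def using rad unfolding radial_def by (intro tendsto_intros)
  then have e1: "eventually (\<lambda>i. L / 2 < height s x (?p i)) sequentially" using L by (intro order_tendstoD) auto
  have "(\<lambda>i. 2 / \<epsilon>\<^sup>2 * (1 - radius (r i))) \<longlonglongrightarrow> 2 / \<epsilon>\<^sup>2 * (1 - 1)" by (intro tendsto_intros radius_subseq)
  then have e2: "eventually (\<lambda>i. 2 / \<epsilon>\<^sup>2 * (1 - radius (r i)) < L / 2) sequentially" using L by (intro order_tendstoD) auto
  have e3: "eventually (\<lambda>i. 1 - \<epsilon> < radius (r i)) sequentially" using \<epsilon> by (intro order_tendstoD(1)[OF radius_subseq]) auto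
  \<comment> \<open>On the radius at \<theta> the height tends to \<open>L\<close> while the barrier
    tends to 0; the threshold \<open>L / 2\<close> separates them.\<close>
  obtain i where i: "L / 2 < height s x (?p i)" "2 / \<epsilon>\<^sup>2 * (1 - radius (r i)) < L / 2" "1 - \<epsilon> < radius (r i)"
    using eventually_happens[OF eventually_conj[OF e1 eventually_conj[OF e2 e3]]] by auto
  define p where "p = ?p i"
  have cp: "cmod p = radius (r i)" using radius[of "r i"] by (simp add: p_def norm_mult)
  have p1: "cmod p < 1" using cp radius by simp
  have "dist p (cis \<theta>) = cmod (of_real (radius (r i) - 1) * cis \<theta>)" by (simp add: p_def dist_norm algebra_simps)
  also have "\<dots> = 1 - radius (r i)" using radius[of "r i"] by (simp only: norm_mult norm_of_real norm_cis) simp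
  finally have d: "dist p (cis \<theta>) < \<epsilon>" using i by simp
  have cp': "cnj (cis \<theta>) * p = of_real (radius (r i))"
    unfolding p_def cis_cnj by (simp add: mult.left_commute[of "cis (- \<theta>)"] cis_mult)
  have big: "2 / \<epsilon>\<^sup>2 * (1 - Re (cnj (cis \<theta>) * p)) < Re (height_holo s x p)"
    unfolding Re_height_holo cp' Re_complex_of_real using order.strict_trans[OF i(2,1)] unfolding p_def .
  have hk: "height_holo s x holomorphic_on ball 0 1" unfolding height_holo_def[abs_def] by (intro holomorphic_intros h g)
  show thesis
  proof (rule that[OF p1])
    show "0 < height s x p" using i L by (simp add: p_def)
    fix R assume R: "cmod p < R" "R < 1"
    obtain \<gamma> where \<gamma>: "path \<gamma>" "pathstart \<gamma> = p" "path_image \<gamma> \<subseteq> ball 0 1 \<inter> ball (cis \<theta>) \<epsilon> \<inter> {z. 0 < height s x z}"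
      "R < cmod (pathfinish \<gamma>)"
      using positivity_reaches_boundary[OF hk _ norm_cis \<epsilon> p1 d big R(2)] height_le[OF s] unfolding Re_height_holo by blast
    \<comment> \<open>The path is cut at its first exit from the disc of radius \<open>R\<close>, so
      that it meets the circle only at its end.\<close>
    have "pathstart \<gamma> \<in> closure (ball 0 R)" using \<gamma>(2) R closure_subset[of "ball 0 R"] by auto
    moreover have "pathfinish \<gamma> \<notin> ball 0 R" using \<gamma>(4) by simp
    ultimately obtain \<eta> where \<eta>: "path \<eta>" "pathstart \<eta> = pathstart \<gamma>" "path_image \<eta> \<subseteq> path_image \<gamma>"
      "path_image \<eta> - {pathfinish \<eta>} \<subseteq> interior (ball 0 R)" "pathfinish \<eta> \<in> frontier (ball 0 R)"
      using exists_path_subpath_to_frontier[OF \<gamma>(1)] by blast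
    have R0: "0 < R" using R(1) norm_ge_zero[of p] by linarith
    have f: "cmod (pathfinish \<eta>) = R" using \<eta>(5) R0 by (simp add: frontier_ball)
    have b: "path_image \<eta> - {pathfinish \<eta>} \<subseteq> ball 0 R" using \<eta>(4) by simp
    have "path_image \<eta> \<subseteq> cball 0 R"
    proof
      fix z assume "z \<in> path_image \<eta>"
      then show "z \<in> cball 0 R" using b f by (cases "z = pathfinish \<eta>") auto
    qed
    moreover have "dist (pathfinish \<eta>) (cis \<theta>) < \<epsilon>"
      using \<gamma>(3) \<eta>(3) pathfinish_in_path_image[of \<eta>] by (auto simp: dist_commute)
    ultimately show "\<exists>\<gamma>. path \<gamma> \<and> pathstart \<gamma> = p \<and> path_image \<gamma> \<subseteq> cball 0 R \<inter> {z. 0 < height s x z}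
      \<and> cmod (pathfinish \<gamma>) = R \<and> dist (pathfinish \<gamma>) (cis \<theta>) < \<epsilon> \<and> path_image \<gamma> - {pathfinish \<gamma>} \<subseteq> ball 0 R"
      using \<eta> \<gamma> f b by (intro exI[of _ \<eta>]) auto
  qed
qed

text \<open>Two boundary paths joined through the connected half-disc preimage give a crosscut of
  the disc of radius \<open>R\<close> on which the height stays positive.\<close>

lemma height_crosscut:
  assumes s: "s \<in> {1, - 1}" and \<theta>: "radial \<theta>" "side x \<theta> = s" and \<theta>': "radial \<theta>'" "side x \<theta>' = s" and \<epsilon>: "0 < \<epsilon>"
  obtains R0 where "R0 < 1" "\<And>R. R0 < R \<Longrightarrow> R < 1 \<Longrightarrow> \<exists>\<alpha>. path \<alpha> \<and> path_image \<alpha> \<subseteq> cball 0 R \<inter> {z. 0 < height s x z}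
      \<and> cmod (pathstart \<alpha>) = R \<and> cmod (pathfinish \<alpha>) = R \<and> dist (pathstart \<alpha>) (cis \<theta>) < \<epsilon>
      \<and> dist (pathfinish \<alpha>) (cis \<theta>') < \<epsilon> \<and> path_image \<alpha> - {pathstart \<alpha>, pathfinish \<alpha>} \<subseteq> ball 0 R"
proof -
  obtain p where p: "cmod p < 1" "0 < height s x p"
    "\<And>R. cmod p < R \<Longrightarrow> R < 1 \<Longrightarrow> \<exists>\<gamma>. path \<gamma> \<and> pathstart \<gamma> = p \<and> path_image \<gamma> \<subseteq> cball 0 R \<inter> {z. 0 < height s x z}
      \<and> cmod (pathfinish \<gamma>) = R \<and> dist (pathfinish \<gamma>) (cis \<theta>) < \<epsilon> \<and> path_image \<gamma> - {pathfinish \<gamma>} \<subseteq> ball 0 R"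
    using height_reaches_boundary[OF s \<theta> \<epsilon>] by blast
  obtain p' where p': "cmod p' < 1" "0 < height s x p'"
    "\<And>R. cmod p' < R \<Longrightarrow> R < 1 \<Longrightarrow> \<exists>\<gamma>. path \<gamma> \<and> pathstart \<gamma> = p' \<and> path_image \<gamma> \<subseteq> cball 0 R \<inter> {z. 0 < height s x z}
      \<and> cmod (pathfinish \<gamma>) = R \<and> dist (pathfinish \<gamma>) (cis \<theta>') < \<epsilon> \<and> path_image \<gamma> - {pathfinish \<gamma>} \<subseteq> ball 0 R"
    using height_reaches_boundary[OF s \<theta>' \<epsilon>] by blast
  have pc: "path_connected {z \<in> ball 0 1. 0 < height s x z}"
    using half_disc_preimage_path_connected unfolding height_def by blast
  have "p \<in> {z \<in> ball 0 1. 0 < height s x z}" "p' \<in> {z \<in> ball 0 1. 0 < height s x z}" using p p' by auto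
  then obtain c where c: "path c" "path_image c \<subseteq> {z \<in> ball 0 1. 0 < height s x z}" "pathstart c = p" "pathfinish c = p'"
    using pc unfolding path_connected_def by blast
  obtain m where m: "m \<in> path_image c" "\<And>z. z \<in> path_image c \<Longrightarrow> cmod z \<le> cmod m"
    using continuous_attains_sup[OF compact_path_image[OF c(1)] path_image_nonempty continuous_on_norm_id] by blast
  show thesis
  proof (rule that[of "cmod m"])
    show "cmod m < 1" using m(1) c(2) by auto
    fix R assume R: "cmod m < R" "R < 1"
    have "p \<in> path_image c" "p' \<in> path_image c" using c by auto
    then have "cmod p < R" "cmod p' < R" using m(2) R by fastforce+
    then obtain \<gamma> \<gamma>' where \<gamma>: "path \<gamma>" "pathstart \<gamma> = p" "path_image \<gamma> \<subseteq> cball 0 R \<inter> {z. 0 < height s x z}"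
      "cmod (pathfinish \<gamma>) = R" "dist (pathfinish \<gamma>) (cis \<theta>) < \<epsilon>" "path_image \<gamma> - {pathfinish \<gamma>} \<subseteq> ball 0 R"
      and \<gamma>': "path \<gamma>'" "pathstart \<gamma>' = p'" "path_image \<gamma>' \<subseteq> cball 0 R \<inter> {z. 0 < height s x z}"
      "cmod (pathfinish \<gamma>') = R" "dist (pathfinish \<gamma>') (cis \<theta>') < \<epsilon>" "path_image \<gamma>' - {pathfinish \<gamma>'} \<subseteq> ball 0 R"
      using p(3)[OF _ R(2)] p'(3)[OF _ R(2)] by blast
    have cb: "path_image c \<subseteq> ball 0 R" using order.strict_trans1[OF m(2) R(1)] by (auto simp: subset_iff)
    define \<alpha> where "\<alpha> = reversepath \<gamma> +++ (c +++ \<gamma>')"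
    have im: "path_image \<alpha> = path_image \<gamma> \<union> (path_image c \<union> path_image \<gamma>')"
      using \<gamma> \<gamma>' c by (simp add: \<alpha>_def path_image_join)
    have \<alpha>: "path \<alpha>" "pathstart \<alpha> = pathfinish \<gamma>" "pathfinish \<alpha> = pathfinish \<gamma>'"
      using \<gamma> \<gamma>' c by (auto simp: \<alpha>_def)
    have "path_image \<alpha> \<subseteq> cball 0 R \<inter> {z. 0 < height s x z}"
      unfolding im using \<gamma>(3) \<gamma>'(3) c(2) cb ball_subset_cball[of 0 R] by blast
    moreover have "path_image \<alpha> - {pathstart \<alpha>, pathfinish \<alpha>} \<subseteq> ball 0 R"
      unfolding im \<alpha> using \<gamma>(6) \<gamma>'(6) cb by blast
    ultimately show "\<exists>\<alpha>. path \<alpha> \<and> path_image \<alpha> \<subseteq> cball 0 R \<inter> {z. 0 < height s x z}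
      \<and> cmod (pathstart \<alpha>) = R \<and> cmod (pathfinish \<alpha>) = R \<and> dist (pathstart \<alpha>) (cis \<theta>) < \<epsilon>
      \<and> dist (pathfinish \<alpha>) (cis \<theta>') < \<epsilon> \<and> path_image \<alpha> - {pathstart \<alpha>, pathfinish \<alpha>} \<subseteq> ball 0 R"
      using \<gamma>(4,5) \<gamma>'(4,5) \<alpha> by (intro exI[of _ \<alpha>]) simp
  qed
qed

text \<open>One crosscut joins \<theta>1 to \<theta>3 where the height is positive, the other
  \<theta>2 to \<theta>4 where it is negative. Interlaced ends force a common point, which is
  absurd.\<close>

lemma no_alternation:
  assumes s: "s \<in> {1, - 1}"
    and o: "0 < \<theta>1" "\<theta>1 < \<theta>2" "\<theta>2 < \<theta>3" "\<theta>3 < \<theta>4" "\<theta>4 < 2 * pi"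
    and rad: "radial \<theta>1" "radial \<theta>2" "radial \<theta>3" "radial \<theta>4"
    and side: "side x \<theta>1 = s" "side x \<theta>2 = - s" "side x \<theta>3 = s" "side x \<theta>4 = - s"
  shows False
proof -
  let ?k = "\<lambda>\<theta>. Re (cayley (cis \<theta>))"
  have lt: "?k \<theta>1 < ?k \<theta>2" "?k \<theta>2 < ?k \<theta>3" "?k \<theta>3 < ?k \<theta>4"
    using o by (auto intro!: cayley_cis_less)
  \<comment> \<open>Separating values on the real line: endpoints close enough to the four boundary
    points keep their order after the Cayley map.\<close>
  obtain c1 where c1: "?k \<theta>1 < c1" "c1 < ?k \<theta>2" using dense[OF lt(1)] by blast
  obtain c2 where c2: "?k \<theta>2 < c2" "c2 < ?k \<theta>3" using dense[OF lt(2)] by blast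
  obtain c3 where c3: "?k \<theta>3 < c3" "c3 < ?k \<theta>4" using dense[OF lt(3)] by blast
  obtain d1 where d1: "0 < d1" "\<And>z. dist z (cis \<theta>1) < d1 \<Longrightarrow> z \<noteq> 1 \<and> ?k \<theta>1 - 1 < Re (cayley z) \<and> Re (cayley z) < c1"
    by (rule cayley_near[of \<theta>1 "?k \<theta>1 - 1" c1]) (use o c1 in auto)
  obtain d2 where d2: "0 < d2" "\<And>z. dist z (cis \<theta>2) < d2 \<Longrightarrow> z \<noteq> 1 \<and> c1 < Re (cayley z) \<and> Re (cayley z) < c2"
    by (rule cayley_near[of \<theta>2 c1 c2]) (use o c1 c2 in auto)
  obtain d3 where d3: "0 < d3" "\<And>z. dist z (cis \<theta>3) < d3 \<Longrightarrow> z \<noteq> 1 \<and> c2 < Re (cayley z) \<and> Re (cayley z) < c3"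
    by (rule cayley_near[of \<theta>3 c2 c3]) (use o c2 c3 in auto)
  obtain d4 where d4: "0 < d4" "\<And>z. dist z (cis \<theta>4) < d4 \<Longrightarrow> z \<noteq> 1 \<and> c3 < Re (cayley z) \<and> Re (cayley z) < ?k \<theta>4 + 1"
    by (rule cayley_near[of \<theta>4 c3 "?k \<theta>4 + 1"]) (use o c3 in auto)
  define d where "d = min (min d1 d2) (min d3 d4)"
  have d: "0 < d" "d \<le> d1" "d \<le> d2" "d \<le> d3" "d \<le> d4" using d1(1) d2(1) d3(1) d4(1) by (auto simp: d_def)
  have e: "0 < d / 2" using d by simp
  have s': "- s \<in> {1, - 1}" using s by auto
  obtain R1 where R1: "R1 < 1" "\<And>R. R1 < R \<Longrightarrow> R < 1 \<Longrightarrow> \<exists>\<alpha>. path \<alpha> \<and> path_image \<alpha> \<subseteq> cball 0 R \<inter> {z. 0 < height s x z}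
      \<and> cmod (pathstart \<alpha>) = R \<and> cmod (pathfinish \<alpha>) = R \<and> dist (pathstart \<alpha>) (cis \<theta>1) < d / 2
      \<and> dist (pathfinish \<alpha>) (cis \<theta>3) < d / 2 \<and> path_image \<alpha> - {pathstart \<alpha>, pathfinish \<alpha>} \<subseteq> ball 0 R"
    using height_crosscut[OF s rad(1) side(1) rad(3) side(3) e] by blast
  obtain R2 where R2: "R2 < 1" "\<And>R. R2 < R \<Longrightarrow> R < 1 \<Longrightarrow> \<exists>\<alpha>. path \<alpha> \<and> path_image \<alpha> \<subseteq> cball 0 R \<inter> {z. 0 < height (- s) x z}
      \<and> cmod (pathstart \<alpha>) = R \<and> cmod (pathfinish \<alpha>) = R \<and> dist (pathstart \<alpha>) (cis \<theta>2) < d / 2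
      \<and> dist (pathfinish \<alpha>) (cis \<theta>4) < d / 2 \<and> path_image \<alpha> - {pathstart \<alpha>, pathfinish \<alpha>} \<subseteq> ball 0 R"
    using height_crosscut[OF s' rad(2) side(2) rad(4) side(4) e] by blast
  have "max (max R1 R2) (max 0 (1 - d / 2)) < 1" using R1 R2 d by auto
  then obtain R where R: "max (max R1 R2) (max 0 (1 - d / 2)) < R" "R < 1" using dense by blast
  then have RR: "R1 < R" "R2 < R" "0 < R" "1 - d / 2 < R" by auto
  obtain \<alpha> where \<alpha>: "path \<alpha>" "path_image \<alpha> \<subseteq> cball 0 R \<inter> {z. 0 < height s x z}"
      "cmod (pathstart \<alpha>) = R" "cmod (pathfinish \<alpha>) = R" "dist (pathstart \<alpha>) (cis \<theta>1) < d / 2"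
      "dist (pathfinish \<alpha>) (cis \<theta>3) < d / 2" "path_image \<alpha> - {pathstart \<alpha>, pathfinish \<alpha>} \<subseteq> ball 0 R"
    using R1(2)[OF RR(1) R(2)] by blast
  obtain \<beta> where \<beta>: "path \<beta>" "path_image \<beta> \<subseteq> cball 0 R \<inter> {z. 0 < height (- s) x z}"
      "cmod (pathstart \<beta>) = R" "cmod (pathfinish \<beta>) = R" "dist (pathstart \<beta>) (cis \<theta>2) < d / 2"
      "dist (pathfinish \<beta>) (cis \<theta>4) < d / 2" "path_image \<beta> - {pathstart \<beta>, pathfinish \<beta>} \<subseteq> ball 0 R"
    using R2(2)[OF RR(2) R(2)] by blast
  \<comment> \<open>Rescaling an endpoint to the unit circle moves it by \<open>1 - R\<close>, which
    is less than \<open>d / 2\<close>.\<close>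
  have near: "dist (q / of_real R) \<zeta> < d" if "cmod q = R" "dist q \<zeta> < d / 2" for q \<zeta>
  proof -
    have "dist (q / of_real R) q = cmod (q / of_real R * of_real (1 - R))"
      using RR by (simp add: dist_norm right_diff_distrib)
    also have "\<dots> = 1 - R" using that RR R(2) by (simp only: norm_mult norm_divide norm_of_real) simp
    finally show ?thesis using dist_triangle[of "q / of_real R" \<zeta> q] that RR by linarith
  qed
  note n1 = d1(2)[OF order.strict_trans2[OF near[OF \<alpha>(3,5)] d(2)]]
  note n2 = d2(2)[OF order.strict_trans2[OF near[OF \<beta>(3,5)] d(3)]]
  note n3 = d3(2)[OF order.strict_trans2[OF near[OF \<alpha>(4,6)] d(4)]]
  note n4 = d4(2)[OF order.strict_trans2[OF near[OF \<beta>(4,6)] d(5)]]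
  have "path_image \<alpha> \<inter> path_image \<beta> \<noteq> {}"
  proof (rule disc_paths_cross[OF RR(3) \<alpha>(1) \<beta>(1)])
    fix z assume z: "z \<in> path_image \<alpha> \<union> path_image \<beta>"
    have "cmod z \<le> R" using z \<alpha>(2) \<beta>(2) by auto
    \<comment> \<open>Only endpoints lie on the circle of radius \<open>R\<close>, and after
      rescaling they are close to the four boundary points and hence different from 1.\<close>
    moreover have "z \<noteq> of_real R"
    proof
      assume zR: "z = of_real R"
      have "z \<notin> ball 0 R" using zR RR by simp
      then have "z \<in> {pathstart \<alpha>, pathfinish \<alpha>, pathstart \<beta>, pathfinish \<beta>}" using z \<alpha>(7) \<beta>(7) by blast
      then have "z / of_real R \<noteq> 1" using n1 n2 n3 n4 by auto
      then show False using zR RR by simp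
    qed
    ultimately show "cmod z \<le> R \<and> z \<noteq> of_real R" by blast
  qed (use \<alpha> \<beta> n1 n2 n3 n4 in auto)
  then obtain z where "0 < height s x z" "0 < height (- s) x z" using \<alpha>(2) \<beta>(2) by blast
  then show False by (simp add: height_def)
qed

lemma side_arcs:
  assumes nz: "AE \<theta> in circ. side x \<theta> \<noteq> 0"
  shows "\<exists>a b \<sigma>. 0 \<le> a \<and> a \<le> b \<and> b \<le> 2 * pi \<and> (\<sigma> = 1 \<or> \<sigma> = - 1) \<and>
        (AE \<theta> in circ. side x \<theta> = \<sigma> * interval_sign a b \<theta>)"
proof -
  define G where "G = {\<theta>. 0 < \<theta> \<and> \<theta> < 2 * pi \<and> radial \<theta> \<and> side x \<theta> \<noteq> 0}"
  have aeG: "AE \<theta> in circ. \<theta> \<in> G"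
  proof -
    have "AE \<theta> in circ. 0 < \<theta> \<and> \<theta> < 2 * pi"
      unfolding AE_circ using AE_lborel_singleton[of 0] AE_lborel_singleton[of "2 * pi"]
      by eventually_elim auto
    then show ?thesis using radial_limit nz by eventually_elim (simp add: G_def radial_def)
  qed
  have val: "side x \<theta> = 1 \<or> side x \<theta> = - 1" if "\<theta> \<in> G" for \<theta>
    using that by (auto simp: G_def side_def sgn_if split: if_splits)
  \<comment> \<open>Order-convexity of the set with sign \<sigma>, relative to the good angles
    \<open>G\<close>.\<close>
  define conv where "conv \<sigma> \<longleftrightarrow> (\<forall>p\<in>G. \<forall>m\<in>G. \<forall>q\<in>G. p < m \<longrightarrow> m < q \<longrightarrow> side x p = \<sigma> \<longrightarrow> side x q = \<sigma> \<longrightarrow> side x m = \<sigma>)" for \<sigma>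
  have "conv 1 \<or> conv (- 1)"
  proof (rule ccontr)
    assume "\<not> ?thesis"
    then obtain p m q p' m' q' where
      1: "p \<in> G" "m \<in> G" "q \<in> G" "p < m" "m < q" "side x p = 1" "side x q = 1" "side x m \<noteq> 1" and
      2: "p' \<in> G" "m' \<in> G" "q' \<in> G" "p' < m'" "m' < q'" "side x p' = - 1" "side x q' = - 1" "side x m' \<noteq> - 1"
      unfolding conv_def by blast
    have v: "side x m = - 1" "side x m' = 1" using val[OF 1(2)] val[OF 2(2)] 1 2 by auto
    show False
    \<comment> \<open>If neither sign class is convex, the earlier of \<open>p\<close> and
      \<open>p'\<close>, followed by the other triple, is an alternating quadruple.\<close>
    proof (cases "p' < p")
      case True
      show False
        by (rule no_alternation[of "- 1" p' p m q x]) (use True 1 2 v in \<open>auto simp: G_def\<close>)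
    next
      case False
      have "p \<noteq> p'" using 1 2 by auto
      then have "p < p'" using False by simp
      show False
        by (rule no_alternation[of 1 p p' m' q' x]) (use \<open>p < p'\<close> 1 2 v in \<open>auto simp: G_def\<close>)
    qed
  qed
  then obtain \<sigma> where \<sigma>: "\<sigma> = 1 \<or> \<sigma> = - 1" "conv \<sigma>" by blast
  define Z where "Z = {\<theta>\<in>G. side x \<theta> = \<sigma>}"
  have other: "side x \<theta> = - \<sigma>" if "\<theta> \<in> G" "\<theta> \<notin> Z" for \<theta> using val[OF that(1)] that \<sigma> by (auto simp: Z_def)
  show ?thesis
  proof (cases "Z = {}")
    case True
    have "AE \<theta> in circ. side x \<theta> = \<sigma> * interval_sign 0 0 \<theta>"
      using aeG by eventually_elim (use other True in \<open>auto simp: interval_sign_def\<close>)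
    then show ?thesis using \<sigma>(1) by (intro exI[of _ 0] exI[of _ \<sigma>]) auto
  next
    case False
    define a b where "a = Inf Z" and "b = Sup Z"
    have Zb: "\<And>\<theta>. \<theta> \<in> Z \<Longrightarrow> 0 < \<theta> \<and> \<theta> < 2 * pi" by (auto simp: Z_def G_def)
    have bb: "bdd_below Z" "bdd_above Z" using Zb by (auto intro!: bdd_belowI[of _ 0] bdd_aboveI[of _ "2 * pi"] simp: less_imp_le)
    have a: "0 \<le> a" "b \<le> 2 * pi" unfolding a_def b_def
      using False Zb by (auto intro!: cInf_greatest cSup_least simp: less_imp_le)
    have mem: "a \<le> \<theta> \<and> \<theta> \<le> b" if "\<theta> \<in> Z" for \<theta>
      unfolding a_def b_def using that bb by (auto intro: cInf_lower cSup_upper)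
    have ab: "a \<le> b" using False mem by fastforce
    have "AE \<theta> in circ. \<theta> \<noteq> a \<and> \<theta> \<noteq> b"
      unfolding AE_circ using AE_lborel_singleton[of a] AE_lborel_singleton[of b] by eventually_elim auto
    with aeG have "AE \<theta> in circ. side x \<theta> = \<sigma> * interval_sign a b \<theta>"
    proof eventually_elim
      case (elim \<theta>)
      show ?case
      proof (cases "\<theta> \<in> Z")
        case True
        then have "a < \<theta> \<and> \<theta> < b" using mem[OF True] elim by auto
        then show ?thesis using True by (auto simp: interval_sign_def Z_def)
      next
        case nZ: False
        have "\<not> (a < \<theta> \<and> \<theta> < b)"
        proof
          assume o: "a < \<theta> \<and> \<theta> < b"
          obtain p where p: "p \<in> Z" "p < \<theta>" using o cInf_less_iff[OF False bb(1)] unfolding a_def by blast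
          obtain q where q: "q \<in> Z" "\<theta> < q" using o less_cSup_iff[OF False bb(2)] unfolding b_def by blast
          have "side x \<theta> = \<sigma>" using \<sigma>(2) p q elim unfolding conv_def Z_def by blast
          then show False using nZ elim by (simp add: Z_def)
        qed
        then show ?thesis using other[of \<theta>] nZ elim by (auto simp: interval_sign_def)
      qed
    qed
    then show ?thesis using a ab \<sigma>(1) by blast
  qed
qed

end


section \<open>The area of the image of a disc\<close>

text \<open>Along the rotated small circle \<open>p + \<rho> * exp (2 * pi * \<i> * t)\<close> the differential is dominated by its
  complex linear part, which traces a circle around \<open>0\<close> starting on the positive real axis.\<close>
lemma local_degree:
  fixes f h g :: "complex \<Rightarrow> complex"
  assumes f: "\<And>z. z \<in> ball 0 1 \<Longrightarrow> f z = h z + cnj (g z)"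
    and h: "(h has_field_derivative h') (at p)" and g: "(g has_field_derivative g') (at p)"
    and p: "cmod p < 1" and dom: "cmod g' < cmod h'"
  obtains d where "0 < d" "\<And>\<epsilon>. 0 < \<epsilon> \<Longrightarrow> \<epsilon> < d \<Longrightarrow> \<exists>\<rho>. cmod \<rho> = \<epsilon> \<and> (continuous_on (ball 0 1) f \<longrightarrow>
      homotopic_loops (- {0}) (circlepath 0 (\<epsilon> * cmod h'))
      (\<lambda>t. f (p + \<rho> * exp (2 * of_real pi * \<i> * of_real t)) - f p))"
proof -
  define D where "D \<zeta> = h' * \<zeta> + cnj (g' * \<zeta>)" for \<zeta>
  have der: "((\<lambda>z. h z + cnj (g z)) has_derivative D) (at p)"
    using h g unfolding has_field_derivative_def D_def[abs_def] by (intro has_derivative_add has_derivative_cnj)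
  \<comment> \<open>Half of the margin by which the complex linear part dominates, so that the
    remainder and the antilinear part together stay below it.\<close>
  define e where "e = (cmod h' - cmod g') / 2"
  have e: "0 < e" "cmod g' + e < cmod h'" using dom by (auto simp: e_def field_simps)
  obtain d1 where d1: "0 < d1" "\<And>y. norm (y - p) < d1 \<Longrightarrow>
      norm ((h y + cnj (g y)) - (h p + cnj (g p)) - D (y - p)) \<le> e * norm (y - p)"
    using der e(1) unfolding has_derivative_at_alt by blast
  define d where "d = min d1 (1 - cmod p)"
  have d: "0 < d" "d \<le> d1" "d \<le> 1 - cmod p" using d1 p by (auto simp: d_def)
  show thesis
  proof (rule that[OF d(1)])
    fix \<epsilon> :: real assume \<epsilon>: "0 < \<epsilon>" "\<epsilon> < d"
    have h0: "h' \<noteq> 0" using dom by auto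
    define \<rho> where "\<rho> = of_real (\<epsilon> * cmod h') / h'"
    have \<rho>: "cmod \<rho> = \<epsilon>" "h' * \<rho> = of_real (\<epsilon> * cmod h')" using h0 \<epsilon> by (auto simp: \<rho>_def norm_divide norm_mult)
    let ?E = "\<lambda>t. exp (2 * of_real pi * \<i> * of_real t)"
    have nE: "cmod (?E t) = 1" for t using norm_exp_i_times[of "2 * pi * t"] by (simp add: mult_ac)
    have inb: "p + \<rho> * ?E t \<in> ball 0 1" for t
      using norm_triangle_ineq[of p "\<rho> * ?E t"] \<epsilon> d \<rho> by (simp add: norm_mult nE)
    have "homotopic_loops (- {0}) (circlepath 0 (\<epsilon> * cmod h')) (\<lambda>t. f (p + \<rho> * ?E t) - f p)"
      if cf: "continuous_on (ball 0 1) f"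
    proof (rule homotopic_loops_nearby_explicit)
      show "path (\<lambda>t. f (p + \<rho> * ?E t) - f p)"
        unfolding path_def
        by (intro continuous_intros continuous_on_compose2[OF cf]) (use inb in auto)
      show "pathfinish (\<lambda>t. f (p + \<rho> * ?E t) - f p) = pathstart (\<lambda>t. f (p + \<rho> * ?E t) - f p)"
        by (simp add: pathfinish_def pathstart_def)
      fix t :: real and x :: complex assume "t \<in> {0..1}" "x \<notin> - {0}"
      then have x: "x = 0" by simp
      define \<zeta> where "\<zeta> = \<rho> * ?E t"
      have n\<zeta>: "cmod \<zeta> = \<epsilon>" by (simp add: \<zeta>_def norm_mult nE \<rho>)
      have c: "circlepath 0 (\<epsilon> * cmod h') t = h' * \<zeta>"
        by (simp add: circlepath \<zeta>_def mult.assoc[symmetric] \<rho>(2))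
      have "f (p + \<zeta>) - f p - h' * \<zeta> = (h (p + \<zeta>) + cnj (g (p + \<zeta>)) - (h p + cnj (g p)) - D \<zeta>) + cnj (g' * \<zeta>)"
        using f[OF inb[of t]] f[of p] p by (simp add: \<zeta>_def[symmetric] D_def)
      also have "cmod \<dots> \<le> cmod (h (p + \<zeta>) + cnj (g (p + \<zeta>)) - (h p + cnj (g p)) - D \<zeta>) + cmod (cnj (g' * \<zeta>))"
        by (rule norm_triangle_ineq)
      also have "\<dots> \<le> e * \<epsilon> + cmod g' * \<epsilon>"
        using d1(2)[of "p + \<zeta>"] n\<zeta> \<epsilon> d by (simp add: norm_mult)
      also have "\<dots> < cmod h' * \<epsilon>" using e(2) \<epsilon> by (simp flip: distrib_right add: add.commute)
      also have "\<dots> = cmod (h' * \<zeta>)" by (simp add: norm_mult n\<zeta>)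
      finally show "cmod (f (p + \<rho> * ?E t) - f p - circlepath 0 (\<epsilon> * cmod h') t) < cmod (circlepath 0 (\<epsilon> * cmod h') t - x)"
        unfolding c x \<zeta>_def[symmetric] by simp
    qed auto
    then show "\<exists>\<rho>. cmod \<rho> = \<epsilon> \<and> (continuous_on (ball 0 1) f \<longrightarrow>
      homotopic_loops (- {0}) (circlepath 0 (\<epsilon> * cmod h')) (\<lambda>t. f (p + \<rho> * ?E t) - f p))"
      using \<rho>(1) by blast
  qed
qed

text \<open>The centre moves along the segment from \<open>p\<close> to \<open>q\<close> while the
  radius vector turns; injectivity keeps the difference away from 0 throughout.\<close>

lemma injective_small_loops_homotopic:
  fixes f :: "complex \<Rightarrow> complex"
  assumes cf: "continuous_on (ball 0 1) f" and inj: "inj_on f (ball 0 1)"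
    and p: "cmod p + \<epsilon> < 1" and q: "cmod q + \<epsilon> < 1"
    and \<rho>: "cmod \<rho> = \<epsilon>" "cmod \<rho>' = \<epsilon>" "0 < \<epsilon>"
  shows "homotopic_loops (- {0}) (\<lambda>t. f (p + \<rho> * exp (2 * of_real pi * \<i> * of_real t)) - f p)
     (\<lambda>t. f (q + \<rho>' * exp (2 * of_real pi * \<i> * of_real t)) - f q)"
proof -
  define P where "P s = of_real (1 - s) * p + of_real s * q" for s :: real
  \<comment> \<open>Interpolating logarithms keeps the modulus equal to \<epsilon>.\<close>
  define r where "r s = exp (of_real (1 - s) * Ln \<rho> + of_real s * Ln \<rho>')" for s :: real
  let ?E = "\<lambda>t. exp (2 * of_real pi * \<i> * of_real t)"
  have nE: "cmod (?E t) = 1" for t using norm_exp_i_times[of "2 * pi * t"] by (simp add: mult_ac)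
  have nz: "\<rho> \<noteq> 0" "\<rho>' \<noteq> 0" using \<rho> by auto
  have nr: "cmod (r s) = \<epsilon>" for s
  proof -
    have "Re (of_real (1 - s) * Ln \<rho> + of_real s * Ln \<rho>') = (1 - s) * ln \<epsilon> + s * ln \<epsilon>"
      using nz \<rho> by simp
    also have "\<dots> = ln \<epsilon>" by (simp add: algebra_simps)
    finally show ?thesis using \<rho>(3) by (simp only: r_def norm_exp_eq_Re exp_ln)
  qed
  have nP: "cmod (P s) + \<epsilon> < 1" if "s \<in> {0..1}" for s
  proof -
    have "cmod (P s) \<le> (1 - s) * cmod p + s * cmod q"
      using norm_triangle_ineq[of "of_real (1 - s) * p" "of_real s * q"] that
      unfolding P_def norm_mult norm_of_real by simp
    also have "\<dots> \<le> (1 - s) * max (cmod p) (cmod q) + s * max (cmod p) (cmod q)"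
      using that by (intro add_mono mult_left_mono) auto
    also have "\<dots> = max (cmod p) (cmod q)" by (simp add: algebra_simps)
    finally show ?thesis using p q by auto
  qed
  have b1: "P s + r s * ?E t \<in> ball 0 1" if "s \<in> {0..1}" for s t
    using norm_triangle_ineq[of "P s" "r s * ?E t"] nP[OF that] by (simp add: norm_mult nE nr)
  have b2: "P s \<in> ball 0 1" if "s \<in> {0..1}" for s using nP[OF that] \<rho>(3) by simp
  define H where "H z = f (P (fst z) + r (fst z) * ?E (snd z)) - f (P (fst z))" for z
  show ?thesis unfolding homotopic_loops
  proof (intro exI[of _ H] conjI ballI)
    have cP: "continuous_on A (\<lambda>z. P (fst z))" for A :: "(real \<times> real) set"
      unfolding P_def by (intro continuous_intros)
    have cr: "continuous_on A (\<lambda>z. r (fst z))" for A :: "(real \<times> real) set"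
      unfolding r_def by (intro continuous_intros)
    show "continuous_on ({0..1} \<times> {0..1}) H"
      unfolding H_def
      by (intro continuous_on_diff continuous_on_compose2[OF cf] continuous_on_add continuous_on_mult cP cr continuous_intros)
        (use b1 b2 in auto)
    show "H \<in> {0..1} \<times> {0..1} \<rightarrow> - {0}"
    proof
      fix z :: "real \<times> real" assume "z \<in> {0..1} \<times> {0..1}"
      then have s: "fst z \<in> {0..1}" by auto
      have "P (fst z) + r (fst z) * ?E (snd z) \<noteq> P (fst z)" using nr[of "fst z"] \<rho>(3) by auto
      then have "f (P (fst z) + r (fst z) * ?E (snd z)) \<noteq> f (P (fst z))"
        using inj b1[OF s] b2[OF s] unfolding inj_on_def by blast
      then show "H z \<in> - {0}" by (simp add: H_def)
    qed
    show "H (0, t) = f (p + \<rho> * ?E t) - f p" for t using nz by (simp add: H_def P_def r_def)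
    show "H (1, t) = f (q + \<rho>' * ?E t) - f q" for t using nz by (simp add: H_def P_def r_def)
    show "pathfinish (H \<circ> Pair s) = pathstart (H \<circ> Pair s)" for s
      by (simp add: H_def pathfinish_def pathstart_def)
  qed
qed

context harmonic_pair
begin

definition jac :: "complex \<Rightarrow> real" where "jac z = (cmod (deriv h z))\<^sup>2 - (cmod (deriv g z))\<^sup>2"

text \<open>The image loop winds once positively around the image of \<open>p\<close> and, as
  conjugation shows, once negatively around that of \<open>q\<close>; yet both loops are homotopic
  in the punctured plane.\<close>

lemma jac_no_sign_change:
  assumes inj: "inj_on hp (ball 0 1)" and p: "cmod p < 1" "0 < jac p" and q: "cmod q < 1" "jac q < 0"
  shows False
proof -
  have dh: "(h has_field_derivative deriv h z) (at z)" if "cmod z < 1" for z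
    using holomorphic_derivI[OF h open_ball] that by simp
  have dg: "(g has_field_derivative deriv g z) (at z)" if "cmod z < 1" for z
    using holomorphic_derivI[OF g open_ball] that by simp
  have domp: "cmod (deriv g p) < cmod (deriv h p)" using p(2) power2_less_imp_less unfolding jac_def by fastforce
  have domq: "cmod (deriv h q) < cmod (deriv g q)" using q(2) power2_less_imp_less unfolding jac_def by fastforce
  let ?E = "\<lambda>t. exp (2 * of_real pi * \<i> * of_real t)"
  obtain d1 where d1: "0 < d1" "\<And>\<epsilon>. 0 < \<epsilon> \<Longrightarrow> \<epsilon> < d1 \<Longrightarrow> \<exists>\<rho>. cmod \<rho> = \<epsilon> \<and> (continuous_on (ball 0 1) hp \<longrightarrow>
      homotopic_loops (- {0}) (circlepath 0 (\<epsilon> * cmod (deriv h p))) (\<lambda>t. hp (p + \<rho> * ?E t) - hp p))"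
    using local_degree[of hp h g, OF hp_def dh dg p(1) domp] p(1) by blast
  obtain d2 where d2: "0 < d2" "\<And>\<epsilon>. 0 < \<epsilon> \<Longrightarrow> \<epsilon> < d2 \<Longrightarrow> \<exists>\<rho>. cmod \<rho> = \<epsilon> \<and> (continuous_on (ball 0 1) (\<lambda>z. cnj (hp z)) \<longrightarrow>
      homotopic_loops (- {0}) (circlepath 0 (\<epsilon> * cmod (deriv g q))) (\<lambda>t. cnj (hp (q + \<rho> * ?E t)) - cnj (hp q)))"
    using local_degree[of "\<lambda>z. cnj (hp z)" g h, OF _ dg dh q(1) domq] q(1) by (auto simp: hp_def)
  define \<epsilon> where "\<epsilon> = min (min d1 d2) (min (1 - cmod p) (1 - cmod q)) / 2"
  have \<epsilon>: "0 < \<epsilon>" "\<epsilon> < d1" "\<epsilon> < d2" "cmod p + \<epsilon> < 1" "cmod q + \<epsilon> < 1"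
    using d1(1) d2(1) p(1) q(1) by (auto simp: \<epsilon>_def min_def field_simps)
  obtain \<rho> where \<rho>: "cmod \<rho> = \<epsilon>" "homotopic_loops (- {0}) (circlepath 0 (\<epsilon> * cmod (deriv h p))) (\<lambda>t. hp (p + \<rho> * ?E t) - hp p)"
    using d1(2)[OF \<epsilon>(1,2)] hp_continuous by blast
  have "continuous_on (ball 0 1) (\<lambda>z. cnj (hp z))" by (intro continuous_intros hp_continuous)
  then obtain \<rho>' where \<rho>': "cmod \<rho>' = \<epsilon>" "homotopic_loops (- {0}) (circlepath 0 (\<epsilon> * cmod (deriv g q)))
      (\<lambda>t. cnj (hp (q + \<rho>' * ?E t)) - cnj (hp q))"
    using d2(2)[OF \<epsilon>(1,3)] by blast
  have "homotopic_loops (- {0}) (cnj \<circ> circlepath 0 (\<epsilon> * cmod (deriv g q))) (cnj \<circ> (\<lambda>t. cnj (hp (q + \<rho>' * ?E t)) - cnj (hp q)))"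
    by (rule homotopic_loops_continuous_image[OF \<rho>'(2)]) (auto intro!: continuous_intros)
  then have 2: "homotopic_loops (- {0}) (cnj \<circ> circlepath 0 (\<epsilon> * cmod (deriv g q))) (\<lambda>t. hp (q + \<rho>' * ?E t) - hp q)"
    by (simp add: o_def)
  have "homotopic_loops (- {0}) (circlepath 0 (\<epsilon> * cmod (deriv h p))) (cnj \<circ> circlepath 0 (\<epsilon> * cmod (deriv g q)))"
    using homotopic_loops_trans[OF homotopic_loops_trans[OF \<rho>(2)
        injective_small_loops_homotopic[OF hp_continuous inj \<epsilon>(4,5) \<rho>(1) \<rho>'(1) \<epsilon>(1)]] homotopic_loops_sym[OF 2]] .
  then have w: "winding_number (circlepath 0 (\<epsilon> * cmod (deriv h p))) 0 = winding_number (cnj \<circ> circlepath 0 (\<epsilon> * cmod (deriv g q))) 0"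
    by (rule winding_number_homotopic_loops)
  have pos: "0 < \<epsilon> * cmod (deriv h p)" "0 < \<epsilon> * cmod (deriv g q)"
    using mult_pos_pos[OF \<epsilon>(1) le_less_trans[OF norm_ge_zero domp]]
      mult_pos_pos[OF \<epsilon>(1) le_less_trans[OF norm_ge_zero domq]] .
  have "winding_number (cnj \<circ> circlepath 0 (\<epsilon> * cmod (deriv g q))) (cnj 0)
     = - cnj (winding_number (circlepath 0 (\<epsilon> * cmod (deriv g q))) 0)"
    by (rule winding_number_cnj) (use pos in auto)
  then show False using w winding_number_circlepath_centre[OF pos(1)] winding_number_circlepath_centre[OF pos(2)] by simp
qed

end

text \<open>Boxes pull back to boxes with the same side lengths, and their volumes determine
  Lebesgue measure. Used to identify \<open>complex\<close> and \<open>real \<times> real\<close>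
  with \<open>real^2\<close>, where the change of variables takes place.\<close>

lemma distr_lborel_isometry:
  fixes T :: "'a::euclidean_space \<Rightarrow> 'b::euclidean_space"
  assumes cont: "continuous_on UNIV T" and bij: "bij_betw T Basis Basis"
    and inner: "\<And>x e. e \<in> Basis \<Longrightarrow> T x \<bullet> T e = x \<bullet> e"
  shows "distr lborel borel T = lborel"
proof (rule lborel_eqI[symmetric])
  fix l u :: 'b assume lu: "\<And>b. b \<in> Basis \<Longrightarrow> l \<bullet> b \<le> u \<bullet> b"
  have TB: "T e \<in> Basis" if "e \<in> Basis" for e using bij that by (auto simp: bij_betw_def)
  define pull where "pull w = (\<Sum>e\<in>Basis. (w \<bullet> T e) *\<^sub>R e)" for w
  have pull: "pull w \<bullet> e = w \<bullet> T e" if "e \<in> Basis" for w e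
    unfolding pull_def using that by (simp add: inner_sum_left inner_Basis if_distrib sum.delta' cong: if_cong)
  have "x \<in> T -` box l u \<longleftrightarrow> x \<in> box (pull l) (pull u)" for x
  proof -
    have "x \<in> T -` box l u \<longleftrightarrow> (\<forall>b\<in>T ` Basis. l \<bullet> b < T x \<bullet> b \<and> T x \<bullet> b < u \<bullet> b)"
      using bij by (simp add: mem_box bij_betw_def)
    then show ?thesis by (simp add: mem_box pull inner)
  qed
  then have "T -` box l u = box (pull l) (pull u)" by blast
  moreover have "T \<in> borel_measurable borel" using cont by (rule borel_measurable_continuous_onI)
  ultimately have "emeasure (distr lborel borel T) (box l u) = emeasure lborel (box (pull l) (pull u))"
    by (subst emeasure_distr) auto
  also have "\<dots> = (\<Prod>e\<in>Basis. (pull u - pull l) \<bullet> e)"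
    using lu TB by (subst emeasure_lborel_box) (auto simp: pull)
  also have "(\<Prod>e\<in>Basis. (pull u - pull l) \<bullet> e) = (\<Prod>e\<in>Basis. (u - l) \<bullet> T e)"
    by (intro prod.cong refl) (simp add: inner_diff_left pull)
  also have "\<dots> = (\<Prod>b\<in>Basis. (u - l) \<bullet> b)" using prod.reindex_bij_betw[OF bij, of "\<lambda>b. (u - l) \<bullet> b"] .
  finally show "emeasure (distr lborel borel T) (box l u) = (\<Prod>b\<in>Basis. (u - l) \<bullet> b)" .
qed simp

definition vec_of_complex :: "complex \<Rightarrow> real^2" where
  "vec_of_complex z = Re z *\<^sub>R axis 1 1 + Im z *\<^sub>R axis 2 1"

definition vec_of_pair :: "real \<times> real \<Rightarrow> real^2" where
  "vec_of_pair v = fst v *\<^sub>R axis 1 1 + snd v *\<^sub>R axis 2 1"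

lemma vec_of_complex_nth [simp]: "vec_of_complex z $ 1 = Re z" "vec_of_complex z $ 2 = Im z"
  by (simp_all add: vec_of_complex_def axis_def)

lemma vec_of_pair_nth [simp]: "vec_of_pair v $ 1 = fst v" "vec_of_pair v $ 2 = snd v"
  by (simp_all add: vec_of_pair_def axis_def)

lemma continuous_vec_of_complex: "continuous_on A vec_of_complex"
  unfolding vec_of_complex_def[abs_def] by (intro continuous_intros)

lemma Basis_vec2: "(Basis :: (real^2) set) = {axis 1 1, axis 2 1}"
  unfolding Basis_vec_def by (auto simp: UNIV_2)

lemma axis_12: "axis 1 (1::real) \<noteq> (axis 2 1 :: real^2)"
  by (simp add: axis_eq_axis)

lemma lborel_vec_of_complex: "distr lborel borel vec_of_complex = lborel"
proof (rule distr_lborel_isometry[OF continuous_vec_of_complex])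
  have "vec_of_complex 1 = axis 1 1" "vec_of_complex \<i> = axis 2 1" by (simp_all add: vec_of_complex_def)
  then show "bij_betw vec_of_complex Basis Basis"
    unfolding Basis_vec2 Basis_complex_def bij_betw_def using axis_12 by auto
  show "vec_of_complex x \<bullet> vec_of_complex e = x \<bullet> e" for x e
    by (simp add: inner_vec_def sum_2 inner_complex_def)
qed

lemma lborel_vec_of_pair: "distr lborel borel vec_of_pair = lborel"
proof (rule distr_lborel_isometry)
  show "continuous_on UNIV vec_of_pair" unfolding vec_of_pair_def[abs_def] by (intro continuous_intros)
  have "vec_of_pair (1, 0) = axis 1 1" "vec_of_pair (0, 1) = axis 2 1" by (simp_all add: vec_of_pair_def)
  moreover have B: "(Basis :: (real \<times> real) set) = {(1, 0), (0, 1)}" by (simp add: Basis_prod_def insert_commute)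
  ultimately show "bij_betw vec_of_pair Basis Basis"
    unfolding Basis_vec2 B bij_betw_def using axis_12 by simp
  show "vec_of_pair x \<bullet> vec_of_pair e = x \<bullet> e" for x e
    by (simp add: inner_vec_def sum_2 inner_prod_def)
qed

lemma measure_vec_of_complex_open:
  assumes "open E" shows "measure lebesgue (vec_of_complex ` E) = measure lebesgue E"
proof -
  have inj: "inj vec_of_complex"
    by (rule injI) (metis vec_of_complex_nth complex_eqI)
  have surj: "surj vec_of_complex"
  proof (rule surjI)
    show "vec_of_complex (Complex (v $ 1) (v $ 2)) = v" for v by (simp add: vec_eq_iff forall_2)
  qed
  have lin: "linear vec_of_complex"
    by (rule linearI) (auto simp: vec_of_complex_def algebra_simps)
  have op: "open (vec_of_complex ` E)" using open_surjective_linear_image[OF assms lin surj] .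
  have "emeasure lborel (vec_of_complex ` E) = emeasure (distr lborel borel vec_of_complex) (vec_of_complex ` E)"
    unfolding lborel_vec_of_complex ..
  also have "\<dots> = emeasure lborel (vec_of_complex -` (vec_of_complex ` E))"
    using op borel_measurable_continuous_onI[OF continuous_vec_of_complex] by (subst emeasure_distr) auto
  also have "vec_of_complex -` (vec_of_complex ` E) = E" using inj by (rule inj_vimage_image_eq)
  finally show ?thesis using op assms by (simp add: measure_def)
qed

text \<open>Fubini on the polar rectangle, with the angular integral expressed through
  \<open>circ\<close> so that Parseval applies to it.\<close>

lemma integral_vec_box:
  fixes G :: "real \<Rightarrow> real \<Rightarrow> real"
  assumes G: "continuous_on UNIV (\<lambda>v. G (fst v) (snd v))" and r: "0 < r"
  shows "integral (box (vec_of_pair (0, 0)) (vec_of_pair (r, 2 * pi))) (\<lambda>v. G (v $ 1) (v $ 2))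
    = (LINT x|lborel. indicator {0..r} x * (LINT \<theta>|circ. G x \<theta>))"
proof -
  let ?b = "cbox (vec_of_pair (0, 0)) (vec_of_pair (r, 2 * pi))"
  have cG: "continuous_on UNIV (\<lambda>v::real^2. G (v $ 1) (v $ 2))"
  proof -
    have "continuous_on UNIV (\<lambda>v::real^2. (v $ 1, v $ 2))" by (intro continuous_intros)
    from continuous_on_compose2[OF G this] show ?thesis by simp
  qed
  have "integral (box (vec_of_pair (0, 0)) (vec_of_pair (r, 2 * pi))) (\<lambda>v. G (v $ 1) (v $ 2))
    = integral ?b (\<lambda>v. G (v $ 1) (v $ 2))"
    by (rule integral_open_interval)
  also have "\<dots> = (LINT v:?b|lborel. G (v $ 1) (v $ 2))"
    by (rule set_borel_integral_eq_integral(2)[symmetric])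
      (unfold set_integrable_def, rule borel_integrable_compact, auto intro: continuous_on_subset[OF cG])
  also have "\<dots> = (LINT v|distr lborel borel vec_of_pair. indicator ?b v * G (v $ 1) (v $ 2))"
    unfolding lborel_vec_of_pair by (simp add: set_lebesgue_integral_def)
  also have "\<dots> = (LINT w|lborel. indicator ?b (vec_of_pair w) * G (fst w) (snd w))"
  proof (subst integral_distr)
    have "vec_of_pair \<in> borel_measurable borel" unfolding vec_of_pair_def[abs_def]
      by (intro borel_measurable_continuous_onI continuous_intros)
    then show "vec_of_pair \<in> lborel \<rightarrow>\<^sub>M borel" by simp
    show "(\<lambda>v. indicator ?b v * G (v $ 1) (v $ 2)) \<in> borel_measurable borel"
      using borel_measurable_continuous_onI[OF cG] by measurable
  qed simp
  also have "\<dots> = (LINT w|(lborel \<Otimes>\<^sub>M lborel). indicator ({0..r} \<times> {0..2 * pi}) w * G (fst w) (snd w))"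
    unfolding lborel_prod
    by (intro Bochner_Integration.integral_cong refl) (auto simp: indicator_def mem_box_cart forall_2)
  also have "\<dots> = (LINT x|lborel. LINT \<theta>|lborel. indicator ({0..r} \<times> {0..2 * pi}) (x, \<theta>) * G x \<theta>)"
  proof -
    have "integrable lborel (\<lambda>w. indicator ({0..r} \<times> {0..2 * pi}) w *\<^sub>R G (fst w) (snd w))"
      by (rule borel_integrable_compact) (auto intro: compact_Times continuous_on_subset[OF G])
    then have "integrable (lborel \<Otimes>\<^sub>M lborel) (\<lambda>w. indicator ({0..r} \<times> {0..2 * pi}) w * G (fst w) (snd w))"
      unfolding lborel_prod by simp
    from lborel_pair.integral_fst'[OF this] show ?thesis by simp
  qed
  also have "\<dots> = (LINT x|lborel. indicator {0..r} x * (LINT \<theta>|circ. G x \<theta>))"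
  proof (rule Bochner_Integration.integral_cong[OF refl])
    fix x :: real
    have "(\<lambda>\<theta>. G x \<theta>) \<in> borel_measurable borel"
    proof (rule borel_measurable_continuous_onI)
      have "continuous_on UNIV (\<lambda>\<theta>. (x, \<theta>))" by (intro continuous_intros)
      from continuous_on_compose2[OF G this] show "continuous_on UNIV (G x)" by simp
    qed
    from integral_circ[OF this]
    show "(LINT \<theta>|lborel. indicator ({0..r} \<times> {0..2 * pi}) (x, \<theta>) * G x \<theta>) = indicator {0..r} x * (LINT \<theta>|circ. G x \<theta>)"
      by (simp add: indicator_times mult.assoc)
  qed
  finally show ?thesis .
qed

section \<open>Polar coordinates and the area series\<close>

lemma taylor_deriv: "taylor (deriv h) n = of_nat (Suc n) * taylor h (Suc n)"
  unfolding taylor_def by (simp add: funpow_Suc_right del: funpow.simps of_nat_Suc)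

text \<open>Parseval for \<open>deriv h\<close> on each circle, then termwise integration in the
  radius. The factor \<open>(n + 1)\<^sup>2\<close> from differentiation against
  \<open>2 * pi / (2 * n + 2)\<close> from integration leaves \<open>pi * (n + 1)\<close>.\<close>

lemma polar_integral_deriv:
  assumes h: "h holomorphic_on ball 0 1" and r: "0 < r" "r < 1"
  shows "(\<lambda>n. pi * (real n * ((cmod (taylor h n))\<^sup>2 * (r\<^sup>2) ^ n))) sums
    (LINT x|lborel. indicator {0..r} x * (x * (LINT \<theta>|circ. (cmod (deriv h (of_real x * cis \<theta>)))\<^sup>2)))"
    and "integrable lborel (\<lambda>x. indicator {0..r} x * (x * (LINT \<theta>|circ. (cmod (deriv h (of_real x * cis \<theta>)))\<^sup>2)))"
proof -
  have dh: "deriv h holomorphic_on ball 0 1" by (rule holomorphic_deriv[OF h open_ball])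
  \<comment> \<open>With zero antiholomorphic part, the harmonic Parseval identity is the one for
    \<open>deriv h\<close>.\<close>
  interpret d: harmonic_pair "deriv h" "\<lambda>_. 0" by standard (use dh in auto)
  have t0: "taylor (\<lambda>_. 0) n = 0" for n
  proof -
    have "(deriv ^^ n) (\<lambda>_. 0 :: complex) = (\<lambda>_. 0)" by (induction n) auto
    then show ?thesis by (simp add: taylor_def)
  qed
  define c where "c n = 2 * pi * (cmod (taylor (deriv h) n))\<^sup>2" for n
  have c0: "0 \<le> c n" for n by (simp add: c_def)
  have ser: "(\<lambda>n. c n * (x * x) ^ n) sums (LINT \<theta>|circ. (cmod (deriv h (of_real x * cis \<theta>)))\<^sup>2)" if x: "0 \<le> x" "x < 1" for x
  proof -
    have "(\<lambda>n. complex_of_real (c n * (x * x) ^ n)) sums (LINT \<theta>|circ. of_real ((cmod (deriv h (of_real x * cis \<theta>)))\<^sup>2))"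
      using d.hp_Parseval[OF x x] unfolding complex_norm_square by (simp add: t0 d.hp_def c_def mult.assoc)
    then have "(\<lambda>n. complex_of_real (c n * (x * x) ^ n)) sums complex_of_real (LINT \<theta>|circ. (cmod (deriv h (of_real x * cis \<theta>)))\<^sup>2)"
      by (simp only: integral_complex_of_real)
    then show ?thesis by (simp only: sums_of_real_iff)
  qed
  define f where "f n x = indicator {0..r} x * (x * (c n * (x * x) ^ n))" for n and x :: real
  have f0: "0 \<le> f n x" for n x using c0[of n] by (auto simp: f_def indicator_def)
  have int: "has_bochner_integral lborel (f n) (c n * r ^ (2 * n + 2) / (2 * real n + 2))" for n
  proof -
    have "has_bochner_integral lborel (\<lambda>x. (c n * x ^ (2 * n + 1)) * indicator {0..r} x)
        (c n * r ^ (2 * n + 2) / (2 * real n + 2) - c n * 0 ^ (2 * n + 2) / (2 * real n + 2))"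
    proof (rule has_bochner_integral_FTC_Icc_real)
      fix x :: real
      have e: "c n * (y * p) / y = c n * p" if "y \<noteq> 0" for y p :: real using that by simp
      have y: "real (2 * n + 2) = 2 * real n + 2" "2 * real n + 2 \<noteq> 0" "2 * n + 2 - Suc 0 = 2 * n + 1" by auto
      from DERIV_cdivide[OF DERIV_cmult[OF DERIV_pow[of "2 * n + 2" x UNIV], of "c n"], of "2 * real n + 2"]
      show "((\<lambda>x. c n * x ^ (2 * n + 2) / (2 * real n + 2)) has_real_derivative c n * x ^ (2 * n + 1)) (at x)"
        unfolding y(1) e[OF y(2)] y(3) .
      show "isCont (\<lambda>x. c n * x ^ (2 * n + 1)) x" by (intro continuous_intros)
    qed (use r in simp)
    moreover have "(\<lambda>x. (c n * x ^ (2 * n + 1)) * indicator {0..r} x) = f n"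
      by (auto simp: f_def fun_eq_iff power_mult power2_eq_square power_mult_distrib mult_ac indicator_def)
    ultimately show ?thesis by simp
  qed
  have bd: "f n x \<le> indicator {0..r} x * (c n * (r * r) ^ n)" for n x
  proof (cases "x \<in> {0..r}")
    case True
    then have "x * (c n * (x * x) ^ n) \<le> 1 * (c n * (r * r) ^ n)"
      using r c0[of n] by (intro mult_mono power_mono) auto
    then show ?thesis using True by (simp add: f_def)
  qed (simp add: f_def)
  have sr: "summable (\<lambda>n. c n * (r * r) ^ n)" using ser[of r] r by (simp add: sums_iff)
  have sumf: "summable (\<lambda>n. f n x)" for x
  proof (rule summable_comparison_test'[OF sr])
    fix n
    have "0 \<le> c n * (r * r) ^ n" using c0 by simp
    then have "f n x \<le> c n * (r * r) ^ n" using bd[of n x] by (cases "x \<in> {0..r}") auto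
    then show "norm (f n x) \<le> c n * (r * r) ^ n" using f0 by simp
  qed
  have "summable (\<lambda>n. LINT x|lborel. norm (f n x))"
  proof (rule summable_comparison_test'[OF summable_mult[OF sr, of r]])
    fix n
    have "integrable lborel (\<lambda>x. indicator {0..r} x * (c n * (r * r) ^ n))"
      by (intro Bochner_Integration.integrable_mult_left integrable_real_indicator) (use r in simp_all)
    moreover have "integrable lborel (f n)" by (rule integrable.intros[OF int])
    ultimately have "(LINT x|lborel. f n x) \<le> (LINT x|lborel. indicator {0..r} x * (c n * (r * r) ^ n))"
      by (intro integral_mono bd)
    also have "\<dots> = r * (c n * (r * r) ^ n)" using r by simp
    finally show "norm (LINT x|lborel. norm (f n x)) \<le> r * (c n * (r * r) ^ n)"
      using f0 by (simp add: abs_of_nonneg integral_nonneg_AE)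
  qed
  note s = sums_integral[of lborel f, OF integrable.intros[OF int] _ this]
    integrable_suminf[of lborel f, OF integrable.intros[OF int] _ this]
  have eq: "(\<Sum>n. f n x) = indicator {0..r} x * (x * (LINT \<theta>|circ. (cmod (deriv h (of_real x * cis \<theta>)))\<^sup>2))" for x
  proof (cases "x \<in> {0..r}")
    case True
    then have "(\<lambda>n. x * (c n * (x * x) ^ n)) sums (x * (LINT \<theta>|circ. (cmod (deriv h (of_real x * cis \<theta>)))\<^sup>2))"
      using r by (intro sums_mult ser) auto
    then show ?thesis using True by (simp add: f_def sums_iff)
  qed (simp add: f_def)
  show "integrable lborel (\<lambda>x. indicator {0..r} x * (x * (LINT \<theta>|circ. (cmod (deriv h (of_real x * cis \<theta>)))\<^sup>2)))"
    using s(2) sumf f0 by (simp add: eq)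
  have "(\<lambda>n. c n * r ^ (2 * n + 2) / (2 * real n + 2)) sums
    (LINT x|lborel. indicator {0..r} x * (x * (LINT \<theta>|circ. (cmod (deriv h (of_real x * cis \<theta>)))\<^sup>2)))"
    using s(1) sumf f0 has_bochner_integral_integral_eq[OF int] by (simp add: eq)
  moreover have "c n * r ^ (2 * n + 2) / (2 * real n + 2) = pi * (real (Suc n) * ((cmod (taylor h (Suc n)))\<^sup>2 * (r\<^sup>2) ^ Suc n))" for n
  proof -
    have "c n = 2 * pi * ((real n + 1)\<^sup>2 * (cmod (taylor h (Suc n)))\<^sup>2)"
      unfolding c_def taylor_deriv norm_mult norm_of_nat power_mult_distrib by (simp add: add.commute)
    moreover have "r ^ (2 * n + 2) = (r\<^sup>2) ^ Suc n"
    proof -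
      have "2 * n + 2 = 2 * Suc n" by simp
      then show ?thesis by (simp only: power_mult)
    qed
    moreover have "2 * pi * ((real n + 1)\<^sup>2 * A) * B / (2 * real n + 2) = pi * ((real n + 1) * (A * B))" for A B
    proof -
      have g: "2 * pi * (x\<^sup>2 * A) * B / (2 * x) = pi * (x * (A * B))" if "x \<noteq> 0" for x :: real
        using that by (simp add: power2_eq_square)
      have e: "2 * real n + 2 = 2 * (real n + 1)" "real n + 1 \<noteq> 0" by auto
      show ?thesis unfolding e(1) by (rule g[OF e(2)])
    qed
    ultimately show ?thesis by (simp only: of_nat_Suc add.commute[of 1])
  qed
  ultimately have "(\<lambda>n. pi * (real (Suc n) * ((cmod (taylor h (Suc n)))\<^sup>2 * (r\<^sup>2) ^ Suc n))) sums
    (LINT x|lborel. indicator {0..r} x * (x * (LINT \<theta>|circ. (cmod (deriv h (of_real x * cis \<theta>)))\<^sup>2)))"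
    by (simp only:)
  \<comment> \<open>The coefficient \<open>n\<close> of the derivative belongs to the coefficient
    \<open>n + 1\<close> of \<open>h\<close>; the restored term at \<open>n = 0\<close> carries the
    factor 0.\<close>
  from sums_Suc[OF this]
  show "(\<lambda>n. pi * (real n * ((cmod (taylor h n))\<^sup>2 * (r\<^sup>2) ^ n))) sums
    (LINT x|lborel. indicator {0..r} x * (x * (LINT \<theta>|circ. (cmod (deriv h (of_real x * cis \<theta>)))\<^sup>2)))"
    by simp
qed

lemma has_derivative_polar:
  "((\<lambda>v::real^2. of_real (v $ 1) * cis (v $ 2)) has_derivative
    (\<lambda>w. of_real (w $ 1) * cis (v $ 2) + of_real (v $ 1) * (of_real (w $ 2) * (\<i> * cis (v $ 2))))) (at v within S)"
  by (rule derivative_eq_intros bounded_linear_imp_has_derivative[OF bounded_linear_vec_nth] refl)+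
    (simp add: scaleR_conv_of_real add.commute)

lemma polar_inj:
  assumes "0 < x" "0 < \<theta>" "\<theta> < 2 * pi" "0 < x'" "0 < \<theta>'" "\<theta>' < 2 * pi"
    and eq: "of_real x * cis \<theta> = of_real x' * cis \<theta>'"
  shows "x = x' \<and> \<theta> = \<theta>'"
proof -
  have "cmod (of_real x * cis \<theta>) = cmod (of_real x' * cis \<theta>')" using eq by (simp only:)
  then have "\<bar>x\<bar> = \<bar>x'\<bar>" by (simp only: norm_mult norm_of_real norm_cis mult_1_right)
  then have "x = x'" using assms(1,4) by simp
  have A: "Arg2pi (of_real x * cis \<theta>) = \<theta>" by (rule Arg2pi_unique[of x]) (use assms in \<open>simp_all add: cis_conv_exp\<close>)
  have B: "Arg2pi (of_real x' * cis \<theta>') = \<theta>'" by (rule Arg2pi_unique[of x']) (use assms in \<open>simp_all add: cis_conv_exp\<close>)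
  have "\<theta> = \<theta>'" using A B unfolding eq by (rule trans[OF sym])
  with \<open>x = x'\<close> show ?thesis ..
qed

context harmonic_pair
begin

lemma hp_has_derivative:
  assumes "cmod z < 1"
  shows "(hp has_derivative (\<lambda>\<zeta>. deriv h z * \<zeta> + cnj (deriv g z * \<zeta>))) (at z within S)"
proof -
  have "(h has_derivative (\<lambda>\<zeta>. deriv h z * \<zeta>)) (at z within S)" "(g has_derivative (\<lambda>\<zeta>. deriv g z * \<zeta>)) (at z within S)"
    using holomorphic_derivI[OF h open_ball, of z S] holomorphic_derivI[OF g open_ball, of z S] assms
    unfolding has_field_derivative_def by simp_all
  then show ?thesis unfolding hp_def[abs_def] by (intro has_derivative_add has_derivative_cnj)
qed

text \<open>The real linear map with parts \<open>A\<close> and \<open>B\<close> has determinant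
  \<open>(cmod A)\<^sup>2 - (cmod B)\<^sup>2\<close>, and the polar frame \<open>c\<close>,
  \<open>x * \<i> * c\<close> spans the signed area \<open>x\<close>.\<close>

lemma jac_polar:
  "Re (A * c + cnj (B * c)) * Im (A * (of_real x * (\<i> * c)) + cnj (B * (of_real x * (\<i> * c))))
    - Re (A * (of_real x * (\<i> * c)) + cnj (B * (of_real x * (\<i> * c)))) * Im (A * c + cnj (B * c))
    = x * ((cmod A)\<^sup>2 - (cmod B)\<^sup>2)" if "cmod c = 1"
proof -
  have "(Re c)\<^sup>2 + (Im c)\<^sup>2 = 1" using that cmod_power2[of c] by simp
  then have c: "Re c * Re c = 1 - Im c * Im c" by (simp add: power2_eq_square)
  have "Re (A * c + cnj (B * c)) * Im (A * (of_real x * (\<i> * c)) + cnj (B * (of_real x * (\<i> * c))))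
    - Re (A * (of_real x * (\<i> * c)) + cnj (B * (of_real x * (\<i> * c)))) * Im (A * c + cnj (B * c))
    = x * ((cmod A)\<^sup>2 - (cmod B)\<^sup>2) * (Re c * Re c + Im c * Im c)"
    unfolding cmod_power2 by (simp add: power2_eq_square algebra_simps)
  then show ?thesis using c by simp
qed

text \<open>Change of variables on the open polar rectangle. The factor \<sigma> is the constant
  sign of the Jacobian, which removes the absolute value from the determinant.\<close>

theorem area_formula:
  assumes inj: "inj_on hp (ball 0 1)" and r: "0 < r" "r < 1"
  obtains \<sigma> :: real where "\<bar>\<sigma>\<bar> = 1"
    "(\<lambda>n. pi * (real n * (((cmod (taylor h n))\<^sup>2 - (cmod (taylor g n))\<^sup>2) * (r\<^sup>2) ^ n))) sums (\<sigma> * measure lebesgue (hp ` ball 0 r))"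
proof -
  obtain \<sigma> :: real where \<sigma>: "\<bar>\<sigma>\<bar> = 1" "\<And>z. cmod z < 1 \<Longrightarrow> \<bar>jac z\<bar> = \<sigma> * jac z"
  proof (cases "\<exists>p. cmod p < 1 \<and> 0 < jac p")
    case True
    then obtain p where p: "cmod p < 1" "0 < jac p" by blast
    have "0 \<le> jac z" if "cmod z < 1" for z using jac_no_sign_change[OF inj p that] not_less by blast
    then show thesis using that[of 1] by simp
  next
    case False
    then have "jac z \<le> 0" if "cmod z < 1" for z using that not_less by blast
    then show thesis using that[of "- 1"] by simp
  qed
  define p where "p v = of_real (v $ 1) * cis (v $ 2)" for v :: "real^2"
  define p' where "p' v w = of_real (w $ 1) * cis (v $ 2) + of_real (v $ 1) * (of_real (w $ 2) * (\<i> * cis (v $ 2)))" for v w :: "real^2"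
  define \<phi> where "\<phi> v = vec_of_complex (hp (p v))" for v
  define \<phi>' where "\<phi>' v w = vec_of_complex (deriv h (p v) * p' v w + cnj (deriv g (p v) * p' v w))" for v w
  define Q where "Q = box (vec_of_pair (0, 0)) (vec_of_pair (r, 2 * pi))"
  have Q: "v \<in> Q \<longleftrightarrow> 0 < v $ 1 \<and> v $ 1 < r \<and> 0 < v $ 2 \<and> v $ 2 < 2 * pi" for v
    by (auto simp: Q_def mem_box_cart forall_2)
  have pQ: "cmod (p v) = v $ 1" if "v \<in> Q" for v using that by (simp add: Q p_def norm_mult)
  have lin: "bounded_linear vec_of_complex"
    unfolding linear_conv_bounded_linear[symmetric] by (rule linearI) (auto simp: vec_of_complex_def algebra_simps)
  have der: "(\<phi> has_derivative \<phi>' v) (at v within Q)" if "v \<in> Q" for v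
  proof -
    have "cmod (p v) < 1" using pQ[OF that] that r by (simp add: Q)
    have "(p has_derivative p' v) (at v within Q)"
      unfolding p_def[abs_def] p'_def[abs_def] by (rule has_derivative_polar)
    from bounded_linear.has_derivative[OF lin has_derivative_in_compose[OF this hp_has_derivative[OF \<open>cmod (p v) < 1\<close>]]]
    show ?thesis unfolding \<phi>_def[abs_def] \<phi>'_def[abs_def] .
  qed
  have injv: "inj vec_of_complex"
    by (rule injI) (metis vec_of_complex_nth complex_eqI)
  have injQ: "inj_on \<phi> Q"
  proof (rule inj_onI)
    fix v w assume vw: "v \<in> Q" "w \<in> Q" "\<phi> v = \<phi> w"
    then have "hp (p v) = hp (p w)" unfolding \<phi>_def using injv by (simp add: inj_eq)
    then have "p v = p w" using inj vw(1,2) r pQ unfolding inj_on_def by (auto simp: Q)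
    then have "v $ 1 = w $ 1 \<and> v $ 2 = w $ 2" unfolding p_def
      by (intro polar_inj) (use vw in \<open>auto simp: Q\<close>)
    then show "v = w" by (simp add: vec_eq_iff forall_2)
  qed
  have det: "det (matrix (\<phi>' v)) = v $ 1 * jac (p v)" for v
  proof -
    let ?A = "deriv h (p v)" and ?B = "deriv g (p v)" and ?c = "cis (v $ 2)"
    have e1: "\<phi>' v (axis 1 1) = vec_of_complex (?A * ?c + cnj (?B * ?c))"
      by (simp add: \<phi>'_def p'_def axis_def)
    have e2: "\<phi>' v (axis 2 1) = vec_of_complex (?A * (of_real (v $ 1) * (\<i> * ?c)) + cnj (?B * (of_real (v $ 1) * (\<i> * ?c))))"
      by (simp add: \<phi>'_def p'_def axis_def)
    have "det (matrix (\<phi>' v)) = \<phi>' v (axis 1 1) $ 1 * \<phi>' v (axis 2 1) $ 2 - \<phi>' v (axis 2 1) $ 1 * \<phi>' v (axis 1 1) $ 2"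
      by (simp add: det_2 matrix_def)
    then show ?thesis unfolding e1 e2 vec_of_complex_nth jac_polar[OF norm_cis] jac_def .
  qed
  \<comment> \<open>The radius is clamped to \<open>[0, r]\<close>, so the integrand is continuous
    on the whole plane and agrees with the Jacobian on \<open>Q\<close>.\<close>
  define G where "G x \<theta> = x * jac (of_real (max 0 (min r x)) * cis \<theta>)" for x \<theta> :: real
  have dh: "deriv h holomorphic_on ball 0 1" and dg: "deriv g holomorphic_on ball 0 1"
    by (intro holomorphic_deriv h g open_ball)+
  have contG: "continuous_on UNIV (\<lambda>v. G (fst v) (snd v))"
    unfolding G_def jac_def
    by (intro continuous_intros continuous_on_compose2[OF holomorphic_on_imp_continuous_on[OF dh]]
        continuous_on_compose2[OF holomorphic_on_imp_continuous_on[OF dg]]) (use r in \<open>auto simp: norm_mult\<close>)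
  have GQ: "\<bar>det (matrix (\<phi>' v))\<bar> = \<sigma> * G (v $ 1) (v $ 2)" if "v \<in> Q" for v
  proof -
    have "max 0 (min r (v $ 1)) = v $ 1" using that by (simp add: Q)
    then have "G (v $ 1) (v $ 2) = v $ 1 * jac (p v)" by (simp add: G_def p_def)
    moreover have "\<bar>jac (p v)\<bar> = \<sigma> * jac (p v)" using \<sigma>(2) pQ[OF that] that r by (simp add: Q)
    ultimately show ?thesis using that by (simp add: det abs_mult Q)
  qed
  have "continuous_on UNIV (\<lambda>v::real^2. (v $ 1, v $ 2))" by (intro continuous_intros)
  from continuous_on_compose2[OF contG this] have cG: "continuous_on UNIV (\<lambda>v::real^2. G (v $ 1) (v $ 2))" by simp
  have "(\<lambda>v. G (v $ 1) (v $ 2)) integrable_on cbox (vec_of_pair (0, 0)) (vec_of_pair (r, 2 * pi))"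
    by (intro integrable_continuous continuous_on_subset[OF cG]) simp
  then have iG: "(\<lambda>v. G (v $ 1) (v $ 2)) integrable_on Q" unfolding Q_def integrable_on_open_interval .
  have "(\<lambda>v. \<sigma> * G (v $ 1) (v $ 2)) integrable_on Q" using integrable_on_cmult_left[OF iG, of \<sigma>] by simp
  then have iD: "(\<lambda>v. \<bar>det (matrix (\<phi>' v))\<bar>) integrable_on Q" by (rule integrable_eq) (simp add: GQ)
  have Qm: "Q \<in> sets lebesgue" by (simp add: Q_def)
  have mQ: "measure lebesgue (\<phi> ` Q) = integral Q (\<lambda>v. \<bar>det (matrix (\<phi>' v))\<bar>)"
    by (rule measure_differentiable_image_eq[OF Qm der injQ iD])
  have lm: "\<phi> ` Q \<in> lmeasurable" using measurable_differentiable_image_eq[OF Qm der injQ] iD by blast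
  have "measure lebesgue (\<phi> ` Q) = integral Q (\<lambda>v. \<sigma> * G (v $ 1) (v $ 2))"
    unfolding mQ by (rule Henstock_Kurzweil_Integration.integral_cong) (simp add: GQ)
  also have "\<dots> = \<sigma> * integral Q (\<lambda>v. G (v $ 1) (v $ 2))" by simp
  also have "integral Q (\<lambda>v. G (v $ 1) (v $ 2)) = (LINT x|lborel. indicator {0..r} x * (LINT \<theta>|circ. G x \<theta>))"
    unfolding Q_def by (rule integral_vec_box[OF contG r(1)])
  also have "\<dots> = (LINT x|lborel. indicator {0..r} x * (x * (LINT \<theta>|circ. (cmod (deriv h (of_real x * cis \<theta>)))\<^sup>2))
      - indicator {0..r} x * (x * (LINT \<theta>|circ. (cmod (deriv g (of_real x * cis \<theta>)))\<^sup>2)))"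
  proof (rule Bochner_Integration.integral_cong[OF refl])
    fix x :: real
    show "indicator {0..r} x * (LINT \<theta>|circ. G x \<theta>) = indicator {0..r} x * (x * (LINT \<theta>|circ. (cmod (deriv h (of_real x * cis \<theta>)))\<^sup>2))
      - indicator {0..r} x * (x * (LINT \<theta>|circ. (cmod (deriv g (of_real x * cis \<theta>)))\<^sup>2))"
    proof (cases "x \<in> {0..r}")
      case True
      then have x: "0 \<le> x" "x < 1" using r by auto
      have i: "integrable circ (\<lambda>\<theta>. (cmod (k (of_real x * cis \<theta>)))\<^sup>2)" if k: "k holomorphic_on ball 0 1" for k
      proof -
        obtain B where B: "\<And>\<theta>. cmod (k (of_real x * cis \<theta>)) \<le> B" using circle_bounded[OF k x] by blast
        note [measurable] = circle_measurable[OF k x]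
        show ?thesis
          by (rule integrable_circ[where B = "B\<^sup>2"]) (measurable, use power_mono[OF B norm_ge_zero, where n = 2] in simp)
      qed
      have "max 0 (min r x) = x" using True by auto
      then have "(LINT \<theta>|circ. G x \<theta>) = x * (LINT \<theta>|circ. (cmod (deriv h (of_real x * cis \<theta>)))\<^sup>2 - (cmod (deriv g (of_real x * cis \<theta>)))\<^sup>2)"
        by (simp add: G_def jac_def)
      then show ?thesis using True i[OF dh] i[OF dg] by (simp add: Bochner_Integration.integral_diff right_diff_distrib)
    qed simp
  qed
  also have "\<dots> = (LINT x|lborel. indicator {0..r} x * (x * (LINT \<theta>|circ. (cmod (deriv h (of_real x * cis \<theta>)))\<^sup>2)))
      - (LINT x|lborel. indicator {0..r} x * (x * (LINT \<theta>|circ. (cmod (deriv g (of_real x * cis \<theta>)))\<^sup>2)))"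
    by (intro Bochner_Integration.integral_diff polar_integral_deriv(2) h g r)
  finally have m: "measure lebesgue (\<phi> ` Q) = \<sigma> * ((LINT x|lborel. indicator {0..r} x * (x * (LINT \<theta>|circ. (cmod (deriv h (of_real x * cis \<theta>)))\<^sup>2)))
      - (LINT x|lborel. indicator {0..r} x * (x * (LINT \<theta>|circ. (cmod (deriv g (of_real x * cis \<theta>)))\<^sup>2))))" .
  have sub: "ball (0::complex) r \<subseteq> ball 0 1" using r by auto
  have "open (hp ` ball 0 r)"
    by (rule invariance_of_domain) (auto intro: continuous_on_subset[OF hp_continuous sub] inj_on_subset[OF inj sub])
  then have "measure lebesgue (hp ` ball 0 r) = measure lebesgue (vec_of_complex ` hp ` ball 0 r)"
    by (rule measure_vec_of_complex_open[symmetric])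
  also have "\<dots> = measure lebesgue (\<phi> ` Q)"
  proof (rule measure_negligible_symdiff[OF lm])
    \<comment> \<open>The rectangle misses only a slit on the real axis. The image of the whole
      diameter covers it and is null because the map is differentiable.\<close>
    let ?N = "(\<lambda>z. vec_of_complex (hp z)) ` (ball 0 1 \<inter> {z. \<i> \<bullet> z = 0})"
    have "negligible ?N"
    proof (rule negligible_differentiable_image_negligible)
      show "negligible (ball 0 1 \<inter> {z. \<i> \<bullet> z = 0})"
        by (rule negligible_subset[OF negligible_hyperplane[of \<i> 0]]) auto
      show "(\<lambda>z. vec_of_complex (hp z)) differentiable_on ball 0 1 \<inter> {z. \<i> \<bullet> z = 0}"
        unfolding differentiable_on_def differentiable_def
        using bounded_linear.has_derivative[OF lin hp_has_derivative] by fastforce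
    qed simp
    moreover have "\<phi> ` Q - vec_of_complex ` hp ` ball 0 r \<union> (vec_of_complex ` hp ` ball 0 r - \<phi> ` Q) \<subseteq> ?N"
    proof -
      have "p v \<in> ball 0 r" if "v \<in> Q" for v using pQ[OF that] that by (simp add: Q)
      then have 1: "\<phi> ` Q \<subseteq> vec_of_complex ` hp ` ball 0 r" unfolding \<phi>_def by blast
      have 2: "vec_of_complex (hp z) \<in> \<phi> ` Q \<union> ?N" if z: "z \<in> ball 0 r" for z
      proof (cases "Im z = 0")
        case True
        then have "z \<in> ball 0 1 \<inter> {z. \<i> \<bullet> z = 0}" using z r by (simp add: inner_complex_def)
        then show ?thesis by blast
      next
        case False
        have "z \<noteq> 0" using False by auto
        have "Arg2pi z \<noteq> 0" using False Arg2pi_eq_0[of z] complex_is_Real_iff by blast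
        then have v: "vec_of_pair (cmod z, Arg2pi z) \<in> Q"
          using z \<open>z \<noteq> 0\<close> Arg2pi_ge_0[of z] Arg2pi_lt_2pi[of z] by (simp add: Q)
        have "p (vec_of_pair (cmod z, Arg2pi z)) = z" using Arg2pi_eq[of z] by (simp add: p_def cis_conv_exp)
        then have "\<phi> (vec_of_pair (cmod z, Arg2pi z)) = vec_of_complex (hp z)" by (simp add: \<phi>_def)
        then show ?thesis using v by (metis UnI1 image_eqI)
      qed
      show ?thesis using 1 2 by blast
    qed
    ultimately show "negligible (\<phi> ` Q - vec_of_complex ` hp ` ball 0 r \<union> (vec_of_complex ` hp ` ball 0 r - \<phi> ` Q))"
      by (rule negligible_subset)
  qed
  finally have area: "measure lebesgue (hp ` ball 0 r) = measure lebesgue (\<phi> ` Q)" .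
  have ss: "\<sigma> * (\<sigma> * t) = t" for t
  proof -
    have "\<sigma> * \<sigma> = 1" using \<sigma>(1) by (metis abs_mult_self_eq mult_1)
    then show ?thesis by (metis mult.assoc mult_1)
  qed
  from sums_diff[OF polar_integral_deriv(1)[OF h r] polar_integral_deriv(1)[OF g r]]
  have "(\<lambda>n. pi * (real n * (((cmod (taylor h n))\<^sup>2 - (cmod (taylor g n))\<^sup>2) * (r\<^sup>2) ^ n))) sums (\<sigma> * measure lebesgue (hp ` ball 0 r))"
    unfolding area m ss by (simp add: right_diff_distrib left_diff_distrib)
  with \<sigma>(1) show thesis by (rule that)
qed

end


section \<open>Area contraction\<close>

sublocale harmonic_boundary \<subseteq> monotone_boundary F
  by unfold_locales (rule side_arcs, assumption, rule sectors_hit, assumption+)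

lemma log_kernel_approx:
  fixes \<rho> v :: real
  assumes \<rho>: "0 < \<rho>" "\<rho> < 1"
  shows "\<bar>- Im (Ln (1 - of_real \<rho> * cis v)) - (\<Sum>n=1..N. \<rho> ^ n * sin (real n * v) / real n)\<bar> \<le> \<rho> ^ Suc N / (1 - \<rho>)"
proof -
  let ?f = "\<lambda>n. \<rho> ^ n * sin (real n * v) / real n"
  have s: "?f sums (- Im (Ln (1 - of_real \<rho> * cis v)))" using \<rho> by (intro log_kernel_sums) auto
  have "{..<Suc N} = insert 0 {1..N}" by auto
  then have "(\<Sum>n<Suc N. ?f n) = (\<Sum>n=1..N. ?f n)" by simp
  then have "- Im (Ln (1 - of_real \<rho> * cis v)) - (\<Sum>n=1..N. ?f n) = (\<Sum>i. ?f (i + Suc N))"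
    using suminf_split_initial_segment[OF sums_summable[OF s], of "Suc N"] sums_unique[OF s] by linarith
  also have "\<bar>\<dots>\<bar> \<le> (\<Sum>i. \<rho> ^ Suc N * \<rho> ^ i)"
  proof -
    have g: "(\<lambda>i. \<rho> ^ Suc N * \<rho> ^ i) sums (\<rho> ^ Suc N * (1 / (1 - \<rho>)))"
      using \<rho> by (intro sums_mult geometric_sums) auto
    have b: "\<bar>?f (i + Suc N)\<bar> \<le> \<rho> ^ Suc N * \<rho> ^ i" for i
    proof -
      have "\<bar>sin (real (i + Suc N) * v)\<bar> / real (i + Suc N) \<le> 1"
        by (rule divide_le_eq_1_pos[THEN iffD2], simp) (rule order_trans[OF abs_sin_le_one], simp)
      then have "\<rho> ^ (i + Suc N) * (\<bar>sin (real (i + Suc N) * v)\<bar> / real (i + Suc N)) \<le> \<rho> ^ (i + Suc N) * 1"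
        using \<rho> by (intro mult_left_mono) auto
      moreover have "\<bar>?f (i + Suc N)\<bar> = \<rho> ^ (i + Suc N) * (\<bar>sin (real (i + Suc N) * v)\<bar> / real (i + Suc N))"
        using \<rho> by (simp only: abs_mult abs_divide power_abs abs_of_nat times_divide_eq_right)
      ultimately show ?thesis by (simp only: power_add mult.commute mult_1_right)
    qed
    have sa: "summable (\<lambda>i. \<bar>?f (i + Suc N)\<bar>)"
      by (rule summable_comparison_test'[OF sums_summable[OF g]]) (use b in simp)
    show ?thesis
      by (rule order_trans[OF summable_rabs[OF sa] suminf_le[OF b sa sums_summable[OF g]]])
  qed
  also have "\<dots> = \<rho> ^ Suc N / (1 - \<rho>)"
    using sums_unique[OF sums_mult[OF geometric_sums[of \<rho>], of "\<rho> ^ Suc N"]] \<rho> by simp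
  finally show ?thesis .
qed

context harmonic_boundary
begin

text \<open>The coefficient inequality for the kernel with \<open>\<kappa> * sin v\<close>
  subtracted, as the truncation grows. The factor \<open>4 * pi\<^sup>2\<close> from the
  unnormalised Fourier coefficients cancels.\<close>

lemma taylor_inequality:
  assumes \<rho>: "0 < \<rho>" "\<rho> < 1" and \<kappa>: "\<kappa> = \<rho> * (1 - \<rho>) / (1 + \<rho>) ^ 3"
    and d: "\<And>n. d n = (cmod (taylor h n))\<^sup>2 - (cmod (taylor g n))\<^sup>2"
    and S: "(\<lambda>n. real n * (d n * \<rho> ^ n)) sums S"
  shows "\<bar>S - \<kappa> * d 1\<bar> \<le> \<rho> - \<kappa>"
proof -
  \<comment> \<open>Subtracting \<open>\<kappa> * sin v\<close> from the kernel changes only the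
    first weight.\<close>
  define w where "w n = \<rho> ^ n - (if n = 1 then \<kappa> else 0)" for n :: nat
  let ?\<Phi> = "\<lambda>v. - Im (Ln (1 - of_real \<rho> * cis v)) - \<kappa> * sin v"
  have bound: "\<bar>\<Sum>n=1..N. w n * (real n * d n)\<bar> \<le> \<rho> - \<kappa> + 4 * (\<rho> ^ Suc N / (1 - \<rho>))" if N: "1 \<le> N" for N
  proof -
    have split: "(\<Sum>n=1..N. (if n = 1 then \<kappa> else 0) * t n) = \<kappa> * t 1" for t :: "nat \<Rightarrow> real"
    proof -
      have "(\<Sum>n=1..N. (if n = 1 then \<kappa> else 0) * t n) = (\<Sum>n=1..N. if n = 1 then \<kappa> * t 1 else 0)"
        by (intro sum.cong) auto
      then show ?thesis using N by simp
    qed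
    have "kernel_sum w N v = (\<Sum>n=1..N. \<rho> ^ n * sin (real n * v) / real n) - \<kappa> * sin v" for v
      using split[of "\<lambda>n. sin (real n * v) / real n"]
      unfolding kernel_sum_def w_def by (simp add: left_diff_distrib diff_divide_distrib sum_subtractf)
    then have approx: "\<bar>?\<Phi> v - kernel_sum w N v\<bar> \<le> \<rho> ^ Suc N / (1 - \<rho>)" for v
      using log_kernel_approx[OF \<rho>, of v N] by simp
    have c: "(cmod (coeff (int n)))\<^sup>2 - (cmod (coeff (- int n)))\<^sup>2 = 4 * pi\<^sup>2 * d n" if "n \<in> {1..N}" for n
    proof -
      have "n \<noteq> 0" using that by auto
      then show ?thesis unfolding coeff_nonneg coeff_neg[OF \<open>n \<noteq> 0\<close>] d
        by (simp add: norm_mult power_mult_distrib right_diff_distrib)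
    qed
    have "4 * pi\<^sup>2 * \<bar>\<Sum>n=1..N. w n * (real n * d n)\<bar> = \<bar>\<Sum>n=1..N. w n * (real n * (4 * pi\<^sup>2 * d n))\<bar>"
    proof -
      have "(\<Sum>n=1..N. w n * (real n * (4 * pi\<^sup>2 * d n))) = 4 * pi\<^sup>2 * (\<Sum>n=1..N. w n * (real n * d n))"
        by (simp add: sum_distrib_left mult_ac)
      then show ?thesis by (simp add: abs_mult)
    qed
    also have "\<dots> = \<bar>\<Sum>n=1..N. w n * (real n * ((cmod (coeff (int n)))\<^sup>2 - (cmod (coeff (- int n)))\<^sup>2))\<bar>"
      by (simp only: c cong: sum.cong)
    also have "\<dots> \<le> 4 * pi\<^sup>2 * w 1 + 16 * pi\<^sup>2 * (\<rho> ^ Suc N / (1 - \<rho>))"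
      by (rule coefficient_inequality[OF concave_kernel_log[OF \<rho> \<kappa>] approx N])
    also have "\<dots> = 4 * pi\<^sup>2 * (\<rho> - \<kappa> + 4 * (\<rho> ^ Suc N / (1 - \<rho>)))"
      unfolding w_def by (simp add: distrib_left right_diff_distrib)
    finally show ?thesis by (rule mult_left_le_imp_le) simp
  qed
  have lim: "(\<lambda>N. \<Sum>n=1..N. w n * (real n * d n)) \<longlonglongrightarrow> S - \<kappa> * d 1"
  proof -
    have "(\<lambda>n. real n * (d n * \<rho> ^ n) - (if n = 1 then \<kappa> * d 1 else 0)) sums (S - \<kappa> * d 1)"
      by (intro sums_diff S sums_single)
    moreover have "real n * (d n * \<rho> ^ n) - (if n = 1 then \<kappa> * d 1 else 0) = w n * (real n * d n)" for n
      by (simp add: w_def algebra_simps)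
    ultimately have "(\<lambda>n. w n * (real n * d n)) sums (S - \<kappa> * d 1)" by simp
    then have "(\<lambda>N. \<Sum>n<Suc N. w n * (real n * d n)) \<longlonglongrightarrow> S - \<kappa> * d 1"
      unfolding sums_def by (rule LIMSEQ_Suc)
    moreover have "(\<Sum>n<Suc N. w n * (real n * d n)) = (\<Sum>n=1..N. w n * (real n * d n))" for N
    proof -
      have "{..<Suc N} = insert 0 {1..N}" by auto
      then show ?thesis by simp
    qed
    ultimately show ?thesis by simp
  qed
  have "(\<lambda>N. \<rho> - \<kappa> + 4 * (\<rho> ^ Suc N / (1 - \<rho>))) \<longlonglongrightarrow> \<rho> - \<kappa> + 4 * (0 / (1 - \<rho>))"
    using \<rho> by (intro tendsto_intros LIMSEQ_Suc LIMSEQ_realpow_zero) auto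
  from LIMSEQ_le[OF tendsto_rabs[OF lim] this] bound show ?thesis by auto
qed

end

context harmonic_disk
begin

text \<open>Parseval bounds partial sums on each circle by the mean of
  \<open>(cmod (hp z))\<^sup>2\<close>, and the radius tends to 1.\<close>

lemma taylor_energy_le:
  assumes A: "finite A" shows "(\<Sum>n\<in>A. (cmod (taylor h n))\<^sup>2 + (cmod (taylor g n))\<^sup>2) \<le> 1"
proof -
  define c where "c n = (cmod (taylor h n))\<^sup>2 + (cmod (taylor g n))\<^sup>2" for n
  have c0: "0 \<le> c n" for n by (simp add: c_def)
  have le: "(\<Sum>n\<in>A. c n * radius k ^ n) \<le> 1" for k
  proof -
    define t where "t = sqrt (radius k)"
    have t: "0 \<le> t" "t < 1" "radius k = t * t" using radius by (auto simp: t_def)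
    have "(\<lambda>n. complex_of_real (2 * pi * (c n * (t * t) ^ n))) sums
      (LINT \<theta>|circ. hp (of_real t * cis \<theta>) * cnj (hp (of_real t * cis \<theta>)))"
      using hp_Parseval[OF t(1,2) t(1,2)] unfolding c_def by (simp only: of_real_mult of_real_eq_id id_apply)
    then have s: "summable (\<lambda>n. 2 * pi * (c n * radius k ^ n))"
      unfolding t(3) using sums_Re sums_summable by fastforce
    have "(\<Sum>n\<in>A. 2 * pi * (c n * radius k ^ n)) \<le> (\<Sum>n. 2 * pi * (c n * radius k ^ n))"
      by (rule sum_le_suminf[OF s A]) (simp add: c0 radius)
    also have "\<dots> \<le> 2 * pi" using energy_le[OF radius, of k] unfolding energy_def c_def .
    finally show ?thesis by (simp add: sum_distrib_left[symmetric])
  qed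
  have "(\<lambda>k. \<Sum>n\<in>A. c n * radius k ^ n) \<longlonglongrightarrow> (\<Sum>n\<in>A. c n * 1 ^ n)"
    by (intro tendsto_intros radius_tendsto)
  from LIMSEQ_le_const2[OF this] le have "(\<Sum>n\<in>A. c n * 1 ^ n) \<le> 1" by blast
  then show ?thesis by (simp add: c_def)
qed

lemma area_bound:
  assumes rr: "0 < r" "r < 1"
  obtains \<kappa> where "0 < \<kappa>" "measure lebesgue (hp ` ball 0 r)
    \<le> pi * (r\<^sup>2 - \<kappa> * (1 - \<bar>(cmod (taylor h 1))\<^sup>2 - (cmod (taylor g 1))\<^sup>2\<bar>))"
proof -
  obtain F q where F: "F \<in> borel_measurable borel" "\<And>\<theta>. cmod (F \<theta>) = 1" "strict_mono q"
    "AE \<theta> in circ. (\<lambda>i. hp (of_real (radius (q i)) * cis \<theta>)) \<longlonglongrightarrow> F \<theta>"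
    using boundary_function by blast
  interpret harmonic_boundary h g F q by unfold_locales (use F in auto)
  define d where "d n = (cmod (taylor h n))\<^sup>2 - (cmod (taylor g n))\<^sup>2" for n
  have inj: "inj_on hp (ball 0 1)" using bij by (rule bij_betw_imp_inj_on)
  obtain \<sigma> :: real where \<sigma>: "\<bar>\<sigma>\<bar> = 1"
    "(\<lambda>n. pi * (real n * (d n * (r\<^sup>2) ^ n))) sums (\<sigma> * measure lebesgue (hp ` ball 0 r))"
    using area_formula[OF inj rr] unfolding d_def by blast
  define m where "m = measure lebesgue (hp ` ball 0 r)"
  have S: "(\<lambda>n. real n * (d n * (r\<^sup>2) ^ n)) sums (\<sigma> * m / pi)"
    using sums_divide[OF \<sigma>(2), of pi] by (simp add: m_def)
  have \<rho>: "0 < r\<^sup>2" "r\<^sup>2 < 1" using rr by (auto simp: power_less_one_iff)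
  define \<kappa> where "\<kappa> = r\<^sup>2 * (1 - r\<^sup>2) / (1 + r\<^sup>2) ^ 3"
  have \<kappa>: "0 < \<kappa>" using \<rho> rr unfolding \<kappa>_def
    by (intro divide_pos_pos mult_pos_pos zero_less_power) (auto intro: add_pos_pos)
  have "\<bar>\<sigma> * m / pi - \<kappa> * d 1\<bar> \<le> r\<^sup>2 - \<kappa>"
    by (rule taylor_inequality[OF \<rho> \<kappa>_def d_def S])
  \<comment> \<open>Moving \<open>\<kappa> * d 1\<close> to the right leaves the defect
    \<open>\<kappa> * (1 - \<bar>d 1\<bar>)\<close>, which vanishes only for extremal maps.\<close>
  then have "\<bar>\<sigma> * m / pi\<bar> \<le> r\<^sup>2 - \<kappa> + \<bar>\<kappa> * d 1\<bar>" by linarith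
  moreover have "\<bar>\<sigma> * m / pi\<bar> = m / pi" using \<sigma>(1) by (simp add: abs_mult m_def)
  ultimately have "m / pi \<le> r\<^sup>2 - \<kappa> * (1 - \<bar>d 1\<bar>)" using \<kappa> by (simp add: abs_mult algebra_simps)
  then have "m \<le> pi * (r\<^sup>2 - \<kappa> * (1 - \<bar>d 1\<bar>))" by (simp add: divide_le_eq mult.commute)
  then show thesis using that[OF \<kappa>] unfolding m_def d_def by blast
qed

lemma first_coefficient_le: "\<bar>(cmod (taylor h 1))\<^sup>2 - (cmod (taylor g 1))\<^sup>2\<bar> \<le> 1"
proof -
  have "(cmod (taylor h 1))\<^sup>2 + (cmod (taylor g 1))\<^sup>2 \<le> 1" using taylor_energy_le[of "{1}"] by simp
  then show ?thesis using zero_le_power2[of "cmod (taylor h 1)"] zero_le_power2[of "cmod (taylor g 1)"] by linarith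
qed

text \<open>Total energy at most 1 with first coefficients differing by at least 1 in squared
  modulus leaves one of them of modulus 1 and the other 0, and no energy for any further
  coefficient: the map is a rotation, possibly composed with conjugation.\<close>

lemma isometry_if_extremal:
  assumes ext: "1 \<le> \<bar>(cmod (taylor h 1))\<^sup>2 - (cmod (taylor g 1))\<^sup>2\<bar>"
    and z: "cmod z < 1" and w: "cmod w < 1"
  shows "dist (hp z) (hp w) = dist z w"
proof -
  define a b where "a = taylor h 1" and "b = taylor g 1"
  have e1: "(cmod a)\<^sup>2 + (cmod b)\<^sup>2 \<le> 1" using taylor_energy_le[of "{1}"] by (simp add: a_def b_def)
  have e: "(cmod a)\<^sup>2 = 1 \<and> (cmod b)\<^sup>2 = 0 \<or> (cmod a)\<^sup>2 = 0 \<and> (cmod b)\<^sup>2 = 1"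
    using e1 ext zero_le_power2[of "cmod a"] zero_le_power2[of "cmod b"] unfolding a_def[symmetric] b_def[symmetric] by linarith
  have rest: "taylor h n = 0 \<and> taylor g n = 0" if "n \<noteq> 1" for n
  proof -
    have "(cmod (taylor h n))\<^sup>2 + (cmod (taylor g n))\<^sup>2 + ((cmod a)\<^sup>2 + (cmod b)\<^sup>2) \<le> 1"
      using taylor_energy_le[of "{n, 1}"] that by (simp add: a_def b_def)
    then have "(cmod (taylor h n))\<^sup>2 + (cmod (taylor g n))\<^sup>2 \<le> 0" using e by linarith
    then show ?thesis by (simp add: sum_power2_le_zero_iff)
  qed
  have lin: "k y = taylor k 1 * y" if "k holomorphic_on ball 0 1" "\<And>n. n \<noteq> 1 \<Longrightarrow> taylor k n = 0" "cmod y < 1" for k y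
  proof -
    have "(\<lambda>n. taylor k n * y ^ n) = (\<lambda>n. if n = 1 then taylor k 1 * y else 0)" using that(2) by auto
    then have "(\<lambda>n. taylor k n * y ^ n) sums (taylor k 1 * y)" using sums_single[of 1 "\<lambda>_. taylor k 1 * y"] by simp
    then show ?thesis using sums_unique2[OF taylor_sums[OF that(1,3)]] by blast
  qed
  have hp: "hp y = a * y + cnj (b * y)" if "cmod y < 1" for y
    unfolding hp_def a_def b_def using lin[OF h _ that] lin[OF g _ that] rest by simp
  have D: "dist (hp z) (hp w) = cmod (a * (z - w) + cnj (b * (z - w)))"
    unfolding dist_norm by (simp add: hp z w algebra_simps)
  have sq: "cmod c = 1" if "(cmod c)\<^sup>2 = 1" for c
    using power2_eq_imp_eq[of "cmod c" 1] that by simp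
  have "cmod a = 1 \<and> b = 0 \<or> a = 0 \<and> cmod b = 1" using e sq by auto
  then show ?thesis unfolding D
    by (elim disjE conjE) (simp_all only: mult_zero_left complex_cnj_zero add_0_left add_0_right
      complex_mod_cnj norm_mult mult_1 dist_norm)
qed

end

theorem theorem1:
  fixes f :: "complex \<Rightarrow> complex"
  assumes harm: "harmonic_on f (ball 0 1)"
    and bij: "bij_betw f (ball 0 1) (ball 0 1)"
  shows "(\<forall>r. 0 < r \<and> r < 1 \<longrightarrow>
            measure lebesgue (f ` ball 0 r) \<le> measure lebesgue (ball (0::complex) r))
       \<and> ((\<exists>r. 0 < r \<and> r < 1 \<and>
            measure lebesgue (f ` ball 0 r) = measure lebesgue (ball (0::complex) r))
          \<longrightarrow> (\<forall>z\<in>ball 0 1. \<forall>w\<in>ball 0 1. dist (f z) (f w) = dist z w))"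
proof -
  obtain h g where hg: "h holomorphic_on ball 0 1" "g holomorphic_on ball 0 1" "g 0 = 0"
    and eq: "\<And>z. z \<in> ball 0 1 \<Longrightarrow> f z = h z + cnj (g z)" using harmonic_decomposition[OF harm] by blast
  interpret p: harmonic_pair h g by unfold_locales (fact hg)+
  have fp: "f z = p.hp z" if "z \<in> ball 0 1" for z using eq[OF that] by (simp add: p.hp_def)
  have "bij_betw p.hp (ball 0 1) (ball 0 1)" using bij bij_betw_cong[of "ball 0 1" f p.hp] fp by blast
  then interpret d: harmonic_disk h g by unfold_locales
  have im: "f ` ball 0 r = p.hp ` ball 0 r" if "r < 1" for r
    by (rule image_cong[OF refl]) (use that fp in auto)
  have disc: "measure lebesgue (ball (0::complex) r) = pi * r\<^sup>2" if "0 < r" for r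
    using content_ball[of r "0::complex"] that by (simp add: measure_completion unit_ball_vol_2)
  have le: "measure lebesgue (f ` ball 0 r) \<le> measure lebesgue (ball (0::complex) r)" if r: "0 < r" "r < 1" for r
  proof -
    obtain \<kappa> where \<kappa>: "0 < \<kappa>" "measure lebesgue (p.hp ` ball 0 r)
      \<le> pi * (r\<^sup>2 - \<kappa> * (1 - \<bar>(cmod (taylor h 1))\<^sup>2 - (cmod (taylor g 1))\<^sup>2\<bar>))"
      using d.area_bound[OF r] by blast
    note \<kappa>(2)
    also have "\<dots> \<le> pi * r\<^sup>2" using \<kappa>(1) d.first_coefficient_le by (intro mult_left_mono) auto
    finally show ?thesis unfolding im[OF r(2)] disc[OF r(1)] .
  qed
  have iso: "dist (f z) (f w) = dist z w"
    if r: "0 < r" "r < 1" and m: "measure lebesgue (f ` ball 0 r) = measure lebesgue (ball (0::complex) r)"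
      and zw: "z \<in> ball 0 1" "w \<in> ball 0 1" for r z w
  proof -
    obtain \<kappa> where \<kappa>: "0 < \<kappa>" "measure lebesgue (p.hp ` ball 0 r)
      \<le> pi * (r\<^sup>2 - \<kappa> * (1 - \<bar>(cmod (taylor h 1))\<^sup>2 - (cmod (taylor g 1))\<^sup>2\<bar>))"
      using d.area_bound[OF r] by blast
    then have "pi * r\<^sup>2 \<le> pi * (r\<^sup>2 - \<kappa> * (1 - \<bar>(cmod (taylor h 1))\<^sup>2 - (cmod (taylor g 1))\<^sup>2\<bar>))"
      using m unfolding im[OF r(2)] disc[OF r(1)] by simp
    then have "\<kappa> * (1 - \<bar>(cmod (taylor h 1))\<^sup>2 - (cmod (taylor g 1))\<^sup>2\<bar>) \<le> 0" by simp
    then have "1 \<le> \<bar>(cmod (taylor h 1))\<^sup>2 - (cmod (taylor g 1))\<^sup>2\<bar>" using \<kappa>(1) by (simp add: mult_le_0_iff)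
    then show ?thesis using d.isometry_if_extremal[of z w] zw fp by simp
  qed
  show ?thesis using le iso by blast
qed

end
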